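(* Let $p$ be a prime number. Let $a, b$ be integers with $1 \le b < a$, and assume that $p$ divides $a-b$ but does not divide $ab$. Define $\eta \in (0,1)$ by $|a-b|_p^{-1} = a^{\eta}$, and assume that $a^{\eta} \ge 4$. Then for every integer $n \ge 3$ not divisible by $p$, $$\mu_{\rm eff}\Bigl(\sqrt[n]{a/b}\Bigr) < \frac{53.8}{\eta}\,\max\Bigl\{\frac{\log 2n}{\eta\log a},\ 4\Bigr\}^2,$$ where $\sqrt[n]{a/b}$ denotes the unique root $\zeta\in\mathbb{Q}_p$ of $bX^n - a$ with $|\zeta - 1|_p < 1$.
   Context: $|\cdot|_p$ is the absolute value on $\mathbb{Q}_p$ normalized by $|p|_p = p^{-1}$. When $p \mid a-b$ and $p\nmid abn$, Hensel's lemma gives a root $\zeta \in \mathbb{Q}_p$ of $bX^n - a$ with $|\zeta-1|_p<1$; this root is denoted $\sqrt[n]{a/b}$. For an irrational $\xi \in \mathbb{Q}_p$, a real number $\mu$ is an effective irrationality measure for $\xi$ if for every $\varepsilon>0$ there is an effectively computable constant $C(\xi,\varepsilon)>0$ such that every rational number $r/q$ with $q\ge1$ satisfies $|\xi - r/q|_p > C(\xi,\varepsilon)\, q^{-\mu-\varepsilon}$. $\mu_{\rm eff}(\xi)$ denotes the infimum of the effective irrationality measures of $\xi$.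
   Formalization: In the definition of irrationality measure, q^{-μ-ε} is replaced by max(|r|,q)^{-μ-ε}, since with q alone (q=1, integers r tending to ξ) no measure exists for these roots; r/q = ξ is skipped, so rational roots are covered too. *)

theory Defs
  imports
    Complex_Main
    "HOL-Library.Extended_Real"
    "HOL-Computational_Algebra.Primes"
    "HOL-Algebra.QuotRing"
begin

section \<open>The field of p-adic numbers\<close>

text \<open>
  The prime p ranges inside the main statement, so the p-adic numbers are not a type but a
  HOL-Algebra ring depending on p: the completion of the rationals, that is, the ring of p-adic
  Cauchy sequences of rationals modulo the ideal of p-adic null sequences.
\<close>

definition rat_padic_abs :: "nat \<Rightarrow> rat \<Rightarrow> real" where
  "rat_padic_abs p x =
     (if x = 0 then 0
      else real p powi (int (multiplicity (int p) (snd (quotient_of x)))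
                        - int (multiplicity (int p) (fst (quotient_of x)))))"

definition padic_cauchy :: "nat \<Rightarrow> (nat \<Rightarrow> rat) \<Rightarrow> bool" where
  "padic_cauchy p X \<longleftrightarrow>
     (\<forall>e>0. \<exists>N. \<forall>k\<ge>N. \<forall>m\<ge>N. rat_padic_abs p (X k - X m) < e)"

definition padic_cauchy_ring :: "nat \<Rightarrow> (nat \<Rightarrow> rat) ring" where
  "padic_cauchy_ring p =
     \<lparr>carrier = {X. padic_cauchy p X},
      mult = (\<lambda>X Y n. X n * Y n), one = (\<lambda>_. 1),
      zero = (\<lambda>_. 0), add = (\<lambda>X Y n. X n + Y n)\<rparr>"

definition padic_null :: "nat \<Rightarrow> (nat \<Rightarrow> rat) set" where
  "padic_null p = {X. (\<lambda>n. rat_padic_abs p (X n)) \<longlonglongrightarrow> 0}"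

type_synonym padic = "(nat \<Rightarrow> rat) set"

definition Qp :: "nat \<Rightarrow> padic ring" where
  "Qp p = padic_cauchy_ring p Quot padic_null p"

definition padic_of_rat :: "nat \<Rightarrow> rat \<Rightarrow> padic" where
  "padic_of_rat p x = padic_null p +>\<^bsub>padic_cauchy_ring p\<^esub> (\<lambda>_. x)"

definition padic_abs :: "nat \<Rightarrow> padic \<Rightarrow> real" where
  "padic_abs p z = lim (\<lambda>n. rat_padic_abs p ((SOME X. X \<in> z) n))"

definition padic_dist :: "nat \<Rightarrow> padic \<Rightarrow> padic \<Rightarrow> real" where
  "padic_dist p x y = padic_abs p (x \<ominus>\<^bsub>Qp p\<^esub> y)"

definition padic_nth_root :: "nat \<Rightarrow> nat \<Rightarrow> int \<Rightarrow> int \<Rightarrow> padic" where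
  "padic_nth_root p n a b =
     (THE z. z \<in> carrier (Qp p) \<and>
             padic_of_rat p (of_int b) \<otimes>\<^bsub>Qp p\<^esub> (z [^]\<^bsub>Qp p\<^esub> n) = padic_of_rat p (of_int a) \<and>
             padic_dist p z \<one>\<^bsub>Qp p\<^esub> < 1)"


section \<open>Effectively computable constants\<close>

text \<open>
  \<open>recursive_fn k f\<close>: f is a total recursive function of k arguments, given as a
  list. Minimization is applied to regular functions only, so every function stays total.
  The values of f on lists of a length other than k are irrelevant.
\<close>

inductive recursive_fn :: "nat \<Rightarrow> (nat list \<Rightarrow> nat) \<Rightarrow> bool" where
  zero: "recursive_fn k (\<lambda>xs. 0)"
| succ: "recursive_fn 1 (\<lambda>xs. Suc (hd xs))"
| proj: "i < k \<Longrightarrow> recursive_fn k (\<lambda>xs. xs ! i)"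
| comp: "recursive_fn (length gs) f \<Longrightarrow> (\<And>g. g \<in> set gs \<Longrightarrow> recursive_fn k g) \<Longrightarrow>
         recursive_fn k (\<lambda>xs. f (map (\<lambda>g. g xs) gs))"
| primitive_rec: "recursive_fn k f \<Longrightarrow> recursive_fn (Suc (Suc k)) g \<Longrightarrow>
         recursive_fn (Suc k) (\<lambda>xs. rec_nat (f (tl xs)) (\<lambda>m r. g (m # r # tl xs)) (hd xs))"
| minimization: "recursive_fn (Suc k) f \<Longrightarrow> (\<And>xs. length xs = k \<Longrightarrow> \<exists>m. f (m # xs) = 0) \<Longrightarrow>
         recursive_fn k (\<lambda>xs. LEAST m. f (m # xs) = 0)"

text \<open>
  A nonnegative real-valued function of k natural numbers is computable if a recursive function
  approximates it to any prescribed precision.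
\<close>

definition computable_real_fn :: "nat \<Rightarrow> (nat list \<Rightarrow> real) \<Rightarrow> bool" where
  "computable_real_fn k C \<longleftrightarrow>
     (\<exists>f. recursive_fn (Suc k) f \<and>
        (\<forall>xs m. length xs = k \<longrightarrow> \<bar>C xs - real (f (m # xs)) / real (Suc m)\<bar> \<le> 1 / real (Suc m)))"


section \<open>Effective irrationality measures\<close>

text \<open>
  For one fixed number and one fixed positive real, ``there is an effectively computable constant''
  asserts no more than ``there is a constant'', because a constant may be replaced by a smaller
  rational one. Effectivity means that a single algorithm produces the constant from the data
  describing the number and from \<open>\<epsilon>\<close>. Hence the notions below refer to a function C
  that is meant to be computable: \<open>C (d @ [u, v])\<close> is the constant \<open>C(\<xi>, \<epsilon>)\<close>
  for the number \<open>\<xi>\<close> described by the list d and for \<open>\<epsilon> = u / v\<close>. Restricting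
  to rational \<open>\<epsilon>\<close> loses nothing, since a constant for \<open>\<epsilon>\<close> also works for every
  larger one.

  The size of \<open>r / q\<close> is measured by the height \<open>max \<bar>r\<bar> q\<close>. With q alone no
  measure would exist for a p-adic integer \<open>\<xi>\<close>, since integers r approximate it
  arbitrarily well with q = 1. Skipping \<open>r / q = \<xi>\<close> has no effect on irrational \<open>\<xi>\<close>
  and extends the definition to rational \<open>\<xi>\<close>.
\<close>

definition effective_irrationality_measure ::
    "(nat list \<Rightarrow> real) \<Rightarrow> nat list \<Rightarrow> nat \<Rightarrow> padic \<Rightarrow> real \<Rightarrow> bool" where
  "effective_irrationality_measure C d p \<xi> \<mu> \<longleftrightarrow>
     (\<forall>u v. u \<ge> 1 \<longrightarrow> v \<ge> 1 \<longrightarrow>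
        C (d @ [u, v]) > 0 \<and>
        (\<forall>r q::int. q \<ge> 1 \<longrightarrow> \<xi> \<noteq> padic_of_rat p (of_int r / of_int q) \<longrightarrow>
           padic_dist p \<xi> (padic_of_rat p (of_int r / of_int q))
             > C (d @ [u, v]) * real_of_int (max \<bar>r\<bar> q) powr (- \<mu> - real u / real v)))"

definition mu_eff :: "(nat list \<Rightarrow> real) \<Rightarrow> nat list \<Rightarrow> nat \<Rightarrow> padic \<Rightarrow> ereal" where
  "mu_eff C d p \<xi> = Inf (ereal ` {\<mu>. effective_irrationality_measure C d p \<xi> \<mu>})"

end

theory Submission
  imports Defs "Jordan_Normal_Form.Determinant"
begin

text \<open>
  The proof is the method of interpolation determinants for two multiplicatively close rationals
  \<open>\<alpha> = a / b\<close> and \<open>\<beta> = x / y\<close>, where \<open>\<beta>\<close> approximates the root.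
  If \<open>\<alpha> - \<beta> ^ n\<close> is p-adically very small, the functions
  \<open>(z choose k) \<beta> ^ (l z)\<close> (\<open>k < K\<close>, \<open>l < L\<close>) take at
  \<open>z = n r + s\<close> almost the values \<open>(z choose k) \<alpha> ^ (l r) \<beta> ^ (l s)\<close>.
  Since \<open>\<beta>\<close> is close to 1, expanding in the binomials \<open>z choose m\<close> shows that every
  determinant formed from these values is divisible by a high power of p, without any loss from
  factorials. A zero estimate produces points for which the determinant does not vanish, and the
  Archimedean size of the cleared determinant then contradicts the divisibility. Nothing
  p-adic beyond valuations of rationals enters this argument. If \<open>n\<close> is so small
  that the points \<open>n r + s\<close> are not distinct, Liouville's inequality already gives the measure.
\<close>

section \<open>Divisibility by powers of p in the rationals\<close>

text \<open>Let M be the maximum in the statement, \<kappa> = E log p = \<eta> log a, N = K L and w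
  = L - 1. Each row loses the index k at which its binomial expansion starts, so the determinant
  gains \<kappa> N K w / 2 p-adically. Divide by \<kappa> N K / 2: the gain is w and the binomials
  cost M. If S is about \<sigma> M / \<eta> and \<kappa> L T about \<sigma> M log H, where H is the
  height of \<beta>, the powers of a and of H cost about w L / (2 \<sigma> M) each. For w = \<omega>
  M this requires 1 + \<omega>^2 / \<sigma> < \<omega> up to lower order terms. The best choice is
  \<omega> = 2, which allows every \<sigma> > 4. The value \<sigma> = 7 has another origin: keeping
  the binomial cost at M uses that S is at least e * 41/40 * L, and L can reach 5 M / 2. Only T
  grows with H. Since the contradiction keeps the p-adic order of the difference below E S T L, the
  relation of T to log H yields the exponent 7 M S, about 49 M^2 / \<eta>.\<close>

text \<open>Membership in \<open>p ^ e\<close> times the ring of p-integral rationals, so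
  \<open>padic_dvd p 0\<close> is p-integrality. Such a predicate treats 0 like any other element
  and needs no infinite valuation.\<close>

definition padic_dvd :: "nat \<Rightarrow> nat \<Rightarrow> rat \<Rightarrow> bool" where
  "padic_dvd p e x \<longleftrightarrow> (\<exists>m n. x = of_int (int p ^ e * m) / of_int n \<and> \<not> int p dvd n)"

lemma padic_dvdI: "x = of_int (int p ^ e * m) / of_int n \<Longrightarrow> \<not> int p dvd n \<Longrightarrow> padic_dvd p e x"
  unfolding padic_dvd_def by blast

context
  fixes p :: nat
  assumes prime_p: "prime p"
begin

lemma padic_dvd_of_int_iff: "padic_dvd p e (of_int i) \<longleftrightarrow> int p ^ e dvd i"
proof
  assume "padic_dvd p e (of_int i)"
  then obtain m n where mn: "(of_int i :: rat) = of_int (int p ^ e * m) / of_int n" "\<not> int p dvd n"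
    unfolding padic_dvd_def by blast
  from mn(2) have "n \<noteq> 0" by auto
  with mn(1) have "of_int (i * n) = (of_int (int p ^ e * m) :: rat)" by (simp add: field_simps)
  hence eq: "i * n = int p ^ e * m" by (simp only: of_int_eq_iff)
  have "coprime (int p ^ e) n"
    using mn(2) prime_p by (simp add: prime_imp_coprime)
  with eq show "int p ^ e dvd i"
    by (metis coprime_dvd_mult_left_iff dvd_triv_left)
next
  assume "int p ^ e dvd i"
  then obtain m where "i = int p ^ e * m" by blast
  thus "padic_dvd p e (of_int i)"
    using prime_p by (intro padic_dvdI[of _ _ _ m 1]) (auto simp: prime_gt_1_nat)
qed

lemma padic_dvd_zero [simp]: "padic_dvd p e 0"
  using padic_dvd_of_int_iff[of e 0] by simp

lemma padic_dvd_of_int: "padic_dvd p 0 (of_int i)"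
  by (simp add: padic_dvd_of_int_iff)

lemma padic_dvd_of_nat: "padic_dvd p 0 (of_nat i)"
  using padic_dvd_of_int[of "int i"] by simp

lemma padic_dvd_one: "padic_dvd p 0 1"
  using padic_dvd_of_int[of 1] by simp

lemma padic_dvd_prime_power: "padic_dvd p e (of_nat p ^ e)"
  using padic_dvd_of_int_iff[of e "int p ^ e"] by simp

lemma padic_dvd_mono: "padic_dvd p e x \<Longrightarrow> d \<le> e \<Longrightarrow> padic_dvd p d x"
proof -
  assume x: "padic_dvd p e x" and le: "d \<le> e"
  from x obtain m n where mn: "x = of_int (int p ^ e * m) / of_int n" "\<not> int p dvd n"
    unfolding padic_dvd_def by blast
  have "int p ^ e * m = int p ^ d * (int p ^ (e - d) * m)"
    using le by (metis le_add_diff_inverse mult.assoc power_add)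
  hence "x = of_int (int p ^ d * (int p ^ (e - d) * m)) / of_int n" using mn(1) by metis
  thus ?thesis using mn(2) by (rule padic_dvdI)
qed

lemma padic_dvd_mult:
  assumes "padic_dvd p d x" "padic_dvd p e y"
  shows "padic_dvd p (d + e) (x * y)"
proof -
  obtain m n where mn: "x = of_int (int p ^ d * m) / of_int n" "\<not> int p dvd n"
    using assms(1) unfolding padic_dvd_def by blast
  obtain m' n' where mn': "y = of_int (int p ^ e * m') / of_int n'" "\<not> int p dvd n'"
    using assms(2) unfolding padic_dvd_def by blast
  have "\<not> int p dvd n * n'" using mn(2) mn'(2) prime_p
    by (simp add: prime_dvd_mult_iff)
  moreover have "x * y = of_int (int p ^ (d + e) * (m * m')) / of_int (n * n')"
    using mn(1) mn'(1) by (simp add: power_add)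
  ultimately show ?thesis by (intro padic_dvdI)
qed

lemma padic_dvd_mult_left: "padic_dvd p e x \<Longrightarrow> padic_dvd p 0 y \<Longrightarrow> padic_dvd p e (y * x)"
  using padic_dvd_mult[of 0 y e x] by simp

lemma padic_dvd_mult_right: "padic_dvd p e x \<Longrightarrow> padic_dvd p 0 y \<Longrightarrow> padic_dvd p e (x * y)"
  using padic_dvd_mult[of e x 0 y] by simp

lemma padic_dvd_add:
  assumes "padic_dvd p e x" "padic_dvd p e y"
  shows "padic_dvd p e (x + y)"
proof -
  obtain m n where mn: "x = of_int (int p ^ e * m) / of_int n" "\<not> int p dvd n"
    using assms(1) unfolding padic_dvd_def by blast
  obtain m' n' where mn': "y = of_int (int p ^ e * m') / of_int n'" "\<not> int p dvd n'"
    using assms(2) unfolding padic_dvd_def by blast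
  have nz: "n \<noteq> 0" "n' \<noteq> 0" using mn(2) mn'(2) by auto
  have "\<not> int p dvd n * n'" using mn(2) mn'(2) prime_p
    by (simp add: prime_dvd_mult_iff)
  moreover have "x + y = of_int (int p ^ e * (m * n' + m' * n)) / of_int (n * n')"
    using mn(1) mn'(1) nz by (simp add: field_simps)
  ultimately show ?thesis by (intro padic_dvdI)
qed

lemma padic_dvd_uminus: "padic_dvd p e x \<Longrightarrow> padic_dvd p e (- x)"
  using padic_dvd_mult_left[OF _ padic_dvd_of_int[of "-1"]] by simp

lemma padic_dvd_diff: "padic_dvd p e x \<Longrightarrow> padic_dvd p e y \<Longrightarrow> padic_dvd p e (x - y)"
  using padic_dvd_add[of e x "- y"] padic_dvd_uminus by simp

lemma padic_dvd_sum: "(\<And>i. i \<in> A \<Longrightarrow> padic_dvd p e (f i)) \<Longrightarrow> padic_dvd p e (sum f A)"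
  by (induction A rule: infinite_finite_induct) (auto intro: padic_dvd_add)

lemma padic_dvd_prod: "(\<And>i. i \<in> A \<Longrightarrow> padic_dvd p (e i) (f i)) \<Longrightarrow> padic_dvd p (sum e A) (prod f A)"
  by (induction A rule: infinite_finite_induct) (auto intro: padic_dvd_mult padic_dvd_one)

lemma padic_dvd_power: "padic_dvd p e x \<Longrightarrow> padic_dvd p (e * k) (x ^ k)"
  by (induction k) (auto intro: padic_dvd_mult padic_dvd_one)

lemma padic_dvd_power0: "padic_dvd p 0 x \<Longrightarrow> padic_dvd p 0 (x ^ k)"
  using padic_dvd_power[of 0 x k] by simp

lemma padic_dvd_power_diff:
  assumes "padic_dvd p e (x - y)" "padic_dvd p 0 x" "padic_dvd p 0 y"
  shows "padic_dvd p e (x ^ k - y ^ k)"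
proof -
  have "padic_dvd p 0 (\<Sum>i<k. x ^ i * y ^ (k - Suc i))"
    using assms by (intro padic_dvd_sum padic_dvd_mult_left padic_dvd_power0)
  moreover have "x ^ k - y ^ k = (x - y) * (\<Sum>i<k. x ^ i * y ^ (k - Suc i))"
    by (simp add: power_diff_sumr2 mult.commute)
  ultimately show ?thesis using padic_dvd_mult_right[OF assms(1)] by simp
qed

lemma padic_dvd_divide:
  assumes "\<not> int p dvd n" shows "padic_dvd p 0 (of_int m / of_int n)"
  using assms by (intro padic_dvdI[of _ _ _ m n]) auto

end


section \<open>Absolute value and completion\<close>

definition padic_class_of :: "nat \<Rightarrow> (nat \<Rightarrow> rat) \<Rightarrow> padic" where
  "padic_class_of p X = padic_null p +>\<^bsub>padic_cauchy_ring p\<^esub> X"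

context
  fixes p :: nat
  assumes prime_p: "prime p"
begin

abbreviation padic_class :: "(nat \<Rightarrow> rat) \<Rightarrow> padic" where
  "padic_class \<equiv> padic_class_of p"

section \<open>The absolute value of rationals, and n-th powers of numbers close to 1\<close>

text \<open>The definition reads the valuation off the reduced fraction. Comparing multiplicities in
  the cross products shows that every fraction gives the same value, which makes multiplicativity a
  computation.\<close>

lemma padic_abs_fraction:
  assumes "i \<noteq> 0" "j \<noteq> 0"
  shows "rat_padic_abs p (of_int i / of_int j) =
    real p powi (int (multiplicity (int p) j) - int (multiplicity (int p) i))"
proof -
  obtain m d where md: "quotient_of (of_int i / of_int j) = (m, d)" by force
  have d: "d > 0" using quotient_of_denom_pos[OF md] .
  have eq: "(of_int i / of_int j :: rat) = of_int m / of_int d" using quotient_of_div[OF md] .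
  hence "(of_int (i * d) :: rat) = of_int (m * j)" using assms d by (simp add: field_simps)
  hence id: "i * d = m * j" by (simp only: of_int_eq_iff)
  hence m: "m \<noteq> 0" using assms d by auto
  have pe: "prime_elem (int p)" using prime_p by simp
  have "multiplicity (int p) i + multiplicity (int p) d = multiplicity (int p) m + multiplicity (int p) j"
    using prime_elem_multiplicity_mult_distrib[OF pe, of i d] prime_elem_multiplicity_mult_distrib[OF pe, of m j]
      id assms d m by simp
  hence "int (multiplicity (int p) d) - int (multiplicity (int p) m) =
    int (multiplicity (int p) j) - int (multiplicity (int p) i)" by linarith
  thus ?thesis using assms md unfolding rat_padic_abs_def by simp
qed

lemma rat_fraction_cases:
  fixes x :: rat
  obtains i j :: int where "x = of_int i / of_int j" "j \<noteq> 0"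
  using quotient_of_div[of x] quotient_of_denom_pos[of x] by (metis less_irrefl surj_pair)

lemma padic_abs_zero [simp]: "rat_padic_abs p 0 = 0"
  by (simp add: rat_padic_abs_def)

lemma padic_abs_one [simp]: "rat_padic_abs p 1 = 1"
  by (simp add: rat_padic_abs_def)

lemma padic_abs_pos: "x \<noteq> 0 \<Longrightarrow> rat_padic_abs p x > 0"
  using prime_gt_0_nat[OF prime_p] by (simp add: rat_padic_abs_def)

lemma padic_abs_nonneg [simp]: "rat_padic_abs p x \<ge> 0"
  using padic_abs_pos[of x] by (cases "x = 0") auto

lemma padic_abs_mult: "rat_padic_abs p (x * y) = rat_padic_abs p x * rat_padic_abs p y"
proof (cases "x = 0 \<or> y = 0")
  case False
  obtain i j where x: "x = of_int i / of_int j" "j \<noteq> 0" by (rule rat_fraction_cases)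
  obtain k l where y: "y = of_int k / of_int l" "l \<noteq> 0" by (rule rat_fraction_cases)
  have nz: "i \<noteq> 0" "k \<noteq> 0" using False x y by auto
  have pe: "prime_elem (int p)" using prime_p by simp
  have "rat_padic_abs p (x * y) = rat_padic_abs p (of_int (i * k) / of_int (j * l))"
    using x y by simp
  also have "\<dots> = real p powi (int (multiplicity (int p) (j * l)) - int (multiplicity (int p) (i * k)))"
    using nz x y by (intro padic_abs_fraction) auto
  also have "\<dots> = real p powi ((int (multiplicity (int p) j) - int (multiplicity (int p) i)) +
      (int (multiplicity (int p) l) - int (multiplicity (int p) k)))"
    using nz x y pe by (simp add: prime_elem_multiplicity_mult_distrib algebra_simps)
  also have "\<dots> = rat_padic_abs p x * rat_padic_abs p y"
    using nz x y prime_gt_0_nat[OF prime_p] by (simp add: padic_abs_fraction power_int_add)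
  finally show ?thesis .
qed auto

lemma padic_abs_uminus [simp]: "rat_padic_abs p (- x) = rat_padic_abs p x"
proof -
  have "rat_padic_abs p (- 1) * rat_padic_abs p (- 1) = 1"
    unfolding padic_abs_mult[symmetric] by simp
  hence "rat_padic_abs p (- 1) = 1"
    using padic_abs_nonneg[of "- 1"] by (auto simp: square_eq_1_iff)
  thus ?thesis using padic_abs_mult[of "- 1" x] by simp
qed

lemma padic_abs_minus_commute: "rat_padic_abs p (x - y) = rat_padic_abs p (y - x)"
  using padic_abs_uminus[of "x - y"] by simp

lemma padic_abs_add_le: "rat_padic_abs p (x + y) \<le> max (rat_padic_abs p x) (rat_padic_abs p y)"
proof (cases "x = 0 \<or> y = 0 \<or> x + y = 0")
  case False
  obtain i j where x: "x = of_int i / of_int j" "j \<noteq> 0" by (rule rat_fraction_cases)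
  obtain k l where y: "y = of_int k / of_int l" "l \<noteq> 0" by (rule rat_fraction_cases)
  define u v d where "u = i * l" and "v = k * j" and "d = j * l"
  have d: "d \<noteq> 0" and xu: "x = of_int u / of_int d" and yv: "y = of_int v / of_int d"
    and xy: "x + y = of_int (u + v) / of_int d"
    unfolding u_def v_def d_def using x y by (auto simp: field_simps)
  have nz: "u \<noteq> 0" "v \<noteq> 0" "u + v \<noteq> 0" using False xu yv xy by auto
  have p1: "\<not> is_unit (int p)" using prime_p by auto
  define m where "m = min (multiplicity (int p) u) (multiplicity (int p) v)"
  have "int p ^ m dvd u" "int p ^ m dvd v"
    unfolding m_def by (auto intro: multiplicity_dvd')
  hence "int p ^ m dvd u + v" by simp
  hence "m \<le> multiplicity (int p) (u + v)"
    using nz p1 by (intro multiplicity_geI) auto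
  hence "real p powi (int (multiplicity (int p) d) - int (multiplicity (int p) (u + v)))
    \<le> real p powi (int (multiplicity (int p) d) - int m)"
    using prime_ge_1_nat[OF prime_p] by (intro power_int_increasing) auto
  also have "\<dots> = max (rat_padic_abs p x) (rat_padic_abs p y) \<or> \<dots> = rat_padic_abs p x \<or> \<dots> = rat_padic_abs p y"
    unfolding xu yv padic_abs_fraction[OF nz(1) d] padic_abs_fraction[OF nz(2) d] m_def by (auto simp: min_def)
  hence "real p powi (int (multiplicity (int p) d) - int m) \<le> max (rat_padic_abs p x) (rat_padic_abs p y)"
    by auto
  finally show ?thesis unfolding xy padic_abs_fraction[OF nz(3) d] .
qed (auto simp: le_max_iff_disj)

lemma padic_abs_diff_le: "rat_padic_abs p (x - y) \<le> max (rat_padic_abs p x) (rat_padic_abs p y)"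
  using padic_abs_add_le[of x "- y"] by simp

lemma padic_abs_add_le_bound:
  "rat_padic_abs p x \<le> B \<Longrightarrow> rat_padic_abs p y \<le> B \<Longrightarrow> rat_padic_abs p (x + y) \<le> B"
  using padic_abs_add_le[of x y] by linarith

lemma padic_abs_add_less_bound:
  "rat_padic_abs p x < B \<Longrightarrow> rat_padic_abs p y < B \<Longrightarrow> rat_padic_abs p (x + y) < B"
  using padic_abs_add_le[of x y] by linarith

lemma padic_abs_diff_less_bound:
  "rat_padic_abs p x < B \<Longrightarrow> rat_padic_abs p y < B \<Longrightarrow> rat_padic_abs p (x - y) < B"
  using padic_abs_diff_le[of x y] by linarith

lemma padic_abs_triangle: "rat_padic_abs p (x + y) \<le> rat_padic_abs p x + rat_padic_abs p y"
  using padic_abs_add_le[of x y] padic_abs_nonneg[of x] padic_abs_nonneg[of y] by linarith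

lemma padic_abs_reverse_triangle:
  "\<bar>rat_padic_abs p x - rat_padic_abs p y\<bar> \<le> rat_padic_abs p (x - y)"
  using padic_abs_triangle[of "x - y" y] padic_abs_triangle[of "y - x" x]
    padic_abs_minus_commute[of x y] by simp

text \<open>In an ultrametric every triangle is isosceles. This serves to recognise units: whatever
  lies at distance less than 1 from a unit is a unit.\<close>

lemma padic_abs_eq_of_diff_less:
  assumes "rat_padic_abs p (x - y) < rat_padic_abs p y"
  shows "rat_padic_abs p x = rat_padic_abs p y"
proof -
  have "rat_padic_abs p x \<le> rat_padic_abs p y" using padic_abs_add_le[of "x - y" y] assms by simp
  moreover have "rat_padic_abs p y \<le> max (rat_padic_abs p x) (rat_padic_abs p (x - y))"
    using padic_abs_diff_le[of x "x - y"] by simp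
  ultimately show ?thesis using assms by linarith
qed

lemma padic_abs_power: "rat_padic_abs p (x ^ k) = rat_padic_abs p x ^ k"
  by (induction k) (auto simp: padic_abs_mult)

lemma padic_abs_sum_le:
  assumes "\<And>i. i \<in> A \<Longrightarrow> rat_padic_abs p (f i) \<le> B" "B \<ge> 0"
  shows "rat_padic_abs p (sum f A) \<le> B"
  using assms(1)
proof (induction A rule: infinite_finite_induct)
  case (insert a A)
  thus ?case using padic_abs_add_le_bound[of "f a" B "sum f A"] by simp
qed (use assms(2) in auto)

lemma padic_abs_of_int:
  assumes "i \<noteq> 0"
  shows "rat_padic_abs p (of_int i) = inverse (real p ^ multiplicity (int p) i)"
  using padic_abs_fraction[of i 1] assms by (simp add: power_int_minus)

lemma padic_abs_of_int_eq_1: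
  assumes "\<not> int p dvd i"
  shows "rat_padic_abs p (of_int i) = 1"
proof -
  have "multiplicity (int p) i = 0" "i \<noteq> 0" using assms by (auto intro: not_dvd_imp_multiplicity_0)
  thus ?thesis by (simp add: padic_abs_of_int)
qed

text \<open>The p-part of a nonzero integer divides it and so cannot exceed it. This is the lower
  bound behind Liouville's inequality.\<close>

lemma padic_abs_of_int_ge:
  assumes "i \<noteq> 0"
  shows "rat_padic_abs p (of_int i) \<ge> 1 / \<bar>real_of_int i\<bar>"
proof -
  have "int p ^ multiplicity (int p) i \<le> \<bar>i\<bar>"
    using assms multiplicity_dvd[of "int p" i] by (intro zdvd_imp_le) auto
  hence "real_of_int (int p ^ multiplicity (int p) i) \<le> real_of_int \<bar>i\<bar>" by (rule of_int_le_iff[THEN iffD2])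
  hence "real p ^ multiplicity (int p) i \<le> \<bar>real_of_int i\<bar>" by simp
  thus ?thesis unfolding padic_abs_of_int[OF assms] inverse_eq_divide
    using prime_gt_0_nat[OF prime_p] by (intro frac_le) auto
qed

lemma padic_abs_le_imp_padic_dvd:
  assumes "rat_padic_abs p x \<le> inverse (real p ^ e)"
  shows "padic_dvd p e x"
proof (cases "x = 0")
  case False
  obtain m d where md: "quotient_of x = (m, d)" by force
  have x: "x = of_int m / of_int d" using quotient_of_div[OF md] .
  have d: "d > 0" using quotient_of_denom_pos[OF md] .
  have m: "m \<noteq> 0" using False x by auto
  have p1: "real p > 1" using prime_gt_1_nat[OF prime_p] by simp
  have "real p powi (int (multiplicity (int p) d) - int (multiplicity (int p) m)) \<le> real p powi (- int e)"
    using assms padic_abs_fraction[of m d] m d unfolding x by (simp add: power_int_minus)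
  hence le: "int (multiplicity (int p) d) - int (multiplicity (int p) m) \<le> - int e"
    using power_int_strict_increasing[OF _ p1] by (meson not_le)
  show ?thesis
  proof (cases "int p dvd d")
    case True
    \<comment> \<open>A reduced fraction with p in its denominator has absolute value greater than
      1, against the assumption.\<close>
    hence "\<not> int p dvd m" using quotient_of_coprime[OF md] prime_p
      by (metis coprime_common_divisor not_prime_unit prime_nat_int_transfer)
    hence "multiplicity (int p) m = 0" by (rule not_dvd_imp_multiplicity_0)
    moreover have "multiplicity (int p) d \<ge> 1"
      using True d prime_p by (intro multiplicity_geI) auto
    ultimately show ?thesis using le by simp
  next
    case False
    have "int p ^ e dvd m" using le by (intro multiplicity_dvd') auto
    then obtain c where "m = int p ^ e * c" by blast
    thus ?thesis using x False by (intro padic_dvdI) auto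
  qed
qed (simp add: padic_dvd_zero prime_p)

lemma padic_dvd_imp_padic_abs_le:
  assumes "padic_dvd p e x"
  shows "rat_padic_abs p x \<le> inverse (real p ^ e)"
proof (cases "x = 0")
  case False
  obtain m n where x: "x = of_int (int p ^ e * m) / of_int n" "\<not> int p dvd n"
    using assms unfolding padic_dvd_def by blast
  hence nz: "int p ^ e * m \<noteq> 0" "n \<noteq> 0" "m \<noteq> 0" using False by auto
  have "e \<le> multiplicity (int p) (int p ^ e * m)"
    using nz prime_p by (intro multiplicity_geI) auto
  moreover have "multiplicity (int p) n = 0" using x(2) by (rule not_dvd_imp_multiplicity_0)
  ultimately have "rat_padic_abs p x \<le> real p powi (- int e)"
    using padic_abs_fraction[OF nz(1,2)] prime_ge_1_nat[OF prime_p] x(1) by (auto intro!: power_int_increasing)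
  thus ?thesis by (simp add: power_int_minus)
qed (use prime_gt_0_nat[OF prime_p] in simp)

text \<open>Nonzero absolute values are integral powers of p, so none lies strictly between 1 / p
  and 1. The gap lets strict bounds survive a passage to the limit.\<close>

lemma padic_abs_less_1D:
  assumes "rat_padic_abs p x < 1"
  shows "rat_padic_abs p x \<le> inverse (real p)"
proof (cases "x = 0")
  case False
  obtain i j where x: "x = of_int i / of_int j" "j \<noteq> 0" by (rule rat_fraction_cases)
  hence "i \<noteq> 0" using False by auto
  note eq = padic_abs_fraction[OF this x(2), folded x(1)]
  have p1: "real p > 1" using prime_gt_1_nat[OF prime_p] by simp
  have "real p powi (int (multiplicity (int p) j) - int (multiplicity (int p) i)) < real p powi 0"
    using assms eq by simp
  hence "\<not> 0 \<le> int (multiplicity (int p) j) - int (multiplicity (int p) i)"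
    using p1 power_int_increasing[of 0 _ "real p"] by (meson less_eq_real_def not_le)
  hence "int (multiplicity (int p) j) - int (multiplicity (int p) i) \<le> -1" by linarith
  hence "rat_padic_abs p x \<le> real p powi (-1)" unfolding eq using p1 by (intro power_int_increasing) auto
  thus ?thesis by (simp add: power_int_minus)
qed (use prime_gt_0_nat[OF prime_p] in simp)

text \<open>The cofactor of x - y in x^n - y^n is a sum of n products of 1-units, hence congruent to
  n modulo p and a unit. So the n-th power map is an isometry on 1-units; this yields the root, its
  uniqueness and its distance to rationals.\<close>

lemma padic_abs_power_diff:
  assumes x: "rat_padic_abs p (x - 1) < 1" and y: "rat_padic_abs p (y - 1) < 1" and n: "\<not> p dvd n"
  shows "rat_padic_abs p (x ^ n - y ^ n) = rat_padic_abs p (x - y)"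
proof -
  define U where "U = {z. rat_padic_abs p (z - 1) < 1}"
  have Uabs: "rat_padic_abs p z = 1" if "z \<in> U" for z
    using padic_abs_eq_of_diff_less[of z 1] that unfolding U_def by simp
  have Umult: "z * w \<in> U" if "z \<in> U" "w \<in> U" for z w
  proof -
    have eq: "z * w - 1 = z * (w - 1) + (z - 1)" by (simp add: algebra_simps)
    have "rat_padic_abs p (z * (w - 1)) < 1"
      using that Uabs[OF that(1)] by (simp add: padic_abs_mult U_def)
    moreover have "rat_padic_abs p (z - 1) < 1" using that(1) unfolding U_def by simp
    ultimately have "rat_padic_abs p (z * w - 1) < 1" unfolding eq by (rule padic_abs_add_less_bound)
    thus ?thesis unfolding U_def by simp
  qed
  have Upow: "z ^ k \<in> U" if "z \<in> U" for z k
  proof (induction k)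
    case 0
    show ?case by (simp add: U_def)
  next
    case (Suc k)
    show ?case using Umult[OF that Suc] by simp
  qed
  define s where "s = (\<Sum>i<n. y ^ (n - Suc i) * x ^ i)"
  have "y ^ (n - Suc i) * x ^ i \<in> U" for i
    using x y by (intro Umult Upow) (auto simp: U_def)
  hence le: "rat_padic_abs p (y ^ (n - Suc i) * x ^ i - 1) \<le> inverse (real p)" for i
    using padic_abs_less_1D unfolding U_def by blast
  have "s - of_int (int n) = (\<Sum>i<n. y ^ (n - Suc i) * x ^ i - 1)"
    unfolding s_def by (simp add: sum_subtractf)
  hence "rat_padic_abs p (s - of_int (int n)) \<le> inverse (real p)"
    using padic_abs_sum_le[of "{..<n}" "\<lambda>i. y ^ (n - Suc i) * x ^ i - 1" "inverse (real p)"] le by simp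
  also have "\<dots> < 1" using prime_gt_1_nat[OF prime_p] by (simp add: field_simps)
  finally have "rat_padic_abs p (s - of_int (int n)) < rat_padic_abs p (of_int (int n))"
    using padic_abs_of_int_eq_1[of "int n"] n by simp
  from padic_abs_eq_of_diff_less[OF this] have "rat_padic_abs p s = 1"
    using padic_abs_of_int_eq_1[of "int n"] n by simp
  moreover have "x ^ n - y ^ n = (x - y) * s"
    unfolding s_def by (rule power_diff_sumr2)
  ultimately show ?thesis by (simp add: padic_abs_mult)
qed

section \<open>Cauchy sequences and null sequences\<close>

lemma padic_cauchy_const: "padic_cauchy p (\<lambda>_. x)"
  unfolding padic_cauchy_def by simp

lemma padic_cauchy_convergent:
  assumes "padic_cauchy p X"
  shows "convergent (\<lambda>n. rat_padic_abs p (X n))"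
proof (rule Cauchy_convergent, rule metric_CauchyI)
  fix e :: real assume "e > 0"
  then obtain N where N: "\<forall>k\<ge>N. \<forall>m\<ge>N. rat_padic_abs p (X k - X m) < e"
    using assms unfolding padic_cauchy_def by blast
  show "\<exists>N. \<forall>m\<ge>N. \<forall>n\<ge>N. dist (rat_padic_abs p (X m)) (rat_padic_abs p (X n)) < e"
    unfolding dist_real_def
    by (intro exI[of _ N] allI impI le_less_trans[OF padic_abs_reverse_triangle]) (use N in simp)
qed

lemma padic_cauchy_bounded:
  assumes "padic_cauchy p X"
  obtains B where "B > 0" "\<forall>n. rat_padic_abs p (X n) \<le> B"
proof -
  have "Bseq (\<lambda>n. rat_padic_abs p (X n))"
    using padic_cauchy_convergent[OF assms] by (rule convergent_imp_Bseq)
  from BseqE[OF this] obtain B where B: "0 < B" "\<forall>n. norm (rat_padic_abs p (X n)) \<le> B" .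
  show ?thesis by (rule that[of B]) (use B in auto)
qed

lemma padic_cauchy_add:
  assumes "padic_cauchy p X" "padic_cauchy p Y"
  shows "padic_cauchy p (\<lambda>n. X n + Y n)"
  unfolding padic_cauchy_def
proof (intro allI impI)
  fix e :: real assume e: "e > 0"
  obtain N where N: "\<forall>k\<ge>N. \<forall>m\<ge>N. rat_padic_abs p (X k - X m) < e"
    using assms(1) e unfolding padic_cauchy_def by blast
  obtain M where M: "\<forall>k\<ge>M. \<forall>m\<ge>M. rat_padic_abs p (Y k - Y m) < e"
    using assms(2) e unfolding padic_cauchy_def by blast
  show "\<exists>N. \<forall>k\<ge>N. \<forall>m\<ge>N. rat_padic_abs p (X k + Y k - (X m + Y m)) < e"
  proof (intro exI[of _ "max N M"] allI impI)
    fix k m assume "k \<ge> max N M" "m \<ge> max N M"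
    hence "rat_padic_abs p (X k - X m) < e" "rat_padic_abs p (Y k - Y m) < e" using N M by auto
    from padic_abs_add_less_bound[OF this] show "rat_padic_abs p (X k + Y k - (X m + Y m)) < e"
      by (simp add: algebra_simps)
  qed
qed

lemma padic_cauchy_mult:
  assumes "padic_cauchy p X" "padic_cauchy p Y"
  shows "padic_cauchy p (\<lambda>n. X n * Y n)"
  unfolding padic_cauchy_def
proof (intro allI impI)
  fix e :: real assume e: "e > 0"
  from padic_cauchy_bounded[OF assms(1)] obtain B where B: "B > 0" "\<forall>n. rat_padic_abs p (X n) \<le> B" .
  from padic_cauchy_bounded[OF assms(2)] obtain C where C: "C > 0" "\<forall>n. rat_padic_abs p (Y n) \<le> C" .
  obtain N where N: "\<forall>k\<ge>N. \<forall>m\<ge>N. rat_padic_abs p (X k - X m) < e / C"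
    using assms(1) divide_pos_pos[OF e C(1)] unfolding padic_cauchy_def by blast
  obtain M where M: "\<forall>k\<ge>M. \<forall>m\<ge>M. rat_padic_abs p (Y k - Y m) < e / B"
    using assms(2) divide_pos_pos[OF e B(1)] unfolding padic_cauchy_def by blast
  show "\<exists>N. \<forall>k\<ge>N. \<forall>m\<ge>N. rat_padic_abs p (X k * Y k - X m * Y m) < e"
  proof (intro exI[of _ "max N M"] allI impI)
    fix k m assume "k \<ge> max N M" "m \<ge> max N M"
    hence 1: "rat_padic_abs p (X k - X m) < e / C" "rat_padic_abs p (Y k - Y m) < e / B" using N M by auto
    have "rat_padic_abs p (X k * (Y k - Y m)) \<le> B * rat_padic_abs p (Y k - Y m)"
      unfolding padic_abs_mult using B(2) by (intro mult_right_mono) auto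
    also have "\<dots> < e" using 1(2) B(1) by (simp add: field_simps)
    finally have 2: "rat_padic_abs p (X k * (Y k - Y m)) < e" .
    have "rat_padic_abs p ((X k - X m) * Y m) \<le> rat_padic_abs p (X k - X m) * C"
      unfolding padic_abs_mult using C(2) by (intro mult_left_mono) auto
    also have "\<dots> < e" using 1(1) C(1) by (simp add: field_simps)
    finally have 3: "rat_padic_abs p ((X k - X m) * Y m) < e" .
    from padic_abs_add_less_bound[OF 2 3] show "rat_padic_abs p (X k * Y k - X m * Y m) < e"
      by (simp add: algebra_simps)
  qed
qed

lemma padic_cauchy_uminus: "padic_cauchy p X \<Longrightarrow> padic_cauchy p (\<lambda>n. - X n)"
  using padic_cauchy_mult[OF padic_cauchy_const[of "-1"]] by simp

lemma padic_cauchy_diff: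
  "padic_cauchy p X \<Longrightarrow> padic_cauchy p Y \<Longrightarrow> padic_cauchy p (\<lambda>n. X n - Y n)"
  using padic_cauchy_add[OF _ padic_cauchy_uminus] by fastforce

lemma padic_cauchy_power: "padic_cauchy p X \<Longrightarrow> padic_cauchy p (\<lambda>k. X k ^ n)"
  by (induction n) (auto intro: padic_cauchy_const padic_cauchy_mult)

lemma padic_null_iff: "X \<in> padic_null p \<longleftrightarrow> (\<lambda>n. rat_padic_abs p (X n)) \<longlonglongrightarrow> 0"
  unfolding padic_null_def by simp

lemma padic_null_cauchy:
  assumes "X \<in> padic_null p"
  shows "padic_cauchy p X"
  unfolding padic_cauchy_def
proof (intro allI impI)
  fix e :: real assume "e > 0"
  then obtain N where N: "\<forall>k\<ge>N. rat_padic_abs p (X k) < e"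
    using assms unfolding padic_null_iff lim_sequentially by (auto simp: dist_real_def)
  show "\<exists>N. \<forall>k\<ge>N. \<forall>m\<ge>N. rat_padic_abs p (X k - X m) < e"
  proof (intro exI[of _ N] allI impI)
    fix k m assume "k \<ge> N" "m \<ge> N"
    thus "rat_padic_abs p (X k - X m) < e" using N by (intro padic_abs_diff_less_bound) auto
  qed
qed

lemma padic_null_comparison:
  assumes "\<And>n. rat_padic_abs p (X n) \<le> g n" "g \<longlonglongrightarrow> 0"
  shows "X \<in> padic_null p"
  unfolding padic_null_iff
  by (rule tendsto_0_le[OF assms(2), of _ 1]) (simp add: order_trans[OF assms(1) abs_ge_self])

lemma padic_null_add:
  assumes "X \<in> padic_null p" "Y \<in> padic_null p"
  shows "(\<lambda>n. X n + Y n) \<in> padic_null p"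
proof -
  have "(\<lambda>n. rat_padic_abs p (X n) + rat_padic_abs p (Y n)) \<longlonglongrightarrow> 0 + 0"
    using assms unfolding padic_null_iff by (rule tendsto_add)
  hence "(\<lambda>n. rat_padic_abs p (X n) + rat_padic_abs p (Y n)) \<longlonglongrightarrow> 0" by simp
  thus ?thesis by (rule padic_null_comparison[OF padic_abs_triangle])
qed

lemma padic_null_mult:
  assumes "X \<in> padic_null p" "padic_cauchy p Y"
  shows "(\<lambda>n. X n * Y n) \<in> padic_null p"
proof -
  obtain l where "(\<lambda>n. rat_padic_abs p (Y n)) \<longlonglongrightarrow> l"
    using padic_cauchy_convergent[OF assms(2)] unfolding convergent_def by blast
  from tendsto_mult[OF assms(1)[unfolded padic_null_iff] this] show ?thesis
    unfolding padic_null_iff padic_abs_mult by simp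
qed

lemma padic_null_uminus: "X \<in> padic_null p \<Longrightarrow> (\<lambda>n. - X n) \<in> padic_null p"
  unfolding padic_null_iff by simp

lemma padic_null_diff:
  "X \<in> padic_null p \<Longrightarrow> Y \<in> padic_null p \<Longrightarrow> (\<lambda>n. X n - Y n) \<in> padic_null p"
  using padic_null_add[OF _ padic_null_uminus] by fastforce

section \<open>The quotient ring in terms of representatives\<close>

lemma padic_cauchy_ring_simps [simp]:
  "X \<in> carrier (padic_cauchy_ring p) \<longleftrightarrow> padic_cauchy p X"
  "X \<oplus>\<^bsub>padic_cauchy_ring p\<^esub> Y = (\<lambda>n. X n + Y n)"
  "X \<otimes>\<^bsub>padic_cauchy_ring p\<^esub> Y = (\<lambda>n. X n * Y n)"
  "\<one>\<^bsub>padic_cauchy_ring p\<^esub> = (\<lambda>_. 1)"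
  "\<zero>\<^bsub>padic_cauchy_ring p\<^esub> = (\<lambda>_. 0)"
  unfolding padic_cauchy_ring_def by auto

lemma cring_padic_cauchy: "cring (padic_cauchy_ring p)"
proof (rule cringI)
  show "abelian_group (padic_cauchy_ring p)"
  proof (rule abelian_groupI, goal_cases)
    case (6 X)
    thus ?case by (intro bexI[of _ "\<lambda>n. - X n"]) (auto intro: padic_cauchy_uminus)
  qed (auto intro: padic_cauchy_add padic_cauchy_const simp: algebra_simps)
  show "Group.comm_monoid (padic_cauchy_ring p)"
    by (rule comm_monoidI) (auto intro: padic_cauchy_mult padic_cauchy_const simp: algebra_simps)
qed (auto simp: algebra_simps)

interpretation R: cring "padic_cauchy_ring p" by (rule cring_padic_cauchy)

lemma padic_cauchy_ring_uminus:
  assumes "padic_cauchy p X"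
  shows "\<ominus>\<^bsub>padic_cauchy_ring p\<^esub> X = (\<lambda>n. - X n)"
  using assms by (intro R.minus_equality) (auto intro: padic_cauchy_uminus)





lemma ideal_padic_null: "ideal (padic_null p) (padic_cauchy_ring p)"
proof (rule idealI)
  show "subgroup (padic_null p) (add_monoid (padic_cauchy_ring p))"
  proof (rule R.add.subgroupI)
    show "padic_null p \<noteq> {}" using padic_null_iff[of "\<lambda>_. 0"] by auto
  next
    fix X assume "X \<in> padic_null p"
    thus "\<ominus>\<^bsub>padic_cauchy_ring p\<^esub> X \<in> padic_null p"
      using padic_cauchy_ring_uminus[OF padic_null_cauchy] padic_null_uminus by simp
  qed (auto intro: padic_null_cauchy padic_null_add)
next
  fix X Y assume "X \<in> padic_null p" "Y \<in> carrier (padic_cauchy_ring p)"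
  thus XY: "X \<otimes>\<^bsub>padic_cauchy_ring p\<^esub> Y \<in> padic_null p" using padic_null_mult by simp
  thus "Y \<otimes>\<^bsub>padic_cauchy_ring p\<^esub> X \<in> padic_null p" by (simp add: mult.commute)
qed (rule R.ring_axioms)



interpretation I: ideal "padic_null p" "padic_cauchy_ring p" by (rule ideal_padic_null)

interpretation h: ring_hom_cring "padic_cauchy_ring p" "Qp p" padic_class
  using I.rcos_ring_hom_cring[OF cring_padic_cauchy]
  unfolding Qp_def padic_class_of_def[abs_def] .

lemma padic_class_mem_iff:
  assumes "padic_cauchy p X"
  shows "Y \<in> padic_class X \<longleftrightarrow> padic_cauchy p Y \<and> (\<lambda>n. Y n - X n) \<in> padic_null p"
proof
  assume "Y \<in> padic_class X"
  then obtain Z where "Z \<in> padic_null p" "Y = (\<lambda>n. Z n + X n)"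
    unfolding padic_class_of_def a_r_coset_def' by auto
  thus "padic_cauchy p Y \<and> (\<lambda>n. Y n - X n) \<in> padic_null p"
    using assms by (auto intro: padic_cauchy_add padic_null_cauchy)
next
  assume "padic_cauchy p Y \<and> (\<lambda>n. Y n - X n) \<in> padic_null p"
  moreover have "Y = (\<lambda>n. (Y n - X n) + X n)" by simp
  ultimately show "Y \<in> padic_class X"
    unfolding padic_class_of_def a_r_coset_def' by (auto intro!: bexI[of _ "\<lambda>n. Y n - X n"])
qed

lemma padic_class_eqI:
  assumes "padic_cauchy p X" "padic_cauchy p Y" "(\<lambda>n. Y n - X n) \<in> padic_null p"
  shows "padic_class X = padic_class Y"
  using I.a_repr_independence'[of Y X] padic_class_mem_iff[of X Y] assms
  unfolding padic_class_of_def by simp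

lemma padic_class_cases:
  assumes "z \<in> carrier (Qp p)"
  obtains X where "padic_cauchy p X" "z = padic_class X"
  using assms unfolding Qp_def FactRing_def padic_class_of_def A_RCOSETS_def' by auto

lemma padic_class_carrier: "padic_cauchy p X \<Longrightarrow> padic_class X \<in> carrier (Qp p)"
  by (intro h.hom_closed) simp

lemma padic_of_rat_eq: "padic_of_rat p x = padic_class (\<lambda>_. x)"
  unfolding padic_of_rat_def padic_class_of_def ..

text \<open>\<open>padic_abs\<close> takes the limit along an arbitrarily chosen representative. Two
  representatives differ by a null sequence, so by the reverse triangle inequality the limit is the
  same along each of them.\<close>

lemma padic_abs_class_tendsto:
  assumes "padic_cauchy p X"
  shows "(\<lambda>n. rat_padic_abs p (X n)) \<longlonglongrightarrow> padic_abs p (padic_class X)"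
proof -
  define Y where "Y = (SOME Y. Y \<in> padic_class X)"
  have "X \<in> padic_class X" using padic_class_mem_iff[OF assms] assms by (simp add: padic_null_iff)
  hence "Y \<in> padic_class X" unfolding Y_def by (rule someI[of "\<lambda>Y. Y \<in> padic_class X"])
  hence Y: "padic_cauchy p Y" "(\<lambda>n. Y n - X n) \<in> padic_null p"
    using padic_class_mem_iff[OF assms] by auto
  have lim: "(\<lambda>n. rat_padic_abs p (Y n)) \<longlonglongrightarrow> padic_abs p (padic_class X)"
    using padic_cauchy_convergent[OF Y(1)] unfolding padic_abs_def Y_def[symmetric]
    by (simp add: convergent_LIMSEQ_iff)
  have "(\<lambda>n. rat_padic_abs p (X n) - rat_padic_abs p (Y n)) \<longlonglongrightarrow> 0"
  proof (rule tendsto_0_le)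
    show "(\<lambda>n. rat_padic_abs p (Y n - X n)) \<longlonglongrightarrow> 0" using Y(2) unfolding padic_null_iff .
    have "\<bar>rat_padic_abs p (X n) - rat_padic_abs p (Y n)\<bar> \<le> rat_padic_abs p (Y n - X n)" for n
      using padic_abs_reverse_triangle[of "X n" "Y n"] padic_abs_minus_commute[of "X n" "Y n"] by simp
    thus "\<forall>\<^sub>F n in sequentially. norm (rat_padic_abs p (X n) - rat_padic_abs p (Y n))
        \<le> norm (rat_padic_abs p (Y n - X n)) * 1" by simp
  qed
  from tendsto_add[OF this lim] show ?thesis by simp
qed

lemma padic_dist_class_tendsto:
  assumes "padic_cauchy p X" "padic_cauchy p Y"
  shows "(\<lambda>n. rat_padic_abs p (X n - Y n)) \<longlonglongrightarrow> padic_dist p (padic_class X) (padic_class Y)"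
proof -
  have "padic_class (\<lambda>n. X n - Y n) = padic_class X \<oplus>\<^bsub>Qp p\<^esub> padic_class (\<lambda>n. - Y n)"
    using h.hom_add[of X "\<lambda>n. - Y n"] assms by (simp add: padic_cauchy_uminus)
  also have "padic_class (\<lambda>n. - Y n) = \<ominus>\<^bsub>Qp p\<^esub> padic_class Y"
    using h.hom_a_inv[of Y] assms by (simp add: padic_cauchy_ring_uminus)
  finally have "padic_class X \<ominus>\<^bsub>Qp p\<^esub> padic_class Y = padic_class (\<lambda>n. X n - Y n)"
    unfolding a_minus_def ..
  thus ?thesis unfolding padic_dist_def
    using padic_abs_class_tendsto[OF padic_cauchy_diff[OF assms]] by simp
qed

lemma padic_class_eq_iff:
  assumes "padic_cauchy p X" "padic_cauchy p Y"
  shows "padic_class X = padic_class Y \<longleftrightarrow> (\<lambda>n. X n - Y n) \<in> padic_null p"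
proof
  assume "padic_class X = padic_class Y"
  moreover have "X \<in> padic_class X" using padic_class_mem_iff[OF assms(1)] assms by (simp add: padic_null_iff)
  ultimately show "(\<lambda>n. X n - Y n) \<in> padic_null p" using padic_class_mem_iff[OF assms(2)] by simp
next
  assume "(\<lambda>n. X n - Y n) \<in> padic_null p"
  thus "padic_class X = padic_class Y" using padic_class_eqI[OF assms(2,1)] by simp
qed

section \<open>The n-th root as a class of a rational sequence\<close>

lemma padic_class_pow:
  assumes "padic_cauchy p X"
  shows "padic_class X [^]\<^bsub>Qp p\<^esub> (n::nat) = padic_class (\<lambda>k. X k ^ n)"
proof (induction n)
  case 0
  thus ?case using h.hom_one by simp
next
  case (Suc n)
  thus ?case using h.hom_mult[of "\<lambda>k. X k ^ n" X] assms by (simp add: padic_cauchy_power mult.commute)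
qed

lemma padic_class_root_iff:
  assumes "padic_cauchy p X"
  shows "padic_of_rat p b \<otimes>\<^bsub>Qp p\<^esub> (padic_class X [^]\<^bsub>Qp p\<^esub> n) = padic_of_rat p a \<longleftrightarrow>
    (\<lambda>k. b * X k ^ n - a) \<in> padic_null p"
proof -
  have "padic_of_rat p b \<otimes>\<^bsub>Qp p\<^esub> (padic_class X [^]\<^bsub>Qp p\<^esub> n) = padic_class (\<lambda>k. b * X k ^ n)"
    unfolding padic_of_rat_eq
    using assms h.hom_mult[of "\<lambda>_. b" "\<lambda>k. X k ^ n"]
    by (simp add: padic_cauchy_const padic_class_pow padic_cauchy_power)
  thus ?thesis unfolding padic_of_rat_eq
    by (subst padic_class_eq_iff[symmetric])
       (auto intro!: assms padic_cauchy_const padic_cauchy_mult[OF padic_cauchy_const padic_cauchy_power])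
qed

text \<open>A limit of numbers below 1 could be 1; here it cannot, because terms below 1 are at most
  1 / p.\<close>

lemma padic_dist_one_less_iff:
  assumes "padic_cauchy p X"
  shows "padic_dist p (padic_class X) \<one>\<^bsub>Qp p\<^esub> < 1 \<longleftrightarrow>
    (\<forall>\<^sub>F k in sequentially. rat_padic_abs p (X k - 1) < 1)"
proof -
  have "\<one>\<^bsub>Qp p\<^esub> = padic_class (\<lambda>_. 1)" using h.hom_one by simp
  hence lim: "(\<lambda>k. rat_padic_abs p (X k - 1)) \<longlonglongrightarrow> padic_dist p (padic_class X) \<one>\<^bsub>Qp p\<^esub>"
    using padic_dist_class_tendsto[OF assms padic_cauchy_const] by simp
  show ?thesis
  proof
    assume "\<forall>\<^sub>F k in sequentially. rat_padic_abs p (X k - 1) < 1"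
    hence "\<forall>\<^sub>F k in sequentially. rat_padic_abs p (X k - 1) \<le> inverse (real p)"
      by (rule eventually_mono) (rule padic_abs_less_1D)
    from tendsto_upperbound[OF lim this] have "padic_dist p (padic_class X) \<one>\<^bsub>Qp p\<^esub> \<le> inverse (real p)" by simp
    also have "\<dots> < 1" using prime_gt_1_nat[OF prime_p] by (simp add: field_simps)
    finally show "padic_dist p (padic_class X) \<one>\<^bsub>Qp p\<^esub> < 1" .
  qed (rule order_tendstoD(2)[OF lim])
qed

text \<open>Hensel's lemma is not needed for the root: if \<open>n m\<^sub>k \<equiv> 1\<close> modulo \<open>p\<^sup>k\<close>, then
  \<open>(a / b) ^ m\<^sub>k\<close> converges to it.\<close>

lemma padic_abs_power_prime_power:
  assumes "rat_padic_abs p (x - 1) < 1"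
  shows "rat_padic_abs p (x ^ (p ^ k) - 1) \<le> inverse (real p) ^ Suc k"
proof (induction k)
  case 0
  thus ?case using padic_abs_less_1D[OF assms] by simp
next
  case (Suc k)
  define y where "y = x ^ (p ^ k)"
  have y: "rat_padic_abs p (y - 1) \<le> inverse (real p) ^ Suc k" using Suc unfolding y_def .
  have ip: "inverse (real p) \<le> 1" "inverse (real p) \<ge> 0"
    using prime_ge_1_nat[OF prime_p] by (auto simp: field_simps)
  have "inverse (real p) ^ Suc k \<le> inverse (real p)"
    using power_decreasing[of 1 "Suc k" "inverse (real p)"] ip by simp
  with y have y1: "rat_padic_abs p (y - 1) \<le> inverse (real p)" by simp
  hence "rat_padic_abs p y \<le> 1" using padic_abs_add_le_bound[of "y - 1" 1 1] ip by simp
  hence ypow: "rat_padic_abs p (y ^ i) \<le> 1" for i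
    unfolding padic_abs_power using padic_abs_nonneg by (intro power_le_one)
  have ydiff: "rat_padic_abs p (y ^ i - 1) \<le> inverse (real p)" for i
  proof -
    have "rat_padic_abs p (y ^ i - 1) = rat_padic_abs p (y - 1) * rat_padic_abs p (\<Sum>j<i. y ^ j)"
      unfolding padic_abs_mult[symmetric] using power_diff_sumr2[of y i 1] by simp
    also have "\<dots> \<le> inverse (real p) * 1"
      using y1 ypow ip by (intro mult_mono padic_abs_sum_le) auto
    finally show ?thesis by simp
  qed
  \<comment> \<open>A sum of p terms, each congruent to 1 modulo p, is divisible by p: this is the
    extra factor gained by raising to the p-th power.\<close>
  define s where "s = (\<Sum>j<p. y ^ j)"
  have "s = (\<Sum>j<p. y ^ j - 1) + of_int (int p)" unfolding s_def by (simp add: sum_subtractf)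
  moreover have "rat_padic_abs p (\<Sum>j<p. y ^ j - 1) \<le> inverse (real p)"
    using ydiff ip by (intro padic_abs_sum_le) auto
  moreover have "rat_padic_abs p (of_int (int p)) \<le> inverse (real p)"
    using padic_dvd_imp_padic_abs_le[of 1 "of_int (int p)"] padic_dvd_of_int_iff[OF prime_p, of 1 "int p"]
    by simp
  ultimately have s: "rat_padic_abs p s \<le> inverse (real p)"
    using padic_abs_add_le_bound[of "\<Sum>j<p. y ^ j - 1" "inverse (real p)" "of_int (int p)"] by simp
  have "x ^ (p ^ Suc k) - 1 = (y - 1) * s"
    using power_diff_sumr2[of y p 1] unfolding y_def s_def by (simp add: power_mult[symmetric] mult.commute)
  hence "rat_padic_abs p (x ^ (p ^ Suc k) - 1) = rat_padic_abs p (y - 1) * rat_padic_abs p s"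
    by (simp add: padic_abs_mult)
  also have "\<dots> \<le> inverse (real p) ^ Suc k * inverse (real p)"
    using y s ip by (intro mult_mono) auto
  finally show ?case by (simp add: mult.commute)
qed

lemma padic_unit_power_close:
  assumes "rat_padic_abs p (x - 1) < 1"
  shows "rat_padic_abs p (x ^ k - 1) < 1"
proof (induction k)
  case (Suc k)
  have eq: "x ^ Suc k - 1 = x ^ k * (x - 1) + (x ^ k - 1)" by (simp add: algebra_simps)
  have "rat_padic_abs p (x ^ k) = 1" using padic_abs_eq_of_diff_less[of "x ^ k" 1] Suc by simp
  hence "rat_padic_abs p (x ^ k * (x - 1)) < 1" using assms by (simp add: padic_abs_mult)
  from padic_abs_add_less_bound[OF this Suc] show ?case unfolding eq .
qed simp

text \<open>By \<open>n * m k = 1 + p ^ k * t k\<close>, the n-th power of \<open>x ^ m k\<close> is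
  x times a power of \<open>x ^ (p ^ k)\<close>, which tends to 1. The sequence is Cauchy because
  its n-th powers are and the power map is isometric on 1-units.\<close>

lemma padic_root_sequence:
  fixes x :: rat
  assumes x: "rat_padic_abs p (x - 1) < 1" and n: "\<not> p dvd n"
  obtains c where "padic_cauchy p c" "\<And>k. rat_padic_abs p (c k - 1) < 1"
    "(\<lambda>k. c k ^ n - x) \<in> padic_null p"
proof -
  have n0: "n > 0" using n by (intro Nat.gr0I) simp
  have "\<exists>m t. n * m = 1 + p ^ k * t" for k
  proof -
    have "coprime n (p ^ k)" using prime_imp_coprime[OF prime_p n] by (simp add: coprime_commute)
    hence "gcd n (p ^ k) = 1" by simp
    thus ?thesis using bezout_nat[of n "p ^ k"] n0 by (metis add.commute less_not_refl)
  qed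
  then obtain m t where mt: "\<And>k. n * m k = 1 + p ^ k * t k" by metis
  define c where "c k = x ^ m k" for k
  have c1: "rat_padic_abs p (c k - 1) < 1" for k unfolding c_def using x by (rule padic_unit_power_close)
  have xabs: "rat_padic_abs p x = 1" using padic_abs_eq_of_diff_less[of x 1] x by simp
  have diff: "rat_padic_abs p (c k ^ n - x) \<le> inverse (real p) ^ Suc k" for k
  proof -
    define y where "y = x ^ (p ^ k)"
    have "c k ^ n = x ^ (n * m k)" unfolding c_def by (simp add: power_mult[symmetric] mult.commute)
    also have "\<dots> = x * y ^ t k" unfolding mt y_def by (simp add: power_add power_mult)
    finally have "c k ^ n - x = x * (y ^ t k - 1)" by (simp add: algebra_simps)
    hence "c k ^ n - x = x * ((y - 1) * (\<Sum>j<t k. y ^ j))"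
      using power_diff_sumr2[of y "t k" 1] by simp
    hence "rat_padic_abs p (c k ^ n - x) = rat_padic_abs p (y - 1) * rat_padic_abs p (\<Sum>j<t k. y ^ j)"
      by (simp add: padic_abs_mult xabs)
    also have "\<dots> \<le> inverse (real p) ^ Suc k * 1"
      using padic_abs_power_prime_power[OF x, of k] xabs
      unfolding y_def by (intro mult_mono padic_abs_sum_le) (auto simp: padic_abs_power)
    finally show ?thesis by simp
  qed
  have "(\<lambda>k. inverse (real p) ^ k) \<longlonglongrightarrow> 0"
    using prime_gt_1_nat[OF prime_p] by (intro LIMSEQ_realpow_zero) (auto simp: field_simps)
  have null: "(\<lambda>k. c k ^ n - x) \<in> padic_null p"
    by (rule padic_null_comparison[OF diff LIMSEQ_Suc[OF \<open>_ \<longlonglongrightarrow> 0\<close>]])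
  have "padic_cauchy p c"
    using padic_null_cauchy[OF null] padic_abs_power_diff[OF c1 c1 n]
    unfolding padic_cauchy_def by simp
  thus ?thesis using that c1 null by blast
qed

text \<open>For uniqueness, a second root Z has n-th powers differing from those of c by a null
  sequence, and the isometry of the power map makes Z - c null. The equation can be divided by b
  because b is a unit.\<close>

lemma padic_nth_root_eq:
  assumes b: "\<not> int p dvd b" and a: "int p dvd a - b" and n: "\<not> p dvd n"
  obtains c where "padic_cauchy p c" "\<And>k. rat_padic_abs p (c k - 1) < 1"
    "(\<lambda>k. c k ^ n - of_int a / of_int b) \<in> padic_null p" "padic_nth_root p n a b = padic_class c"
proof -
  define x :: rat where "x = of_int a / of_int b"
  have b0: "b \<noteq> 0" using b by auto
  have "padic_dvd p 1 (of_int (a - b))" using a prime_p by (subst padic_dvd_of_int_iff) auto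
  hence "padic_dvd p (1 + 0) (of_int (a - b) * (of_int 1 / of_int b))"
    by (intro padic_dvd_mult prime_p padic_dvd_divide b)
  moreover have "of_int (a - b) * (of_int 1 / of_int b) = x - 1"
    unfolding x_def using b0 by (simp add: field_simps)
  ultimately have "rat_padic_abs p (x - 1) \<le> inverse (real p)"
    using padic_dvd_imp_padic_abs_le[of 1 "x - 1"] by simp
  also have "\<dots> < 1" using prime_gt_1_nat[OF prime_p] by (simp add: field_simps)
  finally have x: "rat_padic_abs p (x - 1) < 1" .
  obtain c where c: "padic_cauchy p c" "\<And>k. rat_padic_abs p (c k - 1) < 1"
    "(\<lambda>k. c k ^ n - x) \<in> padic_null p"
    using padic_root_sequence[OF x n] by blast
  have null_iff: "(\<lambda>k. of_int b * X k ^ n - of_int a) \<in> padic_null p \<longleftrightarrow> (\<lambda>k. X k ^ n - x) \<in> padic_null p" for X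
  proof -
    have "rat_padic_abs p (of_int b * X k ^ n - of_int a) = rat_padic_abs p (X k ^ n - x)" for k
    proof -
      have "of_int b * X k ^ n - of_int a = of_int b * (X k ^ n - x)"
        unfolding x_def using b0 by (simp add: field_simps)
      thus ?thesis using padic_abs_of_int_eq_1[OF b] by (simp only: padic_abs_mult mult_1)
    qed
    thus ?thesis unfolding padic_null_iff by simp
  qed
  have "padic_nth_root p n a b = padic_class c"
    unfolding padic_nth_root_def
  proof (rule the_equality)
    show "padic_class c \<in> carrier (Qp p) \<and>
      padic_of_rat p (of_int b) \<otimes>\<^bsub>Qp p\<^esub> (padic_class c [^]\<^bsub>Qp p\<^esub> n) = padic_of_rat p (of_int a) \<and>
      padic_dist p (padic_class c) \<one>\<^bsub>Qp p\<^esub> < 1"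
      using c padic_class_carrier by (simp add: padic_class_root_iff padic_dist_one_less_iff null_iff)
  next
    fix z assume z: "z \<in> carrier (Qp p) \<and>
      padic_of_rat p (of_int b) \<otimes>\<^bsub>Qp p\<^esub> (z [^]\<^bsub>Qp p\<^esub> n) = padic_of_rat p (of_int a) \<and>
      padic_dist p z \<one>\<^bsub>Qp p\<^esub> < 1"
    then obtain Z where Z: "padic_cauchy p Z" "z = padic_class Z" using padic_class_cases by blast
    have "(\<lambda>k. Z k ^ n - x) \<in> padic_null p" and ev: "\<forall>\<^sub>F k in sequentially. rat_padic_abs p (Z k - 1) < 1"
      using z Z by (simp_all add: padic_class_root_iff padic_dist_one_less_iff null_iff)
    from padic_null_diff[OF this(1) c(3)] have "(\<lambda>k. rat_padic_abs p (Z k ^ n - c k ^ n)) \<longlonglongrightarrow> 0"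
      unfolding padic_null_iff by simp
    moreover have "\<forall>\<^sub>F k in sequentially. rat_padic_abs p (Z k ^ n - c k ^ n) = rat_padic_abs p (Z k - c k)"
      using ev by (rule eventually_mono) (rule padic_abs_power_diff[OF _ c(2) n])
    ultimately have "(\<lambda>k. Z k - c k) \<in> padic_null p"
      unfolding padic_null_iff by (rule Lim_transform_eventually)
    thus "z = padic_class c" using padic_class_eq_iff[OF Z(1) c(1)] Z(2) by simp
  qed
  thus ?thesis using that c unfolding x_def by blast
qed

text \<open>The isometry turns the distance of \<open>c k\<close> to \<alpha> into that of their
  n-th powers, and the n-th powers of c tend to a / b. Thus the distance to the root becomes the
  absolute value of a rational, and a fraction other than the root has an n-th power other than a /
  b.\<close>

lemma padic_nth_root_dist:
  assumes b: "\<not> int p dvd b" and a: "int p dvd a - b" and n: "\<not> p dvd n"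
    and less: "padic_dist p (padic_nth_root p n a b) (padic_of_rat p \<alpha>) < 1"
  shows "rat_padic_abs p (\<alpha> - 1) < 1"
    and "padic_dist p (padic_nth_root p n a b) (padic_of_rat p \<alpha>) = rat_padic_abs p (\<alpha> ^ n - of_int a / of_int b)"
    and "\<alpha> ^ n = of_int a / of_int b \<Longrightarrow> padic_nth_root p n a b = padic_of_rat p \<alpha>"
proof -
  obtain c where c: "padic_cauchy p c" "\<And>k. rat_padic_abs p (c k - 1) < 1"
    "(\<lambda>k. c k ^ n - of_int a / of_int b) \<in> padic_null p" "padic_nth_root p n a b = padic_class c"
    using padic_nth_root_eq[OF b a n] by blast
  have lim: "(\<lambda>k. rat_padic_abs p (c k - \<alpha>)) \<longlonglongrightarrow> padic_dist p (padic_nth_root p n a b) (padic_of_rat p \<alpha>)"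
    unfolding c(4) padic_of_rat_eq by (rule padic_dist_class_tendsto[OF c(1) padic_cauchy_const])
  obtain k where k: "rat_padic_abs p (c k - \<alpha>) < 1"
    using order_tendstoD(2)[OF lim less] by (auto simp: eventually_sequentially)
  show \<alpha>1: "rat_padic_abs p (\<alpha> - 1) < 1"
    using padic_abs_diff_less_bound[OF c(2)[of k] k] by simp
  have "(\<lambda>k. rat_padic_abs p (c k - \<alpha>)) \<longlonglongrightarrow> rat_padic_abs p (\<alpha> ^ n - of_int a / of_int b)"
  proof -
    have "(\<lambda>k. rat_padic_abs p (c k - \<alpha>) - rat_padic_abs p (\<alpha> ^ n - of_int a / of_int b)) \<longlonglongrightarrow> 0"
    proof (rule tendsto_0_le)
      show "(\<lambda>k. rat_padic_abs p (c k ^ n - of_int a / of_int b)) \<longlonglongrightarrow> 0"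
        using c(3) unfolding padic_null_iff .
      have "\<bar>rat_padic_abs p (c k - \<alpha>) - rat_padic_abs p (\<alpha> ^ n - of_int a / of_int b)\<bar>
        \<le> rat_padic_abs p (c k ^ n - of_int a / of_int b)" for k
      proof -
        have "rat_padic_abs p (c k - \<alpha>) = rat_padic_abs p (\<alpha> ^ n - c k ^ n)"
          using padic_abs_power_diff[OF c(2)[of k] \<alpha>1 n] padic_abs_minus_commute by metis
        thus ?thesis
          using padic_abs_reverse_triangle[of "\<alpha> ^ n - c k ^ n" "\<alpha> ^ n - of_int a / of_int b"]
            padic_abs_minus_commute[of "of_int a / of_int b" "c k ^ n"] by simp
      qed
      thus "\<forall>\<^sub>F k in sequentially. norm (rat_padic_abs p (c k - \<alpha>) - rat_padic_abs p (\<alpha> ^ n - of_int a / of_int b))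
        \<le> norm (rat_padic_abs p (c k ^ n - of_int a / of_int b)) * 1" by simp
    qed
    from tendsto_add[OF this tendsto_const[of "rat_padic_abs p (\<alpha> ^ n - of_int a / of_int b)"]]
    show ?thesis by simp
  qed
  from LIMSEQ_unique[OF lim this]
  show eq: "padic_dist p (padic_nth_root p n a b) (padic_of_rat p \<alpha>) = rat_padic_abs p (\<alpha> ^ n - of_int a / of_int b)" .
  assume "\<alpha> ^ n = of_int a / of_int b"
  hence "(\<lambda>k. rat_padic_abs p (c k - \<alpha>)) \<longlonglongrightarrow> 0" using lim eq by simp
  thus "padic_nth_root p n a b = padic_of_rat p \<alpha>"
    unfolding c(4) padic_of_rat_eq by (subst padic_class_eq_iff[OF c(1) padic_cauchy_const]) (simp add: padic_null_iff)
qed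

end


section \<open>Interpolation determinants\<close>

lemma sum_lessThan_card_le:
  fixes B :: "nat set"
  assumes "finite B"
  shows "\<Sum>{..<card B} \<le> \<Sum>B"
  using assms
proof (induction "card B" arbitrary: B)
  case (Suc c)
  hence ne: "B \<noteq> {}" by auto
  define M where "M = Max B"
  have M: "M \<in> B" "finite B" using Suc ne unfolding M_def by auto
  have "B \<subseteq> {..M}" using Suc unfolding M_def by auto
  hence "card B \<le> Suc M" using card_mono[of "{..M}" B] by auto
  moreover have "c = card (B - {M})" using Suc.hyps(2) M by simp
  with Suc.hyps(1)[of "B - {M}"] M have "\<Sum>{..<c} \<le> \<Sum>(B - {M})" by simp
  moreover have "\<Sum>B = M + \<Sum>(B - {M})" using M by (simp add: sum.remove)
  ultimately show ?case using Suc.hyps(2)[symmetric] by simp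
qed simp

text \<open>By distinctness the members of A contribute at least 0 + ... + (card A - 1). The others
  contribute at least \<open>card I\<close> each, more than the missing terms of that sum. They will
  be the error rows of the determinant.\<close>

lemma sum_ge_of_inj_on_small:
  fixes t :: "'a \<Rightarrow> nat"
  assumes "finite I" "A \<subseteq> I" "inj_on t A" "\<And>i. i \<in> I - A \<Longrightarrow> card I \<le> t i"
  shows "card I * (card I - 1) \<le> 2 * sum t I"
proof -
  have fA: "finite A" using assms finite_subset by blast
  have gauss: "2 * \<Sum>{..<c} = c * (c - 1)" for c :: nat
  proof -
    have "2 * \<Sum>{..<c} + c = c * c" by (induction c) auto
    thus ?thesis by (simp add: diff_mult_distrib2)
  qed
  have "\<Sum>{..<card A} \<le> sum t A"
    using sum_lessThan_card_le[of "t ` A"] assms(3) fA by (simp add: card_image sum.reindex)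
  hence 1: "card A * (card A - 1) \<le> 2 * sum t A" using gauss[of "card A"] by simp
  have "card (I - A) * card I \<le> sum t (I - A)"
    using sum_bounded_below[of "I - A" "card I" t] assms(4) by simp
  moreover have "sum t I = sum t A + sum t (I - A)"
    using assms(1,2) by (metis add.commute sum.subset_diff)
  moreover obtain d where d: "card (I - A) = d" "card I = card A + d"
    using assms(1,2) fA by (metis card_Diff_subset card_mono le_add_diff_inverse)
  ultimately have 2: "card A * (card A - 1) + 2 * (d * (card A + d)) \<le> 2 * sum t I"
    using 1 by simp
  have "(a + d) * (a + d - 1) \<le> a * (a - 1) + 2 * (d * (a + d))" for a :: nat
  proof -
    have "(a + d) * (a + d - 1) = a * (a + d - 1) + d * (a + d - 1)" by (rule add_mult_distrib)
    also have "a * (a + d - 1) \<le> a * (a - 1) + a * d"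
      by (metis add_mult_distrib2 diff_add_assoc2 diff_is_0_eq le_add2 less_one linorder_not_less mult_0 order_refl)
    also have "d * (a + d - 1) \<le> d * (a + d)" by (rule mult_le_mono2) simp
    finally show ?thesis by (simp add: algebra_simps)
  qed
  from order_trans[OF this 2] show ?thesis unfolding d(2) .
qed

lemma det_mat_leibniz:
  "det (mat N N (\<lambda>(i,j). F i j)) =
   (\<Sum>\<sigma> | \<sigma> permutes {0..<N}. of_int (sign \<sigma>) * (\<Prod>i=0..<N. F i (\<sigma> i)))"
proof -
  have "(\<Prod>i=0..<N. mat N N (\<lambda>(i,j). F i j) $$ (i, \<sigma> i)) = (\<Prod>i=0..<N. F i (\<sigma> i))"
    if "\<sigma> permutes {0..<N}" for \<sigma>
    using that permutes_in_image[OF that] by (intro prod.cong) auto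
  thus ?thesis by (subst det_def'[of _ N]) (auto intro: sum.cong)
qed

lemma det_rows_sum:
  fixes G :: "nat \<Rightarrow> 'b \<Rightarrow> nat \<Rightarrow> 'a :: comm_ring_1"
  assumes "finite M"
  shows "det (mat N N (\<lambda>(i,j). \<Sum>m\<in>M. G i m j)) =
    (\<Sum>f\<in>{0..<N} \<rightarrow>\<^sub>E M. det (mat N N (\<lambda>(i,j). G i (f i) j)))"
proof -
  have "det (mat N N (\<lambda>(i,j). \<Sum>m\<in>M. G i m j)) = (\<Sum>\<sigma> | \<sigma> permutes {0..<N}. 
      \<Sum>f\<in>{0..<N} \<rightarrow>\<^sub>E M. of_int (sign \<sigma>) * (\<Prod>i=0..<N. G i (f i) (\<sigma> i)))"
    unfolding det_mat_leibniz using assms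
    by (simp add: prod_sum_PiE sum_distrib_left)
  also have "\<dots> = (\<Sum>f\<in>{0..<N} \<rightarrow>\<^sub>E M. \<Sum>\<sigma> | \<sigma> permutes {0..<N}. 
      of_int (sign \<sigma>) * (\<Prod>i=0..<N. G i (f i) (\<sigma> i)))" by (rule sum.swap)
  finally show ?thesis unfolding det_mat_leibniz .
qed

lemma det_rows_scale:
  fixes c :: "nat \<Rightarrow> 'a :: comm_ring_1"
  shows "det (mat N N (\<lambda>(i,j). c i * H i j)) = (\<Prod>i=0..<N. c i) * det (mat N N (\<lambda>(i,j). H i j))"
  unfolding det_mat_leibniz by (simp add: prod.distrib sum_distrib_left mult_ac)

text \<open>Expand the determinant in its rows. Choosing the same function \<open>B m\<close> in two rows gives 0, so the
  chosen indices \<open>m\<close> are distinct and add up to at least \<open>N (N - 1) / 2\<close>, where a row of \<open>W\<close>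
  counts as an index \<open>N\<close>.\<close>

lemma padic_dvd_det:
  assumes p: "prime p"
    and F: "\<And>i j. i < N \<Longrightarrow> j < N \<Longrightarrow> F i j = (\<Sum>m<Z. C i m * B m j) + W i j"
    and C0: "\<And>i m. i < N \<Longrightarrow> m < Z \<Longrightarrow> m < k i \<Longrightarrow> C i m = 0"
    and C: "\<And>i m. i < N \<Longrightarrow> m < Z \<Longrightarrow> k i \<le> m \<Longrightarrow> padic_dvd p (E * (m - k i)) (C i m)"
    and B: "\<And>m j. m < Z \<Longrightarrow> j < N \<Longrightarrow> padic_dvd p 0 (B m j)"
    and W: "\<And>i j. i < N \<Longrightarrow> j < N \<Longrightarrow> padic_dvd p (E * N) (W i j)"
    and V: "2 * V + 2 * E * (\<Sum>i<N. k i) \<le> E * (N * (N - 1))"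
  shows "padic_dvd p V (det (mat N N (\<lambda>(i,j). F i j)))"
proof -
  define G where "G = (\<lambda>i m j. if m < Z then C i m * B m j else W i j)"
  have "F i j = (\<Sum>m\<in>{..Z}. G i m j)" if "i < N" "j < N" for i j
    unfolding G_def using F[OF that] by (simp add: lessThan_Suc_atMost[symmetric])
  hence eq: "mat N N (\<lambda>(i,j). F i j) = mat N N (\<lambda>(i,j). \<Sum>m\<in>{..Z}. G i m j)"
    by (intro eq_matI) auto
  have "padic_dvd p V (det (mat N N (\<lambda>(i,j). G i (f i) j)))" for f
  proof -
    define A where "A = {i\<in>{0..<N}. f i < Z}"
    \<comment> \<open>A scalar is split off from each row: its expansion coefficient, or the prime
      power of an error row. What remains in \<open>H\<close> is p-integral.\<close>
    define c where "c i = (if f i < Z then C i (f i) else of_nat p ^ (E * N))" for i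
    define H where "H i j = (if f i < Z then B (f i) j else W i j / of_nat p ^ (E * N))" for i j
    have pnz: "(of_nat p :: rat) \<noteq> 0" using p by auto
    have "G i (f i) j = c i * H i j" for i j
      unfolding G_def c_def H_def using pnz by simp
    hence det_eq: "det (mat N N (\<lambda>(i,j). G i (f i) j)) = (\<Prod>i=0..<N. c i) * det (mat N N (\<lambda>(i,j). H i j))"
      using det_rows_scale[of N c H] by simp
    have H: "padic_dvd p 0 (H i j)" if ij: "i < N" "j < N" for i j
    proof (cases "f i < Z")
      case False
      obtain m n where "W i j = of_int (int p ^ (E * N) * m) / of_int n" "\<not> int p dvd n"
        using W[OF ij] unfolding padic_dvd_def by blast
      thus ?thesis using False pnz unfolding H_def
        by (intro padic_dvdI[of _ _ _ m n]) auto
    qed (use B ij in \<open>auto simp: H_def\<close>)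
    have detH: "padic_dvd p 0 (det (mat N N (\<lambda>(i,j). H i j)))"
      unfolding det_mat_leibniz
    proof (intro padic_dvd_sum[OF p] padic_dvd_mult_left[OF p] padic_dvd_of_int[OF p])
      fix \<sigma> assume "\<sigma> \<in> {\<sigma>. \<sigma> permutes {0..<N}}"
      hence "\<sigma> i < N" if "i < N" for i using that permutes_in_image[of \<sigma> "{0..<N}" i] by auto
      thus "padic_dvd p 0 (\<Prod>i=0..<N. H i (\<sigma> i))"
        using padic_dvd_prod[OF p, of "{0..<N}" "\<lambda>_. 0"] H by auto
    qed
    \<comment> \<open>Either some chosen coefficient lies before the start of its row and vanishes,
      or two rows carry the same function and are equal after scaling, or the chosen indices are
      distinct and their sum is large.\<close>
    consider "\<exists>i\<in>A. f i < k i" | "\<not> inj_on f A" | "\<forall>i\<in>A. k i \<le> f i" "inj_on f A"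
      by force
    thus ?thesis
    proof cases
      case 1
      then obtain i where i: "i < N" "f i < Z" "f i < k i" unfolding A_def by auto
      hence "c i = 0" unfolding c_def using C0 by simp
      hence "(\<Prod>i=0..<N. c i) = 0" using i(1) by (intro prod_zero) auto
      thus ?thesis unfolding det_eq using padic_dvd_zero[OF p] by (simp only: mult_zero_left)
    next
      case 2
      then obtain i i' where i: "i \<in> A" "i' \<in> A" "i \<noteq> i'" "f i = f i'" unfolding inj_on_def by blast
      have "det (mat N N (\<lambda>(i,j). H i j)) = 0"
      proof (rule det_identical_rows[of _ N i i'])
        show "row (mat N N (\<lambda>(i,j). H i j)) i = row (mat N N (\<lambda>(i,j). H i j)) i'"
          using i unfolding A_def H_def by (intro eq_vecI) auto
      qed (use i in \<open>auto simp: A_def\<close>)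
      thus ?thesis unfolding det_eq using padic_dvd_zero[OF p] by simp
    next
      case 3
      define e where "e i = (if f i < Z then E * (f i - k i) else E * N)" for i
      define t where "t i = (if f i < Z then f i else N)" for i
      have "padic_dvd p (e i) (c i)" if "i \<in> {0..<N}" for i
        unfolding e_def c_def using 3(1) C[of i "f i"] that padic_dvd_prime_power[OF p]
        by (auto simp: A_def)
      hence "padic_dvd p (\<Sum>i=0..<N. e i) (\<Prod>i=0..<N. c i)" by (intro padic_dvd_prod[OF p])
      hence dvd: "padic_dvd p (\<Sum>i=0..<N. e i) (det (mat N N (\<lambda>(i,j). G i (f i) j)))"
        unfolding det_eq by (intro padic_dvd_mult_right[OF p] detH)
      have "inj_on t A \<longleftrightarrow> inj_on f A" by (intro inj_on_cong) (auto simp: t_def A_def)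
      moreover have "A \<subseteq> {0..<N}" "\<And>i. i \<in> {0..<N} - A \<Longrightarrow> card {0..<N} \<le> t i"
        by (auto simp: A_def t_def)
      ultimately have "N * (N - 1) \<le> 2 * (\<Sum>i=0..<N. t i)"
        using sum_ge_of_inj_on_small[of "{0..<N}" A t] 3(2) by (metis card_atLeastLessThan diff_zero finite_atLeastLessThan)
      hence *: "E * (N * (N - 1)) \<le> E * (2 * (\<Sum>i=0..<N. t i))" by (rule mult_le_mono2)
      have "E * t i \<le> e i + E * k i" if "i \<in> {0..<N}" for i
        using 3(1) that unfolding t_def e_def by (auto simp: A_def algebra_simps)
      hence "(\<Sum>i=0..<N. E * t i) \<le> (\<Sum>i=0..<N. e i + E * k i)" by (intro sum_mono)
      hence "E * (\<Sum>i=0..<N. t i) \<le> (\<Sum>i=0..<N. e i) + E * (\<Sum>i=0..<N. k i)"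
        by (simp add: sum.distrib sum_distrib_left)
      moreover have "E * (2 * (\<Sum>i=0..<N. t i)) = 2 * (E * (\<Sum>i=0..<N. t i))" by (rule mult.left_commute)
      moreover have "2 * V + 2 * (E * (\<Sum>i=0..<N. k i)) \<le> E * (N * (N - 1))"
        using V by (simp add: lessThan_atLeast0 mult.assoc)
      ultimately have "V \<le> (\<Sum>i=0..<N. e i)" using * by linarith
      thus ?thesis using dvd padic_dvd_mono[OF p] by blast
    qed
  qed
  thus ?thesis unfolding eq det_rows_sum[OF finite_atMost] by (intro padic_dvd_sum[OF p]) auto
qed

section \<open>Nonvanishing: choice of points and the zero estimate\<close>

text \<open>Expanding along a new last column with a variable point x gives a linear combination of
  the functions. Its last coefficient is the nonzero minor found before, so by independence it
  cannot vanish for all x in X.\<close>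

lemma exists_nonzero_minor:
  fixes \<phi> :: "nat \<Rightarrow> 'b \<Rightarrow> 'a :: field"
  assumes "\<And>c. (\<forall>x\<in>X. (\<Sum>i<N. c i * \<phi> i x) = 0) \<Longrightarrow> \<forall>i<N. c i = 0"
  shows "\<exists>g. (\<forall>j<N. g j \<in> X) \<and> det (mat N N (\<lambda>(i,j). \<phi> i (g j))) \<noteq> 0"
  using assms
proof (induction N)
  case 0
  have "det (mat 0 0 (\<lambda>(i,j). \<phi> i (g j))) = 1" for g by (simp add: det_mat_leibniz)
  thus ?case by auto
next
  case (Suc N)
  have "\<forall>i<N. c i = 0" if c: "\<forall>x\<in>X. (\<Sum>i<N. c i * \<phi> i x) = 0" for c
  proof -
    have "(\<Sum>i<N. (if i < N then c i else 0) * \<phi> i x) = (\<Sum>i<N. c i * \<phi> i x)" for x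
      by (intro sum.cong) auto
    hence "\<forall>i<Suc N. (if i < N then c i else 0) = 0"
      using c by (intro Suc.prems) simp
    thus ?thesis by (metis less_Suc_eq)
  qed
  from Suc.IH[OF this] obtain g where g: "\<forall>j<N. g j \<in> X" "det (mat N N (\<lambda>(i,j). \<phi> i (g j))) \<noteq> 0"
    by blast
  define A where "A x = mat (Suc N) (Suc N) (\<lambda>(i,j). \<phi> i (if j < N then g j else x))" for x
  define c where "c i = (-1) ^ (i + N) * det (mat N N (\<lambda>(i',j). \<phi> (if i' < i then i' else Suc i') (g j)))" for i
  have cof: "cofactor (A x) i N = c i" if "i < Suc N" for x i
  proof -
    have "mat_delete (A x) i N = mat N N (\<lambda>(i',j). \<phi> (if i' < i then i' else Suc i') (g j))"
      using that unfolding mat_delete_def A_def by (intro eq_matI) auto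
    thus ?thesis unfolding cofactor_def c_def by simp
  qed
  have det: "det (A x) = (\<Sum>i<Suc N. c i * \<phi> i x)" for x
  proof -
    have "det (A x) = (\<Sum>i<Suc N. A x $$ (i,N) * cofactor (A x) i N)"
      by (rule laplace_expansion_column) (auto simp: A_def)
    also have "\<dots> = (\<Sum>i<Suc N. c i * \<phi> i x)"
      using cof by (intro sum.cong) (auto simp: A_def)
    finally show ?thesis .
  qed
  have "mat N N (\<lambda>(i',j). \<phi> (if i' < N then i' else Suc i') (g j)) = mat N N (\<lambda>(i,j). \<phi> i (g j))"
    by (intro eq_matI) auto
  hence "c N \<noteq> 0" using g(2) unfolding c_def by simp
  then obtain x where x: "x \<in> X" "det (A x) \<noteq> 0"
    using Suc.prems[of c] unfolding det by blast
  show ?case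
  proof (intro exI[of _ "\<lambda>j. if j < N then g j else x"] conjI)
    show "det (mat (Suc N) (Suc N) (\<lambda>(i,j). \<phi> i (if j < N then g j else x))) \<noteq> 0"
      using x(2) unfolding A_def .
  qed (use g x in auto)
qed

text \<open>A kernel vector of the transpose is the coefficient vector of a polynomial of degree
  below m with the m distinct roots \<open>x j\<close>.\<close>

lemma vandermonde_det_nonzero:
  fixes x :: "nat \<Rightarrow> 'a :: field"
  assumes "inj_on x {..<m}"
  shows "det (mat m m (\<lambda>(i,j). x j ^ i)) \<noteq> 0"
proof
  define A where "A = mat m m (\<lambda>(j,i). x j ^ i)"
  assume "det (mat m m (\<lambda>(i,j). x j ^ i)) = 0"
  moreover have "mat m m (\<lambda>(i,j). x j ^ i) = transpose_mat A"
    unfolding A_def by (intro eq_matI) auto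
  ultimately have "det A = 0" using det_transpose[of A m] unfolding A_def by simp
  then obtain v where v: "v \<in> carrier_vec m" "v \<noteq> 0\<^sub>v m" "A *\<^sub>v v = 0\<^sub>v m"
    using det_0_iff_vec_prod_zero_field[of A m] unfolding A_def by auto
  define q where "q = (\<Sum>i<m. monom (v $ i) i)"
  have coeff: "coeff q i = v $ i" if "i < m" for i
    using that unfolding q_def by (simp add: coeff_sum if_distrib sum.delta cong: if_cong)
  obtain i where "i < m" "v $ i \<noteq> 0" using v(1,2) by (metis carrier_vecD eq_vecI index_zero_vec)
  with coeff have q0: "q \<noteq> 0" by auto
  have "degree q < m" unfolding q_def using \<open>i < m\<close>
    by (intro degree_sum_less) (auto intro: le_less_trans[OF degree_monom_le])
  moreover have "poly q (x j) = 0" if "j < m" for j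
  proof -
    have "poly q (x j) = (A *\<^sub>v v) $ j"
      using that v(1) unfolding q_def A_def
      by (simp add: poly_sum poly_monom scalar_prod_def lessThan_atLeast0 mult.commute)
    thus ?thesis using v(3) that by simp
  qed
  hence "x ` {..<m} \<subseteq> {y. poly q y = 0}" by auto
  from card_mono[OF poly_roots_finite[OF q0] this] have "m \<le> card {y. poly q y = 0}"
    using card_image[OF assms] by simp
  ultimately show False using card_poly_roots_bound[OF q0] by linarith
qed

text \<open>Let \<open>m\<close> of the \<open>P l\<close> be nonzero. Shifting \<open>r\<close> by \<open>i < m\<close> shows that the \<open>m \<times> m\<close> matrix with entries
  \<open>\<alpha> ^ (i l) P l (X + n i)\<close> is singular at each of the points \<open>n r + s\<close>. Its determinant has too
  small a degree for that many zeros, and its leading coefficient is a Vandermonde determinant.\<close>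

lemma exponential_polynomial_zero_lemma:
  fixes P :: "nat \<Rightarrow> rat poly"
  assumes \<alpha>: "\<alpha> > 1" and \<beta>: "\<beta> \<noteq> 0" and deg: "\<And>l. l < L \<Longrightarrow> degree (P l) < K"
    and Sn: "S \<le> n" and RS: "K * L \<le> (R + 1 - L) * S"
    and zero: "\<And>r s. r < R \<Longrightarrow> s < S \<Longrightarrow>
      (\<Sum>l<L. poly (P l) (of_nat (n * r + s)) * (\<alpha> ^ (l * r) * \<beta> ^ (l * s))) = 0"
    and l: "l < L"
  shows "P l = 0"
proof (rule ccontr)
  assume nz: "P l \<noteq> 0"
  define J where "J = {l. l < L \<and> P l \<noteq> 0}"
  define m where "m = card J"
  have finJ: "finite J" unfolding J_def by auto
  have mpos: "m > 0" using nz l finJ unfolding m_def J_def by (auto simp: card_gt_0_iff)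
  have mL: "m \<le> L" unfolding m_def J_def using card_mono[of "{..<L}" "{l. l < L \<and> P l \<noteq> 0}"] by auto
  obtain e where e: "bij_betw e {0..<m} J"
    using ex_bij_betw_nat_finite[OF finJ] unfolding m_def by blast
  have eJ: "e j < L" "P (e j) \<noteq> 0" if "j < m" for j
    using bij_betw_apply[OF e, of j] that unfolding J_def by auto
  \<comment> \<open>Column j belongs to the j-th nonzero polynomial, row i to the shift of r by i,
    which multiplies the exponential by \<open>\<alpha> ^ (i * e j)\<close>. Row i applied to the
    vector of the remaining exponentials is the assumed zero at (r + i, s).\<close>
  define T where "T i j = smult (\<alpha> ^ (i * e j)) (P (e j) \<circ>\<^sub>p [:of_nat (n * i), 1:])" for i j
  define D where "D = det (mat m m (\<lambda>(i,j). T i j))"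
  have degT: "degree (T i j) = degree (P (e j))" for i j
    unfolding T_def using \<alpha> by (simp add: degree_pcompose)
  have root: "poly D (of_nat (n * r + s)) = 0" if rs: "r < R + 1 - L" "s < S" for r s
  proof -
    define z :: rat where "z = of_nat (n * r + s)"
    define A where "A = mat m m (\<lambda>(i,j). poly (T i j) z)"
    define v where "v = vec m (\<lambda>j. \<alpha> ^ (e j * r) * \<beta> ^ (e j * s))"
    have "poly D z = det A" unfolding D_def A_def det_mat_leibniz
      by (simp add: poly_sum poly_prod)
    moreover have "A *\<^sub>v v = 0\<^sub>v m"
    proof (intro eq_vecI)
      fix i assume "i < dim_vec (0\<^sub>v m :: rat vec)"
      hence i: "i < m" by simp
      have "(A *\<^sub>v v) $ i = (\<Sum>j=0..<m. poly (T i j) z * (\<alpha> ^ (e j * r) * \<beta> ^ (e j * s)))"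
        using i unfolding A_def v_def by (simp add: scalar_prod_def)
      also have "\<dots> = (\<Sum>j=0..<m. poly (P (e j)) (of_nat (n * (r + i) + s)) * (\<alpha> ^ (e j * (r + i)) * \<beta> ^ (e j * s)))"
        unfolding T_def z_def by (intro sum.cong) (auto simp: poly_pcompose algebra_simps power_add)
      also have "\<dots> = (\<Sum>l\<in>J. poly (P l) (of_nat (n * (r + i) + s)) * (\<alpha> ^ (l * (r + i)) * \<beta> ^ (l * s)))"
        using e by (rule sum.reindex_bij_betw)
      also have "\<dots> = (\<Sum>l<L. poly (P l) (of_nat (n * (r + i) + s)) * (\<alpha> ^ (l * (r + i)) * \<beta> ^ (l * s)))"
        unfolding J_def by (intro sum.mono_neutral_left) auto
      also have "\<dots> = 0" using rs i mL by (intro zero) auto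
      finally show "(A *\<^sub>v v) $ i = 0\<^sub>v m $ i" using i by simp
    qed (auto simp: A_def)
    moreover have "v \<noteq> 0\<^sub>v m"
    proof
      assume "v = 0\<^sub>v m"
      hence "v $ 0 = 0" using mpos by simp
      thus False using mpos \<alpha> \<beta> unfolding v_def by simp
    qed
    moreover have "v \<in> carrier_vec m" "A \<in> carrier_mat m m" unfolding v_def A_def by auto
    ultimately show ?thesis
      using det_0_iff_vec_prod_zero_field[of A m] unfolding z_def by metis
  qed
  \<comment> \<open>Shifts preserve degrees, so every term of the Leibniz formula has degree exactly
    d. The coefficient of \<open>D\<close> at d is therefore the determinant of the leading
    coefficients.\<close>
  define d where "d = (\<Sum>j=0..<m. degree (P (e j)))"
  have deg_term: "degree (\<Prod>i=0..<m. T i (\<sigma> i)) \<le> d" 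
    and coeff_term: "coeff (\<Prod>i=0..<m. T i (\<sigma> i)) d = (\<Prod>i=0..<m. coeff (T i (\<sigma> i)) (degree (P (e (\<sigma> i)))))"
    if "\<sigma> permutes {0..<m}" for \<sigma>
  proof -
    have d: "d = (\<Sum>i=0..<m. degree (T i (\<sigma> i)))"
      unfolding d_def degT using sum.permute[OF that, of "\<lambda>j. degree (P (e j))"] by (simp add: o_def)
    have ne: "T i (\<sigma> i) \<noteq> 0" if "i \<in> {0..<m}" for i
    proof -
      have "\<sigma> i < m" using that permutes_in_image[OF \<open>\<sigma> permutes _\<close>, of i] by auto
      hence "P (e (\<sigma> i)) \<noteq> 0" using eJ by auto
      thus ?thesis unfolding T_def using \<alpha> by (simp add: pcompose_eq_0_iff)
    qed
    hence deg_eq: "degree (\<Prod>i=0..<m. T i (\<sigma> i)) = d"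
      unfolding d by (intro degree_prod_sum_eq)
    thus "degree (\<Prod>i=0..<m. T i (\<sigma> i)) \<le> d" by simp
    have "coeff (\<Prod>i=0..<m. T i (\<sigma> i)) d = lead_coeff (\<Prod>i=0..<m. T i (\<sigma> i))" using deg_eq by simp
    thus "coeff (\<Prod>i=0..<m. T i (\<sigma> i)) d = (\<Prod>i=0..<m. coeff (T i (\<sigma> i)) (degree (P (e (\<sigma> i)))))"
      by (simp add: lead_coeff_prod degT)
  qed
  have "degree D \<le> d" unfolding D_def det_mat_leibniz
  proof (intro degree_sum_le)
    fix \<sigma> assume "\<sigma> \<in> {\<sigma>. \<sigma> permutes {0..<m}}"
    hence "degree (\<Prod>i=0..<m. T i (\<sigma> i)) \<le> d" using deg_term by auto
    moreover have "(of_int (sign \<sigma>) :: rat poly) = [:of_int (sign \<sigma>):]"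
      by (simp add: of_int_poly)
    ultimately show "degree (of_int (sign \<sigma>) * (\<Prod>i=0..<m. T i (\<sigma> i))) \<le> d"
      using degree_mult_le[of "of_int (sign \<sigma>)" "\<Prod>i=0..<m. T i (\<sigma> i)"] by simp
  qed (auto intro: finite_permutations)
  also have "d < K * L"
  proof -
    have "d \<le> (\<Sum>j=0..<m. K - 1)" unfolding d_def using eJ deg
      by (intro sum_mono) (metis Suc_pred' atLeastLessThan_iff bot_nat_0.not_eq_extremum less_Suc_eq_le not_less_zero)
    also have "\<dots> = m * (K - 1)" by simp
    also have "K > 0" using deg[OF l] by simp
    hence "m * (K - 1) < m * K" using mpos by simp
    also have "m * K \<le> K * L" using mL by simp
    finally show ?thesis .
  qed
  also have "K * L \<le> card ((\<lambda>(r,s). of_nat (n * r + s) :: rat) ` ({..<R + 1 - L} \<times> {..<S}))"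
  proof -
    \<comment> \<open>S \<le> n makes r and s the quotient and the remainder of n r + s by n, so
      distinct pairs give distinct roots.\<close>
    have "inj_on (\<lambda>(r,s). of_nat (n * r + s) :: rat) ({..<R + 1 - L} \<times> {..<S})"
    proof (rule inj_onI, clarsimp simp del: of_nat_add of_nat_mult, goal_cases)
      case (1 r s r' s')
      hence s: "s < n" "s' < n" using Sn by auto
      have "(n * r + s) div n = (n * r' + s') div n" "(n * r + s) mod n = (n * r' + s') mod n"
        using 1 by auto
      thus ?case using s by auto
    qed
    thus ?thesis using RS by (simp add: card_image)
  qed
  finally have less: "degree D < card ((\<lambda>(r,s). of_nat (n * r + s) :: rat) ` ({..<R + 1 - L} \<times> {..<S}))" .
  have "D = 0"
  proof (rule ccontr)
    assume D: "D \<noteq> 0"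
    have "(\<lambda>(r,s). of_nat (n * r + s) :: rat) ` ({..<R + 1 - L} \<times> {..<S}) \<subseteq> {z. poly D z = 0}"
      using root by auto
    from card_mono[OF poly_roots_finite[OF D] this] show False
      using less card_poly_roots_bound[OF D] by linarith
  qed
  moreover have "coeff D d = det (mat m m (\<lambda>(i,j). coeff (T i j) (degree (P (e j)))))"
    unfolding D_def det_mat_leibniz coeff_sum
  proof (intro sum.cong refl)
    fix \<sigma> assume "\<sigma> \<in> {\<sigma>. \<sigma> permutes {0..<m}}"
    thus "coeff (of_int (sign \<sigma>) * (\<Prod>i=0..<m. T i (\<sigma> i))) d =
      of_int (sign \<sigma>) * (\<Prod>i=0..<m. coeff (T i (\<sigma> i)) (degree (P (e (\<sigma> i)))))"
      using coeff_term by (simp add: of_int_poly)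
  qed
  ultimately have det0: "det (mat m m (\<lambda>(i,j). coeff (T i j) (degree (P (e j))))) = 0" by simp
  have lead: "coeff (T i j) (degree (P (e j))) = (\<alpha> ^ e j) ^ i * lead_coeff (P (e j))" for i j
  proof -
    have "coeff (T i j) (degree (P (e j))) = lead_coeff (T i j)" by (simp only: degT)
    also have "\<dots> = (\<alpha> ^ e j) ^ i * lead_coeff (P (e j))"
      unfolding T_def lead_coeff_smult
      by (subst lead_coeff_comp) (simp_all add: power_mult[symmetric] mult.commute)
    finally show ?thesis .
  qed
  \<comment> \<open>Column j has the common factor \<open>lead_coeff (P (e j))\<close>. What is left
    is a Vandermonde matrix in powers of \<alpha>, distinct because \<alpha> > 1 and e is
    injective.\<close>
  have "det (mat m m (\<lambda>(i,j). coeff (T i j) (degree (P (e j)))))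
      = (\<Prod>j=0..<m. lead_coeff (P (e j))) * det (mat m m (\<lambda>(i,j). (\<alpha> ^ e j) ^ i))"
    unfolding lead det_mat_leibniz sum_distrib_left
  proof (intro sum.cong refl, goal_cases)
    case (1 \<sigma>)
    hence "(\<Prod>i=0..<m. lead_coeff (P (e (\<sigma> i)))) = (\<Prod>j=0..<m. lead_coeff (P (e j)))"
      using prod.permute[of \<sigma> "{0..<m}" "\<lambda>j. lead_coeff (P (e j))"] by (simp add: o_def)
    thus ?case by (simp add: prod.distrib)
  qed
  moreover have "inj_on (\<lambda>j. \<alpha> ^ e j) {..<m}"
    using e \<alpha> unfolding bij_betw_def inj_on_def by (auto simp: lessThan_atLeast0)
  hence "det (mat m m (\<lambda>(i,j). (\<alpha> ^ e j) ^ i)) \<noteq> 0" by (rule vandermonde_det_nonzero)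
  moreover have "(\<Prod>j=0..<m. lead_coeff (P (e j))) \<noteq> 0" using eJ by auto
  ultimately show False using det0 by simp
qed


text \<open>The integer \<open>(a / b) ^ (l (r - c))\<close> times a denominator depending on \<open>r\<close> only. Taking \<open>c\<close>
  in the middle of the range of \<open>r\<close> halves the exponents; without this the constant 53.8 would be out
  of reach.\<close>

definition centered_monomial :: "int \<Rightarrow> int \<Rightarrow> nat \<Rightarrow> nat \<Rightarrow> nat \<Rightarrow> nat \<Rightarrow> int" where
  "centered_monomial a b w c l r =
    (if c \<le> r then a ^ (l * (r - c)) * b ^ ((w - l) * (r - c))
     else b ^ (l * (c - r)) * a ^ ((w - l) * (c - r)))"

definition centered_scale :: "int \<Rightarrow> int \<Rightarrow> nat \<Rightarrow> nat \<Rightarrow> nat \<Rightarrow> int" where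
  "centered_scale a b w c r = (if c \<le> r then b ^ (w * (r - c)) else a ^ (w * (c - r)))"

definition centered_dist :: "nat \<Rightarrow> nat \<Rightarrow> nat" where
  "centered_dist c r = (if c \<le> r then r - c else c - r)"

text \<open>Of the two extra factors one depends on l, hence on the row of the determinant, and the
  other on r, hence on the column. Both are p-adic units if p does not divide a b, so clearing
  denominators and centring affect neither vanishing nor divisibility by powers of p.\<close>

lemma centered_monomial_eq:
  assumes "a \<noteq> 0" "b \<noteq> 0" "l \<le> w"
  shows "rat_of_int (centered_monomial a b w c l r) =
    (of_int a / of_int b) ^ (l * r) * (of_int b / of_int a) ^ (l * c) * of_int (centered_scale a b w c r)"
proof (cases "c \<le> r")
  case True
  then obtain d where r: "r = c + d" using le_Suc_ex by blast
  obtain e where w: "w = l + e" using assms(3) le_Suc_ex by blast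
  show ?thesis using assms(1,2) unfolding centered_monomial_def centered_scale_def r w
    by (simp add: power_divide power_add distrib_left distrib_right)
next
  case False
  then obtain d where c: "c = r + d" by (meson le_Suc_ex nat_le_linear)
  obtain e where w: "w = l + e" using assms(3) le_Suc_ex by blast
  show ?thesis using assms(1,2) False unfolding centered_monomial_def centered_scale_def c w
    by (simp add: power_divide power_add distrib_left distrib_right)
qed

text \<open>The exponents of the two bases add up to w times the distance from the centre, whatever
  l is. So the bound depends on the column only.\<close>

lemma centered_monomial_abs_le:
  assumes "\<bar>a\<bar> \<le> h" "\<bar>b\<bar> \<le> h" "l \<le> w"
  shows "\<bar>centered_monomial a b w c l r\<bar> \<le> h ^ (w * centered_dist c r)"
proof -
  have gen: "\<bar>u ^ (l * d) * v ^ ((w - l) * d)\<bar> \<le> h ^ (w * d)" if "\<bar>u\<bar> \<le> h" "\<bar>v\<bar> \<le> h" for u v d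
  proof -
    have "\<bar>u ^ (l * d) * v ^ ((w - l) * d)\<bar> = \<bar>u\<bar> ^ (l * d) * \<bar>v\<bar> ^ ((w - l) * d)"
      by (simp add: abs_mult power_abs)
    also have "\<dots> \<le> h ^ (l * d) * h ^ ((w - l) * d)"
      using that by (intro mult_mono power_mono) auto
    also have "\<dots> = h ^ (w * d)"
      using assms(3) by (simp add: power_add[symmetric] add_mult_distrib[symmetric])
    finally show ?thesis .
  qed
  show ?thesis unfolding centered_monomial_def centered_dist_def
    using gen[of a b] gen[of b a] assms by auto
qed

lemma centered_scale_nonzero: "a \<noteq> 0 \<Longrightarrow> b \<noteq> 0 \<Longrightarrow> centered_scale a b w c r \<noteq> 0"
  unfolding centered_scale_def by auto

text \<open>Each side of the centre contributes about R^2 / 8, against about R^2 / 2 for distances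
  measured from an end. The two parities of R are summed separately.\<close>

lemma sum_centered_dist_le: "4 * (\<Sum>r<R. centered_dist (R div 2) r) \<le> R\<^sup>2"
proof -
  define c where "c = R div 2"
  have R: "R = 2 * c \<or> R = 2 * c + 1" unfolding c_def by linarith
  have low: "2 * (\<Sum>r<m. m - r) = m * (m + 1)" for m :: nat
  proof (induction m)
    case (Suc m)
    have "(\<Sum>r<Suc m. Suc m - r) = (\<Sum>r<m. Suc (m - r)) + 1"
      by (simp add: Suc_diff_le)
    also have "(\<Sum>r<m. Suc (m - r)) = (\<Sum>r<m. m - r) + m"
      by (simp only: Suc_eq_plus1 sum.distrib) simp
    finally show ?case using Suc by simp
  qed simp
  have high: "2 * (\<Sum>r<m. r) + m = m * m" for m :: nat by (induction m) auto
  have "(\<Sum>r<c + d. centered_dist c r) = (\<Sum>r<c. c - r) + (\<Sum>r<d. r)" for d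
  proof (induction d)
    case 0
    show ?case by (simp add: centered_dist_def)
  qed (simp add: centered_dist_def)
  moreover have "c + (R - c) = R" unfolding c_def by simp
  ultimately have "(\<Sum>r<R. centered_dist c r) = (\<Sum>r<c. c - r) + (\<Sum>r<R - c. r)"
    by metis
  hence eq: "4 * (\<Sum>r<R. centered_dist c r) = 2 * (c * (c + 1)) + 2 * (2 * (\<Sum>r<R - c. r))"
    using low[of c] by linarith
  from R show ?thesis
  proof
    assume R: "R = 2 * c"
    hence "R - c = c" by simp
    thus ?thesis using eq high[of c] unfolding c_def[symmetric] by (simp add: R power2_eq_square algebra_simps)
  next
    assume R: "R = 2 * c + 1"
    hence "R - c = Suc c" by simp
    thus ?thesis using eq high[of "Suc c"] unfolding c_def[symmetric] by (simp add: R power2_eq_square algebra_simps)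
  qed
qed

section \<open>The binomial basis and the numbering of rows\<close>

text \<open>The determinant uses z choose k at natural numbers only, whereas the zero estimate
  speaks of polynomials and their degrees.\<close>

definition binomial_poly :: "nat \<Rightarrow> rat poly" where
  "binomial_poly k = smult (inverse (fact k)) (\<Prod>i<k. [:- of_nat i, 1:])"

lemma poly_binomial_poly: "poly (binomial_poly k) (of_nat z) = of_nat (z choose k)"
  unfolding binomial_poly_def
  by (simp add: poly_prod binomial_gbinomial gbinomial_prod_rev lessThan_atLeast0 field_simps)

lemma degree_binomial_poly: "degree (binomial_poly k) = k"
  unfolding binomial_poly_def by (simp add: degree_prod_sum_eq)

text \<open>Evaluation at z = k gives a triangular system with diagonal entries 1.\<close>

lemma binomial_combination_zero:
  fixes d :: "nat \<Rightarrow> rat"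
  assumes "\<And>z. (\<Sum>k<K. d k * of_nat (z choose k)) = 0"
  shows "k < K \<Longrightarrow> d k = 0"
proof (induction k rule: less_induct)
  case (less k)
  have "0 = (\<Sum>j<K. d j * of_nat (k choose j))" using assms by simp
  also have "\<dots> = (\<Sum>j\<in>{k}. d j * of_nat (k choose j))"
  proof (rule sum.mono_neutral_right)
    show "\<forall>j\<in>{..<K} - {k}. d j * of_nat (k choose j) = 0"
    proof
      fix j assume "j \<in> {..<K} - {k}"
      thus "d j * of_nat (k choose j) = 0"
        using less.IH[of j] by (cases "j < k") (auto simp: binomial_eq_0)
    qed
  qed (use less in auto)
  finally show ?case by simp
qed

text \<open>The rows of the determinant carry a single index i; \<open>i div L\<close> recovers the
  degree k and \<open>i mod L\<close> the exponent l.\<close>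

lemma lessThan_prod_split:
  fixes K L :: nat
  assumes "L > 0"
  shows "bij_betw (\<lambda>(k, l). k * L + l) ({..<K} \<times> {..<L}) {..<K * L}"
proof (rule bij_betw_byWitness[where f' = "\<lambda>i. (i div L, i mod L)"])
  show "(\<lambda>(k, l). k * L + l) ` ({..<K} \<times> {..<L}) \<subseteq> {..<K * L}"
  proof clarsimp
    fix k l assume "k < K" "l < L"
    hence "k * L + l < Suc k * L" by simp
    also have "\<dots> \<le> K * L" using \<open>k < K\<close> by (intro mult_le_mono1) simp
    finally show "k * L + l < K * L" .
  qed
  show "(\<lambda>i. (i div L, i mod L)) ` {..<K * L} \<subseteq> {..<K} \<times> {..<L}"
    using assms by (auto simp: less_mult_imp_div_less)
qed (use assms in auto)

lemma sum_div_mod: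
  fixes f :: "nat \<Rightarrow> nat \<Rightarrow> 'a :: comm_monoid_add"
  assumes "L > 0"
  shows "(\<Sum>i<K * L. f (i div L) (i mod L)) = (\<Sum>k<K. \<Sum>l<L. f k l)"
proof -
  have "(\<Sum>i<K * L. f (i div L) (i mod L)) =
    (\<Sum>(k, l)\<in>{..<K} \<times> {..<L}. f ((k * L + l) div L) ((k * L + l) mod L))"
    using sum.reindex_bij_betw[OF lessThan_prod_split[OF assms], of "\<lambda>i. f (i div L) (i mod L)" K]
    by (simp add: case_prod_unfold)
  also have "\<dots> = (\<Sum>(k, l)\<in>{..<K} \<times> {..<L}. f k l)" by (intro sum.cong) auto
  finally show ?thesis by (simp only: sum.cartesian_product)
qed

lemma prod_div:
  fixes f :: "nat \<Rightarrow> 'a :: comm_semiring_1"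
  assumes "L > 0"
  shows "(\<Prod>i<K * L. f (i div L)) = (\<Prod>k<K. f k) ^ L"
proof -
  have "(\<Prod>i<K * L. f (i div L)) =
    (\<Prod>(k, l)\<in>{..<K} \<times> {..<L}. f ((k * L + l) div L))"
    using prod.reindex_bij_betw[OF lessThan_prod_split[OF assms], of "\<lambda>i. f (i div L)" K]
    by (simp add: case_prod_unfold)
  also have "\<dots> = (\<Prod>(k, l)\<in>{..<K} \<times> {..<L}. f k)" by (intro prod.cong) auto
  also have "\<dots> = (\<Prod>k<K. \<Prod>l<L. f k)" by (simp only: prod.cartesian_product)
  finally show ?thesis by (simp add: prod_power_distrib)
qed

text \<open>Expand ((B - 1) + 1)^(z - k) and regroup by the identity for (z choose m) (m choose k).
  The coefficient of z choose m contains the power (B - 1)^(m - k) and no denominators, which is the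
  source of the p-divisibility for B close to 1.\<close>

lemma binomial_power_expansion:
  fixes B :: "'a :: comm_ring_1"
  assumes "z < Z"
  shows "of_nat (z choose k) * B ^ z =
    (\<Sum>m<Z. (of_nat (m choose k) * B ^ k * (B - 1) ^ (m - k)) * of_nat (z choose m))"
proof (cases "k \<le> z")
  case True
  define F where "F m = (of_nat (m choose k) * B ^ k * (B - 1) ^ (m - k)) * of_nat (z choose m)" for m
  have "(\<Sum>m<Z. F m) = (\<Sum>m\<in>{k..z}. F m)"
    using assms by (intro sum.mono_neutral_right) (auto simp: F_def not_le not_less binomial_eq_0)
  also have "\<dots> = (\<Sum>i\<in>{0..z - k}. F (i + k))"
    using sum.shift_bounds_cl_nat_ivl[of F 0 k "z - k"] True by simp
  also have "\<dots> = (\<Sum>i\<in>{0..z - k}. (of_nat ((i + k) choose k) * B ^ k * (B - 1) ^ i) * of_nat (z choose (i + k)))"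
    unfolding F_def by simp
  also have "\<dots> = (\<Sum>i\<in>{0..z - k}. of_nat (z choose k) * B ^ k * (of_nat ((z - k) choose i) * (B - 1) ^ i))"
  proof (intro sum.cong refl)
    fix i assume "i \<in> {0..z - k}"
    hence "(z choose (i + k)) * ((i + k) choose k) = (z choose k) * ((z - k) choose i)"
      using choose_mult[of k "i + k" z] True by simp
    hence eq: "of_nat (z choose (i + k)) * of_nat ((i + k) choose k) = (of_nat (z choose k) * of_nat ((z - k) choose i) :: 'a)"
      by (metis of_nat_mult)
    have "(of_nat ((i + k) choose k) * B ^ k * (B - 1) ^ i) * of_nat (z choose (i + k)) =
      (of_nat (z choose (i + k)) * of_nat ((i + k) choose k)) * (B ^ k * (B - 1) ^ i)"
      by (simp only: mult_ac)
    also have "\<dots> = of_nat (z choose k) * B ^ k * (of_nat ((z - k) choose i) * (B - 1) ^ i)"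
      unfolding eq by (simp only: mult_ac)
    finally show "(of_nat ((i + k) choose k) * B ^ k * (B - 1) ^ i) * of_nat (z choose (i + k)) =
      of_nat (z choose k) * B ^ k * (of_nat ((z - k) choose i) * (B - 1) ^ i)" .
  qed
  also have "\<dots> = of_nat (z choose k) * B ^ k * (\<Sum>i\<in>{0..z - k}. of_nat ((z - k) choose i) * (B - 1) ^ i)"
    by (rule sum_distrib_left[symmetric])
  also have "(\<Sum>i\<in>{0..z - k}. of_nat ((z - k) choose i) * (B - 1) ^ i) = ((B - 1) + 1) ^ (z - k)"
    unfolding binomial_ring by (simp add: atLeast0AtMost)
  also have "of_nat (z choose k) * B ^ k * ((B - 1) + 1) ^ (z - k) = of_nat (z choose k) * B ^ z"
    using True by (simp add: mult.assoc power_add[symmetric])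
  finally show ?thesis unfolding F_def ..
next
  case False
  have "(of_nat (m choose k) * B ^ k * (B - 1) ^ (m - k)) * of_nat (z choose m) = 0" for m
    using False by (cases "m < k") (auto simp: binomial_eq_0)
  thus ?thesis using False by (simp add: binomial_eq_0)
qed

section \<open>The interpolation determinant: divisibility against size\<close>

text \<open>The zero estimate supplies grid points with a nonzero integer determinant. Being
  divisible by \<open>p ^ (E * V)\<close>, it is at least that large, and the right side is its
  Leibniz bound. V is what N (N - 1) / 2 with N = K L leaves after subtracting the starting indices
  of all rows.\<close>

lemma interpolation_determinant_bound:
  fixes a b x y :: int and p E n K L R S :: nat
  assumes p: "prime p" and ab: "1 \<le> b" "b < a" "\<not> int p dvd a" "\<not> int p dvd b"
    and xy: "\<not> int p dvd x" "\<not> int p dvd y" "int p ^ E dvd x - y"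
    and approx: "padic_dvd p (E * (K * L)) (of_int a / of_int b - (of_int x / of_int y) ^ n)"
    and L: "L > 0" and Sn: "S \<le> n" and RS: "K * L \<le> (R + 1 - L) * S"
    and V: "2 * V = K * L * (K * (L - 1))"
    and H: "\<bar>x\<bar> \<le> int H" "\<bar>y\<bar> \<le> int H"
  shows "p ^ (E * V) \<le> fact (K * L) * (\<Prod>k<K. (n * R) choose k) ^ L *
    nat a ^ ((L - 1) * (S * (\<Sum>r<R. centered_dist (R div 2) r))) *
    H ^ ((L - 1) * (R * (\<Sum>s<S. centered_dist (S div 2) s)))"
proof -
  define N w where "N = K * L" and "w = L - 1"
  define \<alpha> \<beta> :: rat where "\<alpha> = of_int a / of_int b" and "\<beta> = of_int x / of_int y"
  have nz: "a \<noteq> 0" "b \<noteq> 0" "x \<noteq> 0" "y \<noteq> 0" using ab xy by auto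
  \<comment> \<open>Columns are grid points (r, s). The entry is the value of the function times a
    row factor \<open>v\<close> and a column factor \<open>\<gamma>\<close>. Both factors are
    nonzero and p-integral, so independence and divisibility can be checked on the values.\<close>
  define \<phi> :: "nat \<Rightarrow> nat \<times> nat \<Rightarrow> int" where
    "\<phi> = (\<lambda>i (r, s). int ((n * r + s) choose (i div L)) *
      (centered_monomial a b w (R div 2) (i mod L) r * centered_monomial x y w (S div 2) (i mod L) s))"
  define v :: "nat \<Rightarrow> rat" where
    "v l = (of_int b / of_int a) ^ (l * (R div 2)) * (of_int y / of_int x) ^ (l * (S div 2))" for l
  define \<gamma> :: "nat \<times> nat \<Rightarrow> rat" where
    "\<gamma> = (\<lambda>(r, s). of_int (centered_scale a b w (R div 2) r * centered_scale x y w (S div 2) s))"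
  have modL: "i mod L \<le> w" for i using L unfolding w_def by (metis Suc_pred' less_Suc_eq_le mod_less_divisor)
  have \<phi>: "of_int (\<phi> i (r, s)) = v (i mod L) * \<gamma> (r, s) *
    (of_nat ((n * r + s) choose (i div L)) * (\<alpha> ^ (i mod L * r) * \<beta> ^ (i mod L * s)))" for i r s
    unfolding \<phi>_def v_def \<gamma>_def \<alpha>_def \<beta>_def
    using centered_monomial_eq[OF nz(1,2) modL] centered_monomial_eq[OF nz(3,4) modL] by simp
  have v0: "v l \<noteq> 0" for l unfolding v_def using nz by simp
  have \<gamma>0: "\<gamma> q \<noteq> 0" for q unfolding \<gamma>_def using nz centered_scale_nonzero by (cases q) auto
  define X where "X = {..<R} \<times> {..<S}"
  have "\<exists>g. (\<forall>j<N. g j \<in> X) \<and> det (mat N N (\<lambda>(i,j). rat_of_int (\<phi> i (g j)))) \<noteq> 0"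
  proof (rule exists_nonzero_minor)
    fix c :: "nat \<Rightarrow> rat" assume c: "\<forall>q\<in>X. (\<Sum>i<N. c i * of_int (\<phi> i q)) = 0"
    \<comment> \<open>Collecting the terms with the same l turns a vanishing combination of rows
      into an exponential polynomial with coefficients \<open>P l\<close> in the binomial
      basis.\<close>
    define P where "P l = (\<Sum>k<K. smult (c (k * L + l) * v l) (binomial_poly k))" for l
    have Pval: "poly (P l) (of_nat z) = (\<Sum>k<K. c (k * L + l) * v l * of_nat (z choose k))" for l z
      unfolding P_def by (simp add: poly_sum poly_binomial_poly)
    have P0: "P l = 0" if "l < L" for l
    proof (cases "K = 0")
      case False
      show ?thesis
      proof (rule exponential_polynomial_zero_lemma[of \<alpha> \<beta> L P K S n R l, OF _ _ _ Sn RS])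
        show "\<alpha> > 1" unfolding \<alpha>_def using ab by simp
        show "\<beta> \<noteq> 0" unfolding \<beta>_def using nz by simp
        show "degree (P l) < K" for l unfolding P_def using False
          by (intro degree_sum_less) (auto intro: le_less_trans[OF degree_smult_le] simp: degree_binomial_poly)
        fix r s assume rs: "r < R" "s < S"
        have "0 = (\<Sum>i<K * L. c i * of_int (\<phi> i (r, s)))" using c rs unfolding X_def N_def by simp
        also have "\<dots> = (\<Sum>i<K * L. c (i div L * L + i mod L) * (v (i mod L) * \<gamma> (r, s) *
            (of_nat ((n * r + s) choose (i div L)) * (\<alpha> ^ (i mod L * r) * \<beta> ^ (i mod L * s)))))"
          unfolding \<phi> by simp
        also have "\<dots> = (\<Sum>k<K. \<Sum>l<L. c (k * L + l) * (v l * \<gamma> (r, s) *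
            (of_nat ((n * r + s) choose k) * (\<alpha> ^ (l * r) * \<beta> ^ (l * s)))))"
          using sum_div_mod[OF L, of "\<lambda>k l. c (k * L + l) * (v l * \<gamma> (r, s) *
            (of_nat ((n * r + s) choose k) * (\<alpha> ^ (l * r) * \<beta> ^ (l * s))))" K] .
        also have "\<dots> = \<gamma> (r, s) * (\<Sum>l<L. poly (P l) (of_nat (n * r + s)) * (\<alpha> ^ (l * r) * \<beta> ^ (l * s)))"
          unfolding Pval sum_distrib_left sum_distrib_right
          by (subst sum.swap) (simp add: mult_ac)
        finally show "(\<Sum>l<L. poly (P l) (of_nat (n * r + s)) * (\<alpha> ^ (l * r) * \<beta> ^ (l * s))) = 0"
          using \<gamma>0[of "(r, s)"] by simp
      qed (use that in auto)
    qed (simp add: P_def)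
    show "\<forall>i<N. c i = 0"
    proof (intro allI impI)
      fix i assume i: "i < N"
      hence kl: "i div L < K" "i mod L < L" using L unfolding N_def by (auto simp: less_mult_imp_div_less)
      have "(\<Sum>k<K. c (k * L + i mod L) * v (i mod L) * of_nat (z choose k)) = 0" for z
        using Pval[of "i mod L" z] P0[OF kl(2)] by simp
      from binomial_combination_zero[OF this kl(1)] have "c (i div L * L + i mod L) * v (i mod L) = 0" .
      thus "c i = 0" using v0 by simp
    qed
  qed
  then obtain g where g: "\<forall>j<N. g j \<in> X" "det (mat N N (\<lambda>(i,j). rat_of_int (\<phi> i (g j)))) \<noteq> 0" by blast
  define D where "D = det (mat N N (\<lambda>(i,j). \<phi> i (g j)))"
  have Drat: "det (mat N N (\<lambda>(i,j). rat_of_int (\<phi> i (g j)))) = of_int D"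
    unfolding D_def det_mat_leibniz by simp
  hence D0: "D \<noteq> 0" using g(2) by auto

  \<comment> \<open>Distinctness of the points will allow the product over the columns to be
    compared with a product over the grid.\<close>
  have inj: "inj_on g {..<N}"
  proof (rule inj_onI, rule ccontr)
    fix j j' assume j: "j \<in> {..<N}" "j' \<in> {..<N}" "g j = g j'" "j \<noteq> j'"
    have "det (mat N N (\<lambda>(i,j). rat_of_int (\<phi> i (g j)))) = 0"
    proof (rule det_identical_columns[of _ N j j'])
      show "col (mat N N (\<lambda>(i,j). rat_of_int (\<phi> i (g j)))) j = col (mat N N (\<lambda>(i,j). rat_of_int (\<phi> i (g j)))) j'"
        using j by (intro eq_vecI) auto
    qed (use j in auto)
    thus False using g(2) by simp
  qed

  have \<alpha>0: "padic_dvd p 0 \<alpha>" and \<beta>0: "padic_dvd p 0 \<beta>"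
    and \<alpha>0': "padic_dvd p 0 (of_int b / of_int a)" and \<beta>0': "padic_dvd p 0 (of_int y / of_int x)"
    unfolding \<alpha>_def \<beta>_def using ab xy by (auto intro: padic_dvd_divide[OF p])
  have pv: "padic_dvd p 0 (v l)" for l
    unfolding v_def by (intro padic_dvd_mult_left[OF p] padic_dvd_power0[OF p] \<alpha>0' \<beta>0')
  have p\<gamma>: "padic_dvd p 0 (\<gamma> q)" for q
    unfolding \<gamma>_def by (cases q) (simp only: prod.case padic_dvd_of_int[OF p])
  have p\<beta>1: "padic_dvd p E (\<beta> - 1)"
  proof -
    have "padic_dvd p E (of_int (x - y))" using xy(3) by (simp only: padic_dvd_of_int_iff[OF p])
    from padic_dvd_mult_right[OF p this padic_dvd_divide[OF p xy(2), of 1]]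
    have "padic_dvd p E (of_int (x - y) * (of_int 1 / of_int y))" .
    moreover have "of_int (x - y) * (of_int 1 / of_int y) = \<beta> - 1"
      unfolding \<beta>_def using nz by (simp add: field_simps)
    ultimately show ?thesis by simp
  qed
  have p\<beta>l: "padic_dvd p E (\<beta> ^ l - 1)" for l
    using padic_dvd_power_diff[OF p p\<beta>1 \<beta>0 padic_dvd_one[OF p], of l] by simp
  define z where "z j = n * fst (g j) + snd (g j)" for j
  define Z where "Z = Suc (\<Sum>j<N. z j)"
  have zZ: "z j < Z" if "j < N" for j
    using that member_le_sum[of j "{..<N}" z] unfolding Z_def by simp
  \<comment> \<open>Replacing \<alpha> by \<beta>^n turns the value into (z choose k) (\<beta>^l)^z
    at z = n r + s, which expands in the binomials z choose m with coefficients \<open>C\<close>.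
    \<open>W\<close> is the error of the replacement.\<close>
  define C where "C i m = v (i mod L) * (of_nat (m choose (i div L)) * (\<beta> ^ (i mod L)) ^ (i div L) *
    (\<beta> ^ (i mod L) - 1) ^ (m - i div L))" for i m
  define B where "B m j = \<gamma> (g j) * of_nat (z j choose m)" for m j
  define W where "W i j = v (i mod L) * \<gamma> (g j) * of_nat (z j choose (i div L)) * \<beta> ^ (i mod L * snd (g j)) *
    (\<alpha> ^ (i mod L * fst (g j)) - (\<beta> ^ n) ^ (i mod L * fst (g j)))" for i j
  have "padic_dvd p (E * V) (det (mat N N (\<lambda>(i,j). rat_of_int (\<phi> i (g j)))))"
  proof (rule padic_dvd_det[where Z = Z and C = C and B = B and W = W and k = "\<lambda>i. i div L" and E = E, OF p])
    fix i j assume ij: "i < N" "j < N"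
    obtain r s where rs: "g j = (r, s)" by force
    have zr: "z j = n * r + s" unfolding z_def rs by simp
    have "(\<Sum>m<Z. C i m * B m j) = v (i mod L) * \<gamma> (g j) * (\<Sum>m<Z. (of_nat (m choose (i div L)) *
      (\<beta> ^ (i mod L)) ^ (i div L) * (\<beta> ^ (i mod L) - 1) ^ (m - i div L)) * of_nat (z j choose m))"
      unfolding C_def B_def sum_distrib_left by (intro sum.cong) (auto simp: mult_ac)
    also have "\<dots> = v (i mod L) * \<gamma> (g j) * (of_nat (z j choose (i div L)) * (\<beta> ^ (i mod L)) ^ z j)"
      using binomial_power_expansion[OF zZ[OF ij(2)], of "i div L" "\<beta> ^ (i mod L)"] by simp
    finally have sum: "(\<Sum>m<Z. C i m * B m j) = \<dots>" .
    have "(\<beta> ^ (i mod L)) ^ z j = (\<beta> ^ n) ^ (i mod L * r) * \<beta> ^ (i mod L * s)"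
      unfolding zr by (simp add: power_mult[symmetric] power_add[symmetric] algebra_simps)
    thus "rat_of_int (\<phi> i (g j)) = (\<Sum>m<Z. C i m * B m j) + W i j"
      unfolding sum W_def rs \<phi> zr by (simp add: algebra_simps)
    have "padic_dvd p (E * N) (\<alpha> ^ (i mod L * r) - (\<beta> ^ n) ^ (i mod L * r))"
      using approx unfolding \<alpha>_def[symmetric] \<beta>_def[symmetric] N_def[symmetric]
      by (intro padic_dvd_power_diff[OF p] padic_dvd_power0[OF p] \<alpha>0 \<beta>0)
    thus "padic_dvd p (E * N) (W i j)" unfolding W_def rs fst_conv snd_conv
      by (intro padic_dvd_mult_left[OF p]) (auto intro!: padic_dvd_mult_left[OF p] pv p\<gamma> padic_dvd_of_nat[OF p] padic_dvd_power0[OF p] \<beta>0)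
  next
    fix i m assume "m < i div L"
    thus "C i m = 0" unfolding C_def by (simp add: binomial_eq_0)
  next
    fix i m
    show "padic_dvd p (E * (m - i div L)) (C i m)" unfolding C_def
      by (intro padic_dvd_mult_left[OF p] padic_dvd_power[OF p] p\<beta>l pv padic_dvd_of_nat[OF p] padic_dvd_power0[OF p] \<beta>0)
  next
    fix m j
    show "padic_dvd p 0 (B m j)" unfolding B_def
      by (intro padic_dvd_mult_left[OF p] padic_dvd_of_nat[OF p] p\<gamma>)
  next
    \<comment> \<open>Each k occurs in L rows, so twice the sum of the starting indices is N K - N.
      Together with 2 V = N K (L - 1) = N^2 - N K this gives exactly N (N - 1): the required
      inequality is an equality.\<close>
    have gauss: "2 * \<Sum>{..<K} + K = K * K" by (induction K) auto
    have kL: "(\<Sum>i<N. i div L) = L * \<Sum>{..<K}"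
    proof -
      have "(\<Sum>i<N. i div L) = (\<Sum>k<K. \<Sum>l<L. k)"
        unfolding N_def by (rule sum_div_mod[OF L, of "\<lambda>k l. k"])
      also have "\<dots> = L * \<Sum>{..<K}" unfolding sum_distrib_left by simp
      finally show ?thesis .
    qed
    have "2 * (\<Sum>i<N. i div L) + N = L * (2 * \<Sum>{..<K} + K)"
      unfolding kL unfolding N_def by (simp add: distrib_left)
    hence k: "2 * (\<Sum>i<N. i div L) + N = L * (K * K)" by (simp only: gauss)
    have "2 * V + N * K = N * N"
      using V L unfolding N_def by (cases L) (auto simp: algebra_simps)
    moreover have "N * K = L * (K * K)" unfolding N_def by simp
    ultimately have "2 * V + 2 * (\<Sum>i<N. i div L) + N = N * N" using k by linarith
    hence "2 * V + 2 * (\<Sum>i<N. i div L) = N * (N - 1)" by (simp add: diff_mult_distrib2)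
    hence "E * (2 * V + 2 * (\<Sum>i<N. i div L)) = E * (N * (N - 1))" by simp
    thus "2 * (E * V) + 2 * E * (\<Sum>i<N. i div L) \<le> E * (N * (N - 1))"
      by (simp add: algebra_simps)
  qed
  hence "int p ^ (E * V) dvd D" unfolding Drat padic_dvd_of_int_iff[OF p] .
  hence lower: "int p ^ (E * V) \<le> \<bar>D\<bar>" using D0 by (intro zdvd_imp_le) auto

  \<comment> \<open>The bound of an entry splits into a row part \<open>f\<close> and a column part
    \<open>h\<close>, so all N! terms of the Leibniz formula share one bound.\<close>
  define f where "f i = int ((n * R) choose (i div L))" for i
  define h where "h q = (case q of (r, s) \<Rightarrow> a ^ (w * centered_dist (R div 2) r) * int H ^ (w * centered_dist (S div 2) s))" for q
  have entry: "\<bar>\<phi> i (g j)\<bar> \<le> f i * h (g j)" if ij: "j < N" for i j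
  proof -
    obtain r s where rs: "g j = (r, s)" by force
    have rsX: "r < R" "s < S" using g(1) ij unfolding X_def rs[symmetric] by (auto simp: rs dest: spec[of _ j])
    have "n * r + s \<le> n * Suc r" using rsX Sn by simp
    also have "\<dots> \<le> n * R" using rsX by (intro mult_le_mono2) simp
    finally have "(n * r + s) choose (i div L) \<le> (n * R) choose (i div L)" by (rule binomial_right_mono)
    hence 1: "int ((n * r + s) choose (i div L)) \<le> f i" unfolding f_def by simp
    have "\<bar>\<phi> i (g j)\<bar> = int ((n * r + s) choose (i div L)) *
      (\<bar>centered_monomial a b w (R div 2) (i mod L) r\<bar> * \<bar>centered_monomial x y w (S div 2) (i mod L) s\<bar>)"
      unfolding \<phi>_def rs by (simp add: abs_mult)
    also have "\<dots> \<le> f i * h (g j)"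
      unfolding h_def rs prod.case using 1 ab H modL
      by (intro mult_mono centered_monomial_abs_le) (auto simp: f_def)
    finally show ?thesis .
  qed
  have h1: "h q \<ge> 1" for q
  proof -
    obtain r s where q: "q = (r, s)" by force
    have "1 \<le> a ^ (w * centered_dist (R div 2) r)" using ab by (intro one_le_power) simp
    moreover have "1 \<le> int H ^ (w * centered_dist (S div 2) s)"
      using H nz by (intro one_le_power) linarith
    ultimately show ?thesis unfolding h_def q prod.case
      using mult_mono[of 1 "a ^ (w * centered_dist (R div 2) r)" 1 "int H ^ (w * centered_dist (S div 2) s)"] by simp
  qed
  have "\<bar>D\<bar> \<le> (\<Sum>\<sigma> | \<sigma> permutes {0..<N}. \<bar>of_int (sign \<sigma>) * (\<Prod>i=0..<N. \<phi> i (g (\<sigma> i)))\<bar>)"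
    unfolding D_def det_mat_leibniz by (rule sum_abs)
  also have "\<dots> \<le> (\<Sum>\<sigma> | \<sigma> permutes {0..<N}. (\<Prod>i<N. f i) * (\<Prod>j<N. h (g j)))"
  proof (rule sum_mono)
    fix \<sigma> assume "\<sigma> \<in> {\<sigma>. \<sigma> permutes {0..<N}}"
    hence \<sigma>: "\<sigma> permutes {..<N}" by (simp add: lessThan_atLeast0)
    have "\<bar>of_int (sign \<sigma>) * (\<Prod>i=0..<N. \<phi> i (g (\<sigma> i)))\<bar> = (\<Prod>i<N. \<bar>\<phi> i (g (\<sigma> i))\<bar>)"
      by (simp add: abs_mult abs_prod lessThan_atLeast0 sign_def)
    also have "\<dots> \<le> (\<Prod>i<N. f i * h (g (\<sigma> i)))"
      using entry permutes_in_image[OF \<sigma>] by (intro prod_mono) auto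
    also have "\<dots> = (\<Prod>i<N. f i) * (\<Prod>i<N. h (g (\<sigma> i)))" by (rule prod.distrib)
    also have "(\<Prod>i<N. h (g (\<sigma> i))) = (\<Prod>j<N. h (g j))"
      using prod.permute[OF \<sigma>, of "\<lambda>j. h (g j)"] by (simp add: o_def)
    finally show "\<bar>of_int (sign \<sigma>) * (\<Prod>i=0..<N. \<phi> i (g (\<sigma> i)))\<bar> \<le> (\<Prod>i<N. f i) * (\<Prod>j<N. h (g j))" .
  qed
  also have "\<dots> = fact N * ((\<Prod>i<N. f i) * (\<Prod>j<N. h (g j)))"
    by (simp add: card_permutations)
  also have "(\<Prod>j<N. h (g j)) = (\<Prod>q\<in>g ` {..<N}. h q)" using inj by (simp add: prod.reindex)
  \<comment> \<open>The chosen points are unknown, but h is at least 1 everywhere, so the product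
    may be extended to the whole grid, where the exponents can be summed.\<close>
  also have "fact N * ((\<Prod>i<N. f i) * (\<Prod>q\<in>g ` {..<N}. h q)) \<le> fact N * ((\<Prod>i<N. f i) * (\<Prod>q\<in>X. h q))"
  proof (intro mult_left_mono)
    show "(\<Prod>q\<in>g ` {..<N}. h q) \<le> (\<Prod>q\<in>X. h q)"
    proof (rule prod_mono2)
      show "finite X" unfolding X_def by simp
      show "g ` {..<N} \<subseteq> X" using g(1) by auto
    qed (rule h1 order_trans[OF zero_le_one h1])+
  qed (auto intro!: prod_nonneg simp: f_def)
  also have "(\<Prod>i<N. f i) = (\<Prod>k<K. int ((n * R) choose k)) ^ L"
    unfolding N_def f_def by (rule prod_div[OF L])
  also have "(\<Prod>q\<in>X. h q) = (\<Prod>r<R. \<Prod>s<S. a ^ (w * centered_dist (R div 2) r) * int H ^ (w * centered_dist (S div 2) s))"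
    unfolding X_def h_def by (simp only: prod.cartesian_product)
  also have "\<dots> = a ^ (w * (S * (\<Sum>r<R. centered_dist (R div 2) r))) * int H ^ (w * (R * (\<Sum>s<S. centered_dist (S div 2) s)))"
    by (simp add: prod.distrib power_sum[symmetric] power_mult[symmetric] sum_distrib_left[symmetric] sum_distrib_right[symmetric] prod_power_distrib[symmetric] mult_ac)
  finally have "int p ^ (E * V) \<le> fact N * ((\<Prod>k<K. int ((n * R) choose k)) ^ L *
    (a ^ (w * (S * (\<Sum>r<R. centered_dist (R div 2) r))) * int H ^ (w * (R * (\<Sum>s<S. centered_dist (S div 2) s)))))"
    using lower by linarith
  also have "a = int (nat a)" using ab by simp
  finally have "int (p ^ (E * V)) \<le> int (fact N * (\<Prod>k<K. (n * R) choose k) ^ L *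
    nat a ^ (w * (S * (\<Sum>r<R. centered_dist (R div 2) r))) *
    H ^ (w * (R * (\<Sum>s<S. centered_dist (S div 2) s))))"
    by (simp add: mult.assoc)
  thus ?thesis unfolding N_def w_def by (simp only: of_nat_le_iff)
qed


section \<open>Recursive functions\<close>

lemma recursive_fn_comp1:
  assumes "recursive_fn 1 f" "recursive_fn k g"
  shows "recursive_fn k (\<lambda>xs. f [g xs])"
  using recursive_fn.comp[of "[g]" f k] assms by simp

lemma recursive_fn_comp2:
  assumes "recursive_fn 2 f" "recursive_fn k g" "recursive_fn k h"
  shows "recursive_fn k (\<lambda>xs. f [g xs, h xs])"
  using recursive_fn.comp[of "[g, h]" f k] assms by (auto simp: numeral_2_eq_2)

lemma recursive_fn_Suc: "recursive_fn k g \<Longrightarrow> recursive_fn k (\<lambda>xs. Suc (g xs))"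
  using recursive_fn_comp1[OF recursive_fn.succ] by simp

lemma recursive_fn_const: "recursive_fn k (\<lambda>xs. c)"
  by (induction c) (auto intro: recursive_fn.zero recursive_fn_Suc)

text \<open>Primitive recursion on the second argument of F with the first as parameter. The step
  function receives counter, previous value and parameter in this order, which fixes the projections
  in the applications.\<close>

lemma recursive_fn_rec2:
  assumes f: "recursive_fn 1 f" and g: "recursive_fn 3 g"
    and h: "recursive_fn k h1" "recursive_fn k h2"
    and eq: "\<And>m r y. F y 0 = f [y]" "\<And>m y. F y (Suc m) = g [m, F y m, y]"
  shows "recursive_fn k (\<lambda>xs. F (h2 xs) (h1 xs))"
proof -
  have F: "rec_nat (f [y]) (\<lambda>m r. g [m, r, y]) x = F y x" for x y
    by (induction x) (auto simp: eq)
  have "recursive_fn (Suc 1) (\<lambda>xs. rec_nat (f (tl xs)) (\<lambda>m r. g (m # r # tl xs)) (hd xs))"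
    using f g by (intro recursive_fn.primitive_rec) (auto simp: numeral_3_eq_3)
  hence "recursive_fn 2 (\<lambda>xs. rec_nat (f (tl xs)) (\<lambda>m r. g (m # r # tl xs)) (hd xs))"
    by (simp add: numeral_2_eq_2)
  from recursive_fn_comp2[OF this h] show ?thesis by (simp add: F)
qed

lemma recursive_fn_add:
  assumes "recursive_fn k f" "recursive_fn k g"
  shows "recursive_fn k (\<lambda>xs. f xs + g xs)"
proof (rule recursive_fn_rec2[where F = "\<lambda>y x. x + y" and f = "\<lambda>xs. xs ! 0" and g = "\<lambda>xs. Suc (xs ! 1)"])
qed (use assms in \<open>auto intro!: recursive_fn.proj recursive_fn_Suc\<close>)

lemma recursive_fn_mult:
  assumes "recursive_fn k f" "recursive_fn k g"
  shows "recursive_fn k (\<lambda>xs. f xs * g xs)"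
proof (rule recursive_fn_rec2[where F = "\<lambda>y x. x * y" and f = "\<lambda>xs. 0" and g = "\<lambda>xs. xs ! 1 + xs ! 2"])
qed (use assms in \<open>auto intro!: recursive_fn.proj recursive_fn.zero recursive_fn_add\<close>)

lemma recursive_fn_power:
  assumes "recursive_fn k f" "recursive_fn k g"
  shows "recursive_fn k (\<lambda>xs. f xs ^ g xs)"
proof (rule recursive_fn_rec2[where F = "\<lambda>y x. y ^ x" and f = "\<lambda>xs. 1" and g = "\<lambda>xs. xs ! 1 * xs ! 2"])
qed (use assms in \<open>auto intro!: recursive_fn.proj recursive_fn_const recursive_fn_mult\<close>)

lemma recursive_fn_pred:
  assumes "recursive_fn k f"
  shows "recursive_fn k (\<lambda>xs. f xs - Suc 0)"
proof (rule recursive_fn_rec2[where F = "\<lambda>y x. x - Suc 0" and f = "\<lambda>xs. 0" and g = "\<lambda>xs. xs ! 0"])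
qed (use assms in \<open>auto intro!: recursive_fn.proj recursive_fn.zero\<close>)

lemma recursive_fn_diff:
  assumes "recursive_fn k f" "recursive_fn k g"
  shows "recursive_fn k (\<lambda>xs. f xs - g xs)"
proof (rule recursive_fn_rec2[where F = "\<lambda>y x. y - x" and f = "\<lambda>xs. xs ! 0" and g = "\<lambda>xs. xs ! 1 - Suc 0"])
qed (use assms in \<open>auto intro!: recursive_fn.proj recursive_fn_pred\<close>)

text \<open>Division by minimization: the least j with m + 1 \<le> (j + 1) T also satisfies j T
  \<le> m + 1, so 1 / T lies between j / (m + 1) and (j + 1) / (m + 1).\<close>

lemma computable_real_fn_inverse:
  assumes T: "recursive_fn k T" and pos: "\<And>xs. T xs > 0"
  shows "computable_real_fn k (\<lambda>xs. 1 / real (T xs))"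
proof -
  define F where "F ys = Suc (ys ! 1) - Suc (ys ! 0) * T (map (\<lambda>i. ys ! (i + 2)) [0..<k])" for ys
  have "recursive_fn (Suc (Suc k)) (\<lambda>ys. T (map (\<lambda>g. g ys) (map (\<lambda>i ys. ys ! (i + 2)) [0..<k])))"
    using T by (intro recursive_fn.comp) (auto intro: recursive_fn.proj)
  hence "recursive_fn (Suc (Suc k)) (\<lambda>ys. T (map (\<lambda>i. ys ! (i + 2)) [0..<k]))" by (simp add: o_def)
  hence F: "recursive_fn (Suc (Suc k)) F"
    unfolding F_def[abs_def]
    by (intro recursive_fn_diff recursive_fn_Suc recursive_fn_mult recursive_fn.proj) auto
  have ex: "\<exists>j. F (j # ys) = 0" for ys
  proof -
    define t where "t = T (map (\<lambda>i. ys ! Suc i) [0..<k])"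
    have "Suc (ys ! 0) * 1 \<le> Suc (Suc (ys ! 0)) * t"
      using pos[of "map (\<lambda>i. ys ! Suc i) [0..<k]"] unfolding t_def by (intro mult_le_mono) auto
    thus ?thesis unfolding F_def t_def by (intro exI[of _ "Suc (ys ! 0)"]) simp
  qed
  define f where "f ys = (LEAST j. F (j # ys) = 0)" for ys
  have f: "recursive_fn (Suc k) f"
    unfolding f_def[abs_def] using F ex by (intro recursive_fn.minimization) auto
  have "\<bar>1 / real (T xs) - real (f (m # xs)) / real (Suc m)\<bar> \<le> 1 / real (Suc m)"
    if len: "length xs = k" for xs m
  proof -
    have xs: "map ((!) xs) [0..<k] = xs" using len by (metis map_nth)
    define t where "t = T xs"
    have Fj: "F (j # m # xs) = 0 \<longleftrightarrow> Suc m \<le> Suc j * t" for j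
      unfolding F_def t_def by (simp add: xs)
    define j where "j = f (m # xs)"
    have "F (j # m # xs) = 0" unfolding j_def f_def using LeastI_ex[OF ex[of "m # xs"]] .
    hence up: "Suc m \<le> Suc j * t" using Fj by simp
    have low: "j * t \<le> Suc m"
    proof (cases j)
      case (Suc i)
      have "F (i # m # xs) \<noteq> 0" using not_less_Least[of i "\<lambda>j. F (j # m # xs) = 0"] Suc
        unfolding j_def f_def by simp
      thus ?thesis using Fj[of i] Suc by simp
    qed simp
    have t: "real t > 0" using pos[of xs] unfolding t_def by simp
    define M where "M = real (Suc m)"
    have m: "M > 0" unfolding M_def by simp
    have "M \<le> real (Suc j * t)" "real (j * t) \<le> M" using up low unfolding M_def by (simp_all only: of_nat_le_iff)
    hence "M \<le> (real j + 1) * real t" "real j * real t \<le> M" by (simp_all add: distrib_right)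
    hence "1 / real t \<le> (real j + 1) / M" "real j / M \<le> 1 / real t"
      using t m by (simp_all add: field_simps)
    thus ?thesis unfolding j_def[symmetric] t_def[symmetric] M_def[symmetric]
      by (simp add: add_divide_distrib abs_le_iff)
  qed
  thus ?thesis unfolding computable_real_fn_def using f by blast
qed


section \<open>Choice of parameters\<close>

text \<open>A single term of (1 + t)^Z is at most the whole power, which is at most exp (t Z). The
  parameter t stays free for optimisation.\<close>

lemma ln_binomial_le:
  assumes "t > 0" "k \<le> Z"
  shows "ln (real (Z choose k)) \<le> t * real Z - real k * ln t"
proof -
  have "real (Z choose k) * t ^ k * 1 ^ (Z - k) \<le> (\<Sum>j\<le>Z. real (Z choose j) * t ^ j * 1 ^ (Z - j))"
    using assms by (intro member_le_sum) auto
  also have "\<dots> = (t + 1) ^ Z" by (rule binomial_ring[symmetric])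
  also have "\<dots> \<le> exp t ^ Z"
    using assms exp_ge_add_one_self[of t] by (intro power_mono) (auto simp: add.commute)
  also have "\<dots> = exp (t * real Z)" by (simp add: exp_of_nat_mult[symmetric] mult.commute)
  finally have le: "real (Z choose k) * t ^ k \<le> exp (t * real Z)" by simp
  have pos: "real (Z choose k) > 0" using assms by simp
  from le have "ln (real (Z choose k) * t ^ k) \<le> t * real Z"
    using pos assms by (subst (asm) ln_le_cancel_iff[symmetric]) auto
  thus ?thesis using pos assms by (simp add: ln_mult ln_realpow)
qed

lemma sum_ln_binomial_le:
  assumes "K > 0" "K \<le> Z"
  shows "(\<Sum>k<K. ln (real (Z choose k))) \<le> real K ^ 2 / 2 * (1 + ln (2 * real Z / real K))"
proof -
  \<comment> \<open>One t serves all k. This value minimises the sum of t Z - k log t over k when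
    the sum of the k is replaced by K^2 / 2.\<close>
  define t where "t = real K / (2 * real Z)"
  have t: "t > 0" unfolding t_def using assms by simp
  have tZ: "t * real Z = real K / 2" unfolding t_def using assms by simp
  define q where "q = ln (2 * real Z / real K)"
  have q: "- ln t = q" unfolding t_def q_def using assms by (simp add: ln_div)
  have q0: "q \<ge> 0" unfolding q_def using assms by (intro ln_ge_zero) (auto simp: field_simps)
  have "(\<Sum>k<K. ln (real (Z choose k))) \<le> (\<Sum>k<K. real K / 2 + real k * q)"
  proof (rule sum_mono)
    fix k assume "k \<in> {..<K}"
    hence "ln (real (Z choose k)) \<le> t * real Z - real k * ln t"
      using assms by (intro ln_binomial_le[OF t]) simp
    also have "\<dots> = real K / 2 + real k * q" unfolding tZ q[symmetric] by simp
    finally show "ln (real (Z choose k)) \<le> real K / 2 + real k * q" .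
  qed
  also have "\<dots> = real K ^ 2 / 2 + (\<Sum>k<K. real k) * q"
    by (simp add: sum.distrib sum_distrib_right power2_eq_square)
  also have "(\<Sum>k<K. real k) \<le> real K ^ 2 / 2"
  proof -
    have "2 * (\<Sum>k<K. real k) + real K = real K ^ 2"
      by (induction K) (auto simp: power2_eq_square algebra_simps)
    thus ?thesis by simp
  qed
  hence "real K ^ 2 / 2 + (\<Sum>k<K. real k) * q \<le> real K ^ 2 / 2 + real K ^ 2 / 2 * q"
    using q0 by (intro add_left_mono mult_right_mono)
  finally show ?thesis unfolding q_def by (simp add: algebra_simps)
qed

lemma ln_4_ge_1: "ln (4 :: real) \<ge> 1"
proof -
  have "exp 1 \<le> (4 :: real)" using exp_le by linarith
  thus ?thesis by (simp add: ln_ge_iff)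
qed

text \<open>(1 - 1/128)^128 \<le> exp (-1) suffices. The precision is needed because e * 5/2 * 41/40
  has to stay below 7, which would fail with 2.74 in place of e.\<close>

lemma exp_1_le: "exp 1 \<le> (273 / 100 :: real)"
proof -
  have "(127 / 128 :: real) ^ 128 \<le> exp (- 1 / 128) ^ 128"
    using exp_ge_add_one_self[of "- 1 / 128 :: real"] by (intro power_mono) auto
  also have "\<dots> = exp (- 1)" by (simp add: exp_of_nat_mult[symmetric])
  finally have "(127 / 128 :: real) ^ 128 * exp 1 \<le> exp (- 1) * exp 1" by (intro mult_right_mono) auto
  also have "exp (- 1) * exp 1 = (1 :: real)" by (simp add: exp_add[symmetric])
  finally have up: "(127 / 128 :: real) ^ 128 * exp 1 \<le> 1" .
  have "(100 / 273 :: real) \<le> (127 / 128) ^ 128"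
  proof -
    have "100 / 273 \<le> u / v" if "100 * v \<le> 273 * u" "v > 0" for u v :: real
      using that by (simp add: field_simps)
    moreover have "(100 :: nat) * 128 ^ 128 \<le> 273 * 127 ^ 128" by simp
    hence "real (100 * 128 ^ 128) \<le> real (273 * 127 ^ 128)" by (simp only: of_nat_le_iff)
    hence "(100 :: real) * 128 ^ 128 \<le> 273 * 127 ^ 128"
      by (simp only: of_nat_mult of_nat_power of_nat_numeral)
    ultimately show ?thesis unfolding power_divide by (meson zero_less_numeral zero_less_power)
  qed
  hence "(100 / 273 :: real) * exp 1 \<le> (127 / 128) ^ 128 * exp 1" by (intro mult_right_mono) auto
  from order_trans[OF this up] show ?thesis by simp
qed

text \<open>For large M the left side is about 0.6 M and the right side about M; M \<ge> 4 pays for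
  the lower order terms. The left side is the combined cost of the powers of a and of H, while M and
  1/4 on the right are the shares of the binomials and of the factorial.\<close>

lemma parameter_inequality:
  fixes M w :: real
  assumes "M \<ge> 4" "2 * M \<le> w" "w \<le> 2 * M + 1"
  shows "w * (w + 1) * ((41 / 40) ^ 2 + 41 / 40) / (14 * M) < w - M - 1 / 4"
proof -
  define d where "d = w - 2 * M"
  have w: "w = 2 * M + d" and d: "0 \<le> d" "d \<le> 1" unfolding d_def using assms by auto
  have "M * M \<ge> 4 * M" using assms by (intro mult_right_mono) auto
  moreover have "M * d \<ge> 0" using assms d by simp
  moreover have "d * d \<le> d" using d mult_right_mono[of d 1 d] by simp
  \<comment> \<open>The products M * M, M * d and d * d become unknowns m, k and e, which makes the
    claim linear. The fraction 3321 / 1600 is (41/40)^2 + 41/40.\<close>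
  moreover have "3321 * (4 * m + 4 * k + e + 2 * M + d) < 1600 * (14 * m + 14 * k) - 5600 * M"
    if "m \<ge> 4 * M" "k \<ge> 0" "e \<le> d" for m k e :: real
    using that assms(1) d by argo
  ultimately have "3321 * (4 * (M * M) + 4 * (M * d) + d * d + 2 * M + d) <
      1600 * (14 * (M * M) + 14 * (M * d)) - 5600 * M" by blast
  moreover have "1600 * (w * (w + 1) * ((41 / 40) ^ 2 + 41 / 40)) =
    3321 * (4 * (M * M) + 4 * (M * d) + d * d + 2 * M + d)"
    unfolding w by (simp add: algebra_simps power2_eq_square)
  moreover have "1600 * ((w - M - 1 / 4) * (14 * M)) = 1600 * (14 * (M * M) + 14 * (M * d)) - 5600 * M"
    unfolding w by (simp add: algebra_simps)
  ultimately have "1600 * (w * (w + 1) * ((41 / 40) ^ 2 + 41 / 40)) < 1600 * ((w - M - 1 / 4) * (14 * M))"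
    by (simp only:)
  hence "w * (w + 1) * ((41 / 40) ^ 2 + 41 / 40) < (w - M - 1 / 4) * (14 * M)"
    by (rule mult_left_less_imp_less) simp
  thus ?thesis using assms by (simp add: divide_less_eq)
qed

text \<open>After division by \<open>N K \<kappa> / 2\<close> the claim becomes
  \<open>1 / 4 + M + w L (\<theta> ^ 2 + \<theta>) / (14 M) < w\<close>, where \<open>\<theta> = 41 / 40\<close> absorbs the
  difference between \<open>R\<close> and \<open>L T\<close>.\<close>

lemma logarithmic_contradiction:
  fixes \<kappa> \<eta> M la lH :: real and n w L S T R K N V D1 D2 :: nat
  assumes \<kappa>: "\<kappa> \<ge> 1" and \<eta>: "0 < \<eta>" "\<eta> < 1" and la: "\<kappa> = \<eta> * la"
    and M: "M \<ge> 4" and nM: "ln (2 * real n) \<le> M * \<kappa>"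
    and w: "2 * M \<le> real w" "real w \<le> 2 * M + 1" and L: "L = Suc w"
    and S: "7 * M / \<eta> \<le> real S" "S \<le> n" and T: "T \<ge> 40" "7 * M * lH \<le> \<kappa> * real L * real T" and lH: "lH \<ge> 0"
    and R: "R = L * T + L - 1" and K: "K = S * T" and N: "N = K * L" and V: "2 * V = N * (K * w)"
    and D: "4 * D1 \<le> R\<^sup>2" "4 * D2 \<le> S\<^sup>2"
  shows "ln (fact N) + real L * (\<Sum>k<K. ln (real ((n * R) choose k))) + real (w * (S * D1)) * la + real (w * (R * D2)) * lH
    < \<kappa> * real V"
proof -
  \<comment> \<open>R is less than L (T + 1), and T \<ge> 40 bounds (T + 1) / T by 41/40.\<close>
  define \<theta> :: real where "\<theta> = 41 / 40"
  have S7: "7 * M \<le> real S"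
  proof -
    have "7 * M \<le> 7 * M / \<eta>" using \<eta> M by (simp add: field_simps)
    thus ?thesis using S by linarith
  qed
  have S28: "S \<ge> 28" using S7 M by linarith
  have Lr: "real L = real w + 1" using L by simp
  have L25: "real L \<le> 5 / 2 * M" using Lr w M by linarith
  have L8: "real L \<ge> 9" using Lr w M by linarith
  have Lpos: "L > 0" using L by simp
  have RL: "real R = real L * real T + real L - 1"
  proof -
    have "R + 1 = L * T + L" using R Lpos by linarith
    hence "real (R + 1) = real (L * T + L)" by (simp only:)
    thus ?thesis by simp
  qed
  have R\<theta>: "real R \<le> real L * real T * \<theta>"
  proof -
    have "real L * 40 \<le> real L * real T" using T by (intro mult_left_mono) auto
    thus ?thesis unfolding RL \<theta>_def by simp
  qed
  have Kr: "real K = real S * real T" using K by simp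
  have Kbig: "real K \<ge> 1120"
  proof -
    have "28 * 40 \<le> real S * real T" using S28 T by (intro mult_mono) auto
    thus ?thesis unfolding Kr by simp
  qed
  have Nr: "real N = real K * real L" using N by simp
  have Npos: "real N > 0" using Nr Kbig L8 by simp

  have n0: "n > 0" using S(2) S28 by linarith
  have KZ: "K \<le> n * R"
  proof -
    have "T \<le> L * T" using Lpos by simp
    hence "T \<le> R" unfolding R using Lpos by linarith
    thus ?thesis unfolding K using S(2) by (intro mult_le_mono)
  qed
  \<comment> \<open>Here the factor 7 in the lower bound for S is used up almost completely: 2.73 *
    5/2 * 41/40 is about 6.996.\<close>
  have e: "exp 1 * (real L * \<theta>) \<le> real S"
  proof -
    have "exp 1 * (real L * \<theta>) \<le> 273 / 100 * (5 / 2 * M * \<theta>)"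
      using exp_1_le L25 M unfolding \<theta>_def by (intro mult_mono) auto
    also have "\<dots> \<le> 7 * M" unfolding \<theta>_def using M by simp
    finally show ?thesis using S7 by linarith
  qed
  \<comment> \<open>The previous bound gives e R \<le> S T = K, so e * 2 n R / K is at most 2 n.
    This is why log (2 n) governs the cost of the binomials.\<close>
  have lnZ: "1 + ln (2 * real (n * R) / real K) \<le> M * \<kappa>"
  proof -
    have "real L * real T \<ge> 0" by simp
    hence Rpos: "real R > 0" using RL L8 by linarith
    have "2 * real (n * R) / real K > 0" using Rpos n0 Kbig by simp
    hence "1 + ln (2 * real (n * R) / real K) = ln (exp 1 * (2 * real (n * R) / real K))"
      using Rpos n0 Kbig by (subst ln_mult) auto
    also have "\<dots> \<le> ln (2 * real n)"
    proof -
      have "exp 1 * real R \<le> exp 1 * (real L * real T * \<theta>)" using R\<theta> by simp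
      also have "\<dots> = exp 1 * (real L * \<theta>) * real T" by simp
      also have "\<dots> \<le> real K" unfolding Kr using e by (intro mult_right_mono) auto
      finally have "exp 1 * real R * (2 * real n) \<le> real K * (2 * real n)" by (intro mult_right_mono) auto
      hence "exp 1 * (2 * real (n * R) / real K) \<le> 2 * real n" using Kbig
        by (simp add: field_simps)
      thus ?thesis using Rpos n0 Kbig by (subst ln_le_cancel_iff) auto
    qed
    finally show ?thesis using nM by linarith
  qed
  define Q where "Q = real N * real K * \<kappa> / 2"
  have Qpos: "Q > 0" unfolding Q_def using Npos Kbig \<kappa> by simp

  have t1: "ln (fact N) \<le> Q * (1 / 4)"
  proof -
    have N1: "N \<ge> 1" using Npos by linarith
    have "(fact N :: real) \<le> real (N ^ N)" by (rule fact_le_power)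
    hence "ln (fact N) \<le> ln (real N ^ N)" using Npos by (subst ln_le_cancel_iff) auto
    also have "\<dots> = real N * ln (real N)" using Npos by (simp add: ln_realpow)
    also have "ln (real N) \<le> real K / 8"
    proof -
      have "real L \<le> real K"
      proof -
        have "real L \<le> real S" using L25 S7 M by linarith
        also have "real S * 1 \<le> real S * real T" using T by (intro mult_left_mono) auto
        finally show ?thesis unfolding Kr by simp
      qed
      hence "real N \<le> real K * real K" unfolding Nr by (intro mult_left_mono) auto
      hence "ln (real N) \<le> ln (real K * real K)" using Npos Kbig by (subst ln_le_cancel_iff) auto
      also have "\<dots> = 2 * ln (real K)" using Kbig by (simp add: ln_mult)
      \<comment> \<open>Comparing K with 32 makes log x \<le> x - 1 efficient: log N \<le> K / 16 +
        8, which is below K / 8 for K \<ge> 1120.\<close>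
      also have "ln (real K) = ln (real K / 32 * 32)" by simp
      also have "\<dots> = ln (real K / 32) + ln 32" using Kbig by (subst ln_mult) auto
      finally have "ln (real N) \<le> 2 * (ln (real K / 32) + ln 32)" .
      moreover have "ln (real K / 32) \<le> real K / 32 - 1" using Kbig by (intro ln_le_minus_one) simp
      moreover have "ln (32 :: real) \<le> 5"
        using ln_realpow[of "2 :: real" 5] ln_le_minus_one[of "2 :: real"] by simp
      ultimately show ?thesis using Kbig by argo
    qed
    hence "real N * ln (real N) \<le> real N * (real K / 8)" by (intro mult_left_mono) auto
    also have "\<dots> \<le> real N * (real K / 8) * \<kappa>"
      using mult_left_mono[OF \<kappa>, of "real N * (real K / 8)"] by simp
    finally show ?thesis unfolding Q_def by simp
  qed

  have t2: "real L * (\<Sum>k<K. ln (real ((n * R) choose k))) \<le> Q * M"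
  proof -
    have "(\<Sum>k<K. ln (real ((n * R) choose k))) \<le> real K ^ 2 / 2 * (1 + ln (2 * real (n * R) / real K))"
      using Kbig KZ by (intro sum_ln_binomial_le) auto
    also have "\<dots> \<le> real K ^ 2 / 2 * (M * \<kappa>)" using lnZ by (intro mult_left_mono) auto
    finally have "real L * (\<Sum>k<K. ln (real ((n * R) choose k))) \<le> real L * (real K ^ 2 / 2 * (M * \<kappa>))"
      by (intro mult_left_mono) auto
    thus ?thesis unfolding Q_def Nr by (simp add: power2_eq_square mult_ac)
  qed

  \<comment> \<open>The factor 1 / \<eta> in log a = \<kappa> / \<eta> is absorbed by the size of S,
    since T / \<eta> \<le> K / (7 M).\<close>
  have t3: "real (w * (S * D1)) * la \<le> Q * (real w * real L * \<theta>\<^sup>2 / (14 * M))"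
  proof -
    have la_eq: "la = \<kappa> / \<eta>" using la \<eta> by simp
    have la0: "la \<ge> 0" unfolding la_eq using \<kappa> \<eta> by simp
    have "real (4 * D1) \<le> real (R\<^sup>2)" using D(1) by (simp only: of_nat_le_iff)
    hence "4 * real D1 \<le> real R ^ 2" by simp
    also have "\<dots> \<le> (real L * real T * \<theta>) ^ 2" using R\<theta> by (intro power_mono) auto
    finally have D1: "real D1 \<le> (real L * real T * \<theta>) ^ 2 / 4" by simp
    have "real (w * (S * D1)) * la = real w * (real S * real D1) * la" by simp
    also have "\<dots> \<le> real w * (real S * ((real L * real T * \<theta>) ^ 2 / 4)) * la"
      by (intro mult_right_mono mult_left_mono D1 la0) auto
    also have "\<dots> = real w * real N * real L * \<theta>\<^sup>2 * \<kappa> / 4 * (real T / \<eta>)"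
      unfolding la_eq Nr Kr by (simp add: power2_eq_square mult_ac)
    also have "\<dots> \<le> real w * real N * real L * \<theta>\<^sup>2 * \<kappa> / 4 * (real K / (7 * M))"
    proof (intro mult_left_mono)
      have "7 * M / \<eta> * real T \<le> real S * real T" using S(1) by (intro mult_right_mono) auto
      thus "real T / \<eta> \<le> real K / (7 * M)" unfolding Kr using M \<eta> by (simp add: field_simps)
    qed (use \<kappa> in auto)
    also have "\<dots> = Q * (real w * real L * \<theta>\<^sup>2 / (14 * M))"
      unfolding Q_def using M by (simp add: field_simps)
    finally show ?thesis .
  qed

  \<comment> \<open>The lower bound on T says that log H is at most \<kappa> L T / (7 M), which
    makes this cost equal to that of the powers of a up to one factor \<theta>.\<close>
  have t4: "real (w * (R * D2)) * lH \<le> Q * (real w * real L * \<theta> / (14 * M))"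
  proof -
    have "real (4 * D2) \<le> real (S\<^sup>2)" using D(2) by (simp only: of_nat_le_iff)
    hence D2: "real D2 \<le> real S ^ 2 / 4" by simp
    have lH': "lH \<le> \<kappa> * real L * real T / (7 * M)" using T(2) M by (simp add: field_simps)
    have "real (w * (R * D2)) * lH = real w * (real R * real D2) * lH" by simp
    also have "\<dots> \<le> real w * ((real L * real T * \<theta>) * (real S ^ 2 / 4)) * (\<kappa> * real L * real T / (7 * M))"
      using R\<theta> D2 lH lH' by (intro mult_mono) (auto simp: \<theta>_def)
    also have "\<dots> = Q * (real w * real L * \<theta> / (14 * M))"
      unfolding Q_def Nr Kr using M by (simp add: field_simps power2_eq_square)
    finally show ?thesis .
  qed

  have "real (2 * V) = real (N * (K * w))" using V by simp
  hence rhs: "\<kappa> * real V = Q * real w" unfolding Q_def by (simp add: mult_ac)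
  have "real w * real L * \<theta>\<^sup>2 / (14 * M) + real w * real L * \<theta> / (14 * M)
    = real w * (real w + 1) * (\<theta>\<^sup>2 + \<theta>) / (14 * M)"
    unfolding Lr by (simp add: add_divide_distrib[symmetric] distrib_left)
  also have "\<dots> < real w - M - 1 / 4"
    using parameter_inequality[OF M w] unfolding \<theta>_def .
  finally have "Q * (real w * real L * \<theta>\<^sup>2 / (14 * M) + real w * real L * \<theta> / (14 * M)) < Q * (real w - M - 1 / 4)"
    using Qpos by (intro mult_strict_left_mono)
  thus ?thesis using t1 t2 t3 t4 unfolding rhs by (simp add: algebra_simps)
qed

section \<open>From the determinant to rational approximations of the root\<close>

text \<open>Taking logarithms in the determinant bound shows that the gain
  \<open>\<kappa> * real V\<close> is at most the sum of the four costs, contrary to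
  \<open>logarithmic_contradiction\<close>.\<close>

lemma no_good_approximation:
  fixes a b x y :: int and p E n H w L S T :: nat and \<eta> M \<kappa> :: real
  assumes p: "prime p" and ab: "1 \<le> b" "b < a" "\<not> int p dvd a" "\<not> int p dvd b"
    and xy: "\<not> int p dvd x" "\<not> int p dvd y" "int p ^ E dvd x - y"
    and H: "\<bar>x\<bar> \<le> int H" "\<bar>y\<bar> \<le> int H"
    and \<kappa>: "\<kappa> = real E * ln (real p)" "\<kappa> \<ge> 1" and \<eta>: "0 < \<eta>" "\<eta> < 1" "\<kappa> = \<eta> * ln (real_of_int a)"
    and M: "M \<ge> 4" "ln (2 * real n) \<le> M * \<kappa>"
    and w: "2 * M \<le> real w" "real w \<le> 2 * M + 1" and L: "L = Suc w"
    and S: "7 * M / \<eta> \<le> real S" "S \<le> n"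
    and T: "T \<ge> 40" "7 * M * ln (real H) \<le> \<kappa> * real L * real T"
  shows "\<not> padic_dvd p (E * (S * T * L)) (of_int a / of_int b - (of_int x / of_int y) ^ n)"
proof
  \<comment> \<open>With the R chosen next, R + 1 - L = L T, so the L T S points available to the
    zero estimate are exactly as many as the K L functions.\<close>
  assume approx: "padic_dvd p (E * (S * T * L)) (of_int a / of_int b - (of_int x / of_int y) ^ n)"
  define K R N where "K = S * T" and "R = L * T + L - 1" and "N = K * L"
  define V where "V = N * (K * w) div 2"
  define D1 where "D1 = (\<Sum>r<R. centered_dist (R div 2) r)"
  define D2 where "D2 = (\<Sum>s<S. centered_dist (S div 2) s)"
  have "N * (K * w) = K * K * (w * Suc w)" unfolding N_def L by (simp only: mult_ac)
  moreover have "even (K * K * (w * Suc w))" by simp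
  ultimately have "even (N * (K * w))" by (simp only:)
  hence V: "2 * V = N * (K * w)" unfolding V_def by simp
  have "x \<noteq> 0" using xy by auto
  hence H1: "H \<ge> 1" using H by linarith
  have main: "p ^ (E * V) \<le> fact N * (\<Prod>k<K. (n * R) choose k) ^ L *
    nat a ^ (w * (S * D1)) * H ^ (w * (R * D2))"
  proof -
    have "R + 1 - L = L * T" unfolding R_def using L by simp
    hence RS: "K * L \<le> (R + 1 - L) * S" unfolding K_def by simp
    have wL: "w = L - 1" and Lpos: "L > 0" using L by simp_all
    show ?thesis
      using interpolation_determinant_bound[OF p ab xy approx[folded K_def] Lpos S(2) RS
        V[unfolded N_def wL] H]
      unfolding N_def D1_def D2_def wL .
  qed
  have binpos: "(n * R) choose k > 0" if "k < K" for k
  proof -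
    have "T \<le> L * T" using L by simp
    hence "T \<le> R" unfolding R_def using L by linarith
    hence "K \<le> n * R" unfolding K_def using S(2) by (intro mult_le_mono)
    thus ?thesis using that by simp
  qed
  define P where "P = (\<Prod>k<K. real ((n * R) choose k))"
  have P0: "P > 0" unfolding P_def using binpos by (intro prod_pos) auto
  have a0: "real (nat a) = real_of_int a" "real_of_int a > 0" using ab by auto
  have p0: "real p > 0" using prime_gt_0_nat[OF p] by simp
  have "real (p ^ (E * V)) \<le> real (fact N * (\<Prod>k<K. (n * R) choose k) ^ L *
    nat a ^ (w * (S * D1)) * H ^ (w * (R * D2)))" using main by (simp only: of_nat_le_iff)
  hence "real p ^ (E * V) \<le> fact N * P ^ L *
    real_of_int a ^ (w * (S * D1)) * real H ^ (w * (R * D2))"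
    unfolding P_def by (simp only: of_nat_mult of_nat_power of_nat_prod of_nat_fact a0)
  hence "ln (real p ^ (E * V)) \<le> ln (fact N * P ^ L *
    real_of_int a ^ (w * (S * D1)) * real H ^ (w * (R * D2)))"
    using p0 P0 a0 H1 by (subst ln_le_cancel_iff) auto
  also have "\<dots> = ln (fact N) + real L * ln P +
    real (w * (S * D1)) * ln (real_of_int a) + real (w * (R * D2)) * ln (real H)"
    using P0 a0 H1 by (simp add: ln_mult ln_realpow)
  also have "ln P = (\<Sum>k<K. ln (real ((n * R) choose k)))"
    unfolding P_def using binpos by (intro ln_prod) (auto simp: not_less[symmetric])
  finally have "ln (real p ^ (E * V)) \<le> ln (fact N) + real L * (\<Sum>k<K. ln (real ((n * R) choose k))) +
    real (w * (S * D1)) * ln (real_of_int a) + real (w * (R * D2)) * ln (real H)" .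
  moreover have "ln (real p ^ (E * V)) = \<kappa> * real V" using p0 \<kappa> by (simp add: ln_realpow)
  ultimately have ge: "\<kappa> * real V \<le> ln (fact N) + real L * (\<Sum>k<K. ln (real ((n * R) choose k))) +
    real (w * (S * D1)) * ln (real_of_int a) + real (w * (R * D2)) * ln (real H)" by (simp only:)
  have "ln (fact N) + real L * (\<Sum>k<K. ln (real ((n * R) choose k))) + real (w * (S * D1)) * ln (real_of_int a)
    + real (w * (R * D2)) * ln (real H) < \<kappa> * real V"
  proof (rule logarithmic_contradiction[OF \<kappa>(2) \<eta> M w L S T _ R_def K_def N_def V])
    show "4 * D1 \<le> R\<^sup>2" "4 * D2 \<le> S\<^sup>2" unfolding D1_def D2_def by (rule sum_centered_dist_le)+
    show "ln (real H) \<ge> 0" using H1 by simp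
  qed
  thus False using ge by linarith
qed

lemma reduced_fraction:
  fixes r q :: int
  assumes "q \<ge> 1"
  shows "\<exists>x y. (of_int r / of_int q :: rat) = of_int x / of_int y \<and> coprime x y \<and> y \<ge> 1 \<and> \<bar>x\<bar> \<le> \<bar>r\<bar> \<and> y \<le> q"
proof -
  obtain x y where xy: "quotient_of (of_int r / of_int q) = (x, y)" by force
  obtain z where z: "r = x * z" "q = y * z" using quotient_of_int_div[OF xy] assms by auto
  have y: "y \<ge> 1" using quotient_of_denom_pos[OF xy] by simp
  have "0 < y * z" using z(2) assms by simp
  hence z1: "z \<ge> 1" using y by (simp add: zero_less_mult_iff)
  have "y * 1 \<le> y * z" using y z1 by (intro mult_left_mono) auto
  hence "y \<le> q" using z(2) by simp
  moreover have "\<bar>x\<bar> * 1 \<le> \<bar>x\<bar> * \<bar>z\<bar>" using z1 by (intro mult_left_mono) auto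
  hence "\<bar>x\<bar> \<le> \<bar>r\<bar>" unfolding z(1) abs_mult by simp
  ultimately show ?thesis using quotient_of_div[OF xy] quotient_of_coprime[OF xy] y by blast
qed

text \<open>A distance of at least 1 exceeds the bound since c > 1. For n < S Liouville's exponent n
  is at most 7 M S, and c > 2 a covers its constant. For n \<ge> S the determinant applies with T
  taken from log H, and the second bound on c covers the rounding of T.\<close>

lemma padic_root_approximation:
  fixes a b r q :: int and p n E :: nat and \<eta> M \<kappa> :: real
  assumes p: "prime p" and ab: "1 \<le> b" "b < a" "\<not> int p dvd a" "\<not> int p dvd b"
    and E: "int p ^ E dvd a - b" "E \<ge> 1" and n: "\<not> p dvd n"
    and \<kappa>: "\<kappa> = real E * ln (real p)" "\<kappa> \<ge> 1" and \<eta>: "0 < \<eta>" "\<eta> < 1" "\<kappa> = \<eta> * ln (real_of_int a)"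
    and M: "M \<ge> 4" "ln (2 * real n) \<le> M * \<kappa>"
    and w: "w = nat \<lceil>2 * M\<rceil>" and S: "S = nat \<lceil>7 * M / \<eta>\<rceil>"
    and q: "q \<ge> 1" and ne: "padic_nth_root p n a b \<noteq> padic_of_rat p (of_int r / of_int q)"
    and c: "c \<ge> (real_of_int a + 1) ^ 2" "c \<ge> exp (41 * \<kappa> * real S * real (Suc w))"
  shows "padic_dist p (padic_nth_root p n a b) (padic_of_rat p (of_int r / of_int q)) >
    1 / c * real_of_int (max \<bar>r\<bar> q) powr (- (7 * M * real S))"
proof -
  define \<delta> where "\<delta> = padic_dist p (padic_nth_root p n a b) (padic_of_rat p (of_int r / of_int q))"
  define G where "G = real_of_int (max \<bar>r\<bar> q)"
  have G1: "G \<ge> 1" unfolding G_def using q by simp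
  define \<mu> where "\<mu> = 7 * M * real S"
  have \<mu>0: "\<mu> \<ge> 0" unfolding \<mu>_def using M by simp
  have a2: "real_of_int a \<ge> 2" using ab by linarith
  have c4: "c > 2 * real_of_int a"
  proof -
    have "(real_of_int a + 1) ^ 2 = real_of_int a * real_of_int a + 2 * real_of_int a + 1"
      by (simp add: power2_eq_square algebra_simps)
    moreover have "real_of_int a * real_of_int a \<ge> 0" by (rule zero_le_square)
    ultimately show ?thesis using c(1) by linarith
  qed
  have c1: "c > 1" using c4 a2 by linarith
  obtain x y :: int where xy: "(of_int r / of_int q :: rat) = of_int x / of_int y" "coprime x y" "y \<ge> 1"
    "\<bar>x\<bar> \<le> \<bar>r\<bar>" "y \<le> q"
    using reduced_fraction[OF q] by blast
  define \<alpha> :: rat where "\<alpha> = of_int x / of_int y"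
  define H where "H = nat (max \<bar>x\<bar> y)"
  have H1: "H \<ge> 1" unfolding H_def using xy by simp
  have iH: "int H = max \<bar>x\<bar> y" unfolding H_def using xy by simp
  hence "int H \<le> max \<bar>r\<bar> q" using xy by linarith
  hence HG: "real H \<le> G" unfolding G_def by linarith
  have Hxy: "\<bar>x\<bar> \<le> int H" "\<bar>y\<bar> \<le> int H" using iH xy by linarith+
  \<comment> \<open>Reducing the fraction can only lower the height, so a bound in terms of H
    implies the one in terms of r and q.\<close>
  have GH: "G powr (- \<mu>) \<le> real H powr (- \<mu>)" using HG H1 \<mu>0 by (intro powr_mono2') auto
  have "int p dvd int p ^ E" using E(2) by (intro dvd_power) auto
  hence "int p dvd a - b" using E(1) dvd_trans by blast
  note root = padic_nth_root_dist[OF p ab(4) this n, of \<alpha>]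
  show ?thesis
  proof (cases "\<delta> < 1")
    case False
    have "1 / c * G powr (- \<mu>) \<le> 1 / c * G powr 0"
      using G1 \<mu>0 c1 by (intro mult_left_mono powr_mono) auto
    also have "\<dots> < 1" using G1 c1 by simp
    finally show ?thesis using False unfolding \<delta>_def[symmetric] G_def[symmetric] \<mu>_def[symmetric] by simp
  next
    case True
    hence less: "padic_dist p (padic_nth_root p n a b) (padic_of_rat p \<alpha>) < 1"
      unfolding \<delta>_def \<alpha>_def xy(1) .
    have \<alpha>1: "rat_padic_abs p (\<alpha> - 1) < 1" using root(1)[OF less] .
    have \<delta>: "\<delta> = rat_padic_abs p (\<alpha> ^ n - of_int a / of_int b)"
      using root(2)[OF less] unfolding \<delta>_def \<alpha>_def xy(1) .
    have \<alpha>n: "\<alpha> ^ n \<noteq> of_int a / of_int b" using root(3)[OF less] ne unfolding \<alpha>_def xy(1) by blast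
    have y0: "y \<noteq> 0" using xy by simp
    have "rat_padic_abs p \<alpha> = 1" using padic_abs_eq_of_diff_less[OF p, of \<alpha> 1] \<alpha>1 by (simp add: padic_abs_one[OF p])
    hence "rat_padic_abs p (of_int x) = rat_padic_abs p (of_int y)"
      using padic_abs_mult[OF p, of \<alpha> "of_int y"] y0 unfolding \<alpha>_def by simp
    moreover have "rat_padic_abs p (of_int z) < 1" if "int p dvd z" for z
    proof -
      have "rat_padic_abs p (of_int z) \<le> inverse (real p ^ 1)"
        using that by (intro padic_dvd_imp_padic_abs_le[OF p]) (simp only: padic_dvd_of_int_iff[OF p] power_one_right)
      also have "\<dots> < 1" using prime_gt_1_nat[OF p] by (simp add: field_simps)
      finally show ?thesis .
    qed
    \<comment> \<open>The absolute value of \<alpha> is 1, so p divides both x and y or neither;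
      coprimality leaves neither.\<close>
    ultimately have "int p dvd x \<longleftrightarrow> int p dvd y"
      using padic_abs_of_int_eq_1[OF p] by (metis less_irrefl)
    hence px: "\<not> int p dvd x" and py: "\<not> int p dvd y"
      using xy(2) p by (metis coprime_common_divisor not_prime_unit prime_nat_int_transfer)+
    show ?thesis
    proof (cases "S \<le> n")
      case False
      \<comment> \<open>Since b y^n is a p-adic unit, the nonzero integer d has p-adic absolute
        value \<delta>; its ordinary size is at most 2 a H^n.\<close>
      define d where "d = b * x ^ n - a * y ^ n"
      have d_eq: "rat_of_int d = (\<alpha> ^ n - of_int a / of_int b) * of_int (b * y ^ n)"
        unfolding \<alpha>_def d_def using y0 ab by (simp add: power_divide field_simps)
      have "rat_of_int d \<noteq> 0" unfolding d_eq using \<alpha>n y0 ab by simp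
      hence d0: "d \<noteq> 0" by auto
      have "prime (int p)" using p by simp
      hence u: "\<not> int p dvd b * y ^ n"
        using ab(4) py prime_dvd_power[of "int p" y n] by (auto simp: prime_dvd_mult_iff)
      have "rat_padic_abs p (of_int d) = \<delta>"
        unfolding d_eq padic_abs_mult[OF p] \<delta> padic_abs_of_int_eq_1[OF p u] by simp
      hence ge: "\<delta> \<ge> 1 / \<bar>real_of_int d\<bar>" using padic_abs_of_int_ge[OF p d0] by simp
      have nz: "\<bar>real_of_int d\<bar> > 0" using d0 by simp
      have "\<bar>d\<bar> \<le> \<bar>b\<bar> * \<bar>x\<bar> ^ n + \<bar>a\<bar> * \<bar>y\<bar> ^ n"
        unfolding d_def by (metis abs_mult abs_triangle_ineq4 power_abs)
      also have "\<dots> \<le> a * int H ^ n + a * int H ^ n"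
        using ab Hxy by (intro add_mono mult_mono power_mono) auto
      finally have "real_of_int \<bar>d\<bar> \<le> real_of_int (a * int H ^ n + a * int H ^ n)"
        by (simp only: of_int_le_iff)
      hence "\<bar>real_of_int d\<bar> \<le> 2 * real_of_int a * real H ^ n" by simp
      hence "1 / (2 * real_of_int a * real H ^ n) \<le> \<delta>"
        using order_trans[OF frac_le[of 1 1] ge] nz by simp
      moreover have "1 / c * real H powr (- \<mu>) < 1 / (2 * real_of_int a * real H ^ n)"
      proof -
        have "real n \<le> real S" using False by simp
        also have "real S * 1 \<le> real S * (7 * M)" using M by (intro mult_left_mono) auto
        finally have "real n \<le> \<mu>" unfolding \<mu>_def by (simp add: mult.commute)
        hence "real H powr (- \<mu>) \<le> real H powr (- real n)" using H1 by (intro powr_mono) auto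
        also have "\<dots> = 1 / real H ^ n" using H1 by (simp add: powr_minus powr_realpow divide_inverse)
        finally have "1 / c * real H powr (- \<mu>) \<le> 1 / c * (1 / real H ^ n)" using c1 by (intro mult_left_mono) auto
        also have "\<dots> < 1 / (2 * real_of_int a) * (1 / real H ^ n)"
          using c4 a2 H1 by (intro mult_strict_right_mono divide_strict_left_mono) auto
        finally show ?thesis by simp
      qed
      moreover have "1 / c * G powr (- \<mu>) \<le> 1 / c * real H powr (- \<mu>)"
        using GH c1 by (intro mult_left_mono) auto
      ultimately show ?thesis unfolding \<delta>_def[symmetric] G_def[symmetric] \<mu>_def[symmetric] by linarith
    next
      case True
      define L where "L = Suc w"
      \<comment> \<open>The ceiling makes \<kappa> L T at least 7 M log H, and the 40 keeps T \<ge>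
        40 even for H = 1. T exceeds the quotient by at most 41, independently of H.\<close>
      define T where "T = 40 + nat \<lceil>7 * M * ln (real H) / (\<kappa> * real L)\<rceil>"
      have \<kappa>L: "\<kappa> * real L > 0" using \<kappa> unfolding L_def by simp
      have quot0: "7 * M * ln (real H) / (\<kappa> * real L) \<ge> 0" using M H1 \<kappa>L by simp
      have Tle: "real T \<le> 41 + 7 * M * ln (real H) / (\<kappa> * real L)"
        unfolding T_def using quot0 by linarith
      have Tge: "7 * M * ln (real H) / (\<kappa> * real L) \<le> real T" unfolding T_def by linarith
      hence Tge': "7 * M * ln (real H) \<le> \<kappa> * real L * real T"
        using \<kappa>L by (simp add: pos_divide_le_eq mult.commute)
      have wr: "2 * M \<le> real w" "real w \<le> 2 * M + 1" unfolding w using M by linarith+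
      have Sr: "7 * M / \<eta> \<le> real S" unfolding S by linarith
      have S0: "S > 0" using Sr M \<eta> by (intro Nat.gr0I) (auto simp: field_simps)
      define N where "N = S * T * L"
      have "T > 0" unfolding T_def by simp
      hence "N > 0" unfolding N_def L_def using S0 by simp
      hence N1: "N \<ge> 1" by simp
      have "\<delta> > inverse (real p ^ (E * N))"
      proof (rule ccontr)
        assume "\<not> \<delta> > inverse (real p ^ (E * N))"
        hence small: "rat_padic_abs p (\<alpha> ^ n - of_int a / of_int b) \<le> inverse (real p ^ (E * N))"
          unfolding \<delta> by simp
        hence dN: "padic_dvd p (E * N) (of_int a / of_int b - \<alpha> ^ n)"
          using padic_abs_minus_commute[OF p] by (intro padic_abs_le_imp_padic_dvd[OF p]) metis
        \<comment> \<open>Modulo \<open>p ^ E\<close> both \<alpha>^n and 1 agree with a / b. By the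
          isometry of the power map \<alpha> itself is then 1 modulo \<open>p ^ E\<close>, which is
          the congruence of x and y that the determinant needs.\<close>
        have "padic_dvd p E (of_int (a - b) * (of_int 1 / of_int b))"
          using E(1) by (intro padic_dvd_mult_right[OF p _ padic_dvd_divide[OF p ab(4)]])
            (simp only: padic_dvd_of_int_iff[OF p])
        moreover have "of_int (a - b) * (of_int 1 / of_int b) = (of_int a / of_int b - 1 :: rat)"
          using ab by (simp add: field_simps)
        ultimately have "padic_dvd p E (of_int a / of_int b - 1)" by metis
        moreover have "padic_dvd p E (of_int a / of_int b - \<alpha> ^ n)"
          by (rule padic_dvd_mono[OF p dN]) (use N1 in simp)
        ultimately have "padic_dvd p E ((of_int a / of_int b - 1) - (of_int a / of_int b - \<alpha> ^ n))"
          by (rule padic_dvd_diff[OF p])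
        hence "rat_padic_abs p (\<alpha> ^ n - 1) \<le> inverse (real p ^ E)"
          by (intro padic_dvd_imp_padic_abs_le[OF p]) simp
        hence "rat_padic_abs p (\<alpha> - 1) \<le> inverse (real p ^ E)"
          using padic_abs_power_diff[OF p \<alpha>1 _ n, of 1] by (simp add: padic_abs_zero[OF p])
        hence "padic_dvd p E ((\<alpha> - 1) * of_int y)"
          by (intro padic_dvd_mult_right[OF p] padic_abs_le_imp_padic_dvd[OF p] padic_dvd_of_int[OF p])
        moreover have "(\<alpha> - 1) * of_int y = of_int (x - y)" unfolding \<alpha>_def using y0 by (simp add: field_simps)
        ultimately have "int p ^ E dvd x - y" by (simp only: padic_dvd_of_int_iff[OF p])
        from no_good_approximation[OF p ab px py this Hxy \<kappa> \<eta> M wr L_def Sr True _ Tge']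
        show False using dN unfolding N_def \<alpha>_def T_def by simp
      qed
      moreover have "1 / c * G powr (- \<mu>) \<le> inverse (real p ^ (E * N))"
      proof -
        have p0: "real p > 0" using prime_gt_0_nat[OF p] by simp
        \<comment> \<open>The bound for \<kappa> N splits into 41 \<kappa> S L, covered by c, and 7
          M S log H, which produces the exponent.\<close>
        define t where "t = 7 * M * ln (real H) / (\<kappa> * real L)"
        have t: "\<kappa> * real L * t = 7 * M * ln (real H)"
          unfolding t_def using \<kappa>L by (metis less_irrefl nonzero_mult_div_cancel_left times_divide_eq_right)
        have "\<kappa> * real N = \<kappa> * real L * real S * real T" unfolding N_def by simp
        also have "\<dots> \<le> \<kappa> * real L * real S * (41 + t)"
          using Tle \<kappa>L unfolding t_def by (intro mult_left_mono) auto
        also have "\<dots> = 41 * \<kappa> * real S * real L + real S * (\<kappa> * real L * t)" by (simp add: algebra_simps)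
        also have "\<dots> = 41 * \<kappa> * real S * real L + \<mu> * ln (real H)" unfolding t \<mu>_def by simp
        finally have le: "\<kappa> * real N \<le> 41 * \<kappa> * real S * real L + \<mu> * ln (real H)" .
        have "1 / c \<le> 1 / exp (41 * \<kappa> * real S * real L)"
          using c(2) unfolding L_def by (intro frac_le) auto
        hence "1 / c \<le> exp (- (41 * \<kappa> * real S * real L))" by (simp only: exp_minus inverse_eq_divide)
        hence "1 / c * G powr (- \<mu>) \<le> exp (- (41 * \<kappa> * real S * real L)) * real H powr (- \<mu>)"
          using GH c1 by (intro mult_mono) auto
        also have "\<dots> = exp (- (41 * \<kappa> * real S * real L + \<mu> * ln (real H)))"
          using H1 by (simp add: powr_def exp_add[symmetric] exp_diff[symmetric])
        also have "\<dots> \<le> exp (- (\<kappa> * real N))" using le by simp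
        also have "\<dots> = inverse (exp (ln (real p)) ^ (E * N))"
          unfolding \<kappa>(1) by (simp add: exp_minus exp_of_nat_mult[symmetric] mult_ac)
        also have "exp (ln (real p)) = real p" using p0 by simp
        finally show ?thesis .
      qed
      ultimately show ?thesis unfolding \<delta>_def[symmetric] G_def[symmetric] \<mu>_def[symmetric] by linarith
    qed
  qed
qed

text \<open>Entries 1 and 3 of the list are \<open>a\<close> and \<open>n\<close>; the exponent bounds \<open>41 S L\<close>.\<close>

definition denominator_fn :: "nat list \<Rightarrow> nat" where
  "denominator_fn xs = (xs ! 1 + 1) ^ (41 * (7 * (2 * xs ! 3 + 4) * xs ! 1 + 1) * (4 * xs ! 3 + 10))"

lemma recursive_denominator_fn: "recursive_fn 6 denominator_fn"
  unfolding denominator_fn_def[abs_def]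
  by (intro recursive_fn_power recursive_fn_mult recursive_fn_add recursive_fn.proj recursive_fn_const) auto

text \<open>One computable function has to serve all data at once, and \<eta> is a real number that
  is not among its inputs. So S and w must be bounded in terms of a and n before they enter the
  constant.\<close>

theorem theorem3p1:
  shows "\<exists>C. computable_real_fn 6 C \<and>
    (\<forall>(p::nat) (a::int) (b::int) (\<eta>::real) (n::nat).
       prime p \<longrightarrow> 1 \<le> b \<longrightarrow> b < a \<longrightarrow>
       int p dvd a - b \<longrightarrow> \<not> int p dvd a * b \<longrightarrow>
       0 < \<eta> \<longrightarrow> \<eta> < 1 \<longrightarrow>
       inverse (rat_padic_abs p (of_int (a - b))) = real_of_int a powr \<eta> \<longrightarrow>
       real_of_int a powr \<eta> \<ge> 4 \<longrightarrow>
       n \<ge> 3 \<longrightarrow> \<not> p dvd n \<longrightarrow>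
       mu_eff C [p, nat a, nat b, n] p (padic_nth_root p n a b)
         < ereal (53.8 / \<eta> * (max (ln (2 * real n) / (\<eta> * ln (real_of_int a))) 4)\<^sup>2))"
proof (intro exI[of _ "\<lambda>xs. 1 / real (denominator_fn xs)"] conjI allI impI)
  show "computable_real_fn 6 (\<lambda>xs. 1 / real (denominator_fn xs))"
    by (intro computable_real_fn_inverse recursive_denominator_fn) (simp add: denominator_fn_def)
  fix p n :: nat and a b :: int and \<eta> :: real
  assume p: "prime p" and ab: "1 \<le> b" "b < a" and dvd: "int p dvd a - b" and nab: "\<not> int p dvd a * b"
    and \<eta>: "0 < \<eta>" "\<eta> < 1" and abs: "inverse (rat_padic_abs p (of_int (a - b))) = real_of_int a powr \<eta>"
    and ge4: "real_of_int a powr \<eta> \<ge> 4" and n: "n \<ge> 3" "\<not> p dvd n"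
  \<comment> \<open>By the definition of \<eta>, \<open>p ^ E\<close> equals a^\<eta>, so \<eta> log
    a is also E log p; a^\<eta> \<ge> 4 > e makes it at least 1.\<close>
  define E where "E = multiplicity (int p) (a - b)"
  define \<kappa> where "\<kappa> = \<eta> * ln (real_of_int a)"
  define M where "M = max (ln (2 * real n) / \<kappa>) 4"
  define w where "w = nat \<lceil>2 * M\<rceil>"
  define S where "S = nat \<lceil>7 * M / \<eta>\<rceil>"
  have a2: "real_of_int a \<ge> 2" using ab by linarith
  have pE: "real p ^ E = real_of_int a powr \<eta>"
    using abs padic_abs_of_int[OF p, of "a - b"] ab unfolding E_def by simp
  have p0: "real p > 0" using prime_gt_0_nat[OF p] by simp
  have E1: "E \<ge> 1" using pE ge4 by (cases E) auto
  have pEdvd: "int p ^ E dvd a - b" unfolding E_def by (rule multiplicity_dvd)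
  have "real E * ln (real p) = ln (real p ^ E)" using p0 by (simp add: ln_realpow)
  also have "\<dots> = \<kappa>" unfolding pE \<kappa>_def using a2 by (simp add: ln_powr)
  finally have \<kappa>E: "\<kappa> = real E * ln (real p)" ..
  have "ln 4 \<le> ln (real_of_int a powr \<eta>)" using ge4 by (subst ln_le_cancel_iff) auto
  hence \<kappa>1: "\<kappa> \<ge> 1" using ln_4_ge_1 a2 unfolding \<kappa>_def by (simp add: ln_powr)
  have M4: "M \<ge> 4" unfolding M_def by simp
  have nM: "ln (2 * real n) \<le> M * \<kappa>"
  proof -
    have "ln (2 * real n) / \<kappa> \<le> M" unfolding M_def by simp
    thus ?thesis using \<kappa>1 by (simp add: divide_le_eq)
  qed
  have pab: "\<not> int p dvd a" "\<not> int p dvd b" using nab by auto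

  define c where "c u v = real (denominator_fn ([p, nat a, nat b, n] @ [u, v]))" for u v
  \<comment> \<open>Q bounds 41 S (w + 1) by means of M \<le> 2 n + 4 and 1 / \<eta> \<le> a. Since
    \<kappa> \<le> log (a + 1), the power (a + 1)^Q dominates the exponential required of the
    constant.\<close>
  define Q where "Q = 41 * (7 * (2 * n + 4) * nat a + 1) * (4 * n + 10)"
  have c: "c u v = (real_of_int a + 1) ^ Q" for u v
  proof -
    have "denominator_fn ([p, nat a, nat b, n] @ [u, v]) = (nat a + 1) ^ Q"
      unfolding denominator_fn_def Q_def by simp
    moreover have "real (nat a + 1) = real_of_int a + 1" using ab by simp
    ultimately show ?thesis unfolding c_def by (simp only: of_nat_power)
  qed
  have c1: "c u v \<ge> (real_of_int a + 1) ^ 2" for u v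
  proof -
    have "2 \<le> Q" unfolding Q_def by (simp add: algebra_simps)
    thus ?thesis unfolding c using a2 by (intro power_increasing) auto
  qed
  have c2: "c u v \<ge> exp (41 * \<kappa> * real S * real (Suc w))" for u v
  proof -
    have M_le: "M \<le> 2 * real n + 4"
    proof -
      have "ln (2 * real n) \<le> 2 * real n - 1" using n by (intro ln_le_minus_one) simp
      moreover have "ln (2 * real n) / \<kappa> \<le> ln (2 * real n)"
        using \<kappa>1 n by (simp add: divide_le_eq mult_le_cancel_left1)
      ultimately show ?thesis unfolding M_def by simp
    qed
    \<comment> \<open>The chain is 1 \<le> \<kappa> = \<eta> log a \<le> \<eta> a.\<close>
    have "1 / \<eta> \<le> real_of_int a"
    proof -
      have "ln (real_of_int a) \<le> real_of_int a - 1" using a2 by (intro ln_le_minus_one) simp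
      hence "\<kappa> \<le> \<eta> * real_of_int a" unfolding \<kappa>_def using \<eta> by (intro mult_left_mono) auto
      thus ?thesis using \<kappa>1 \<eta> by (simp add: field_simps)
    qed
    hence "7 * M * (1 / \<eta>) \<le> 7 * (2 * real n + 4) * real_of_int a"
      using M_le M4 \<eta> by (intro mult_mono) auto
    hence "7 * M / \<eta> \<le> 7 * (2 * real n + 4) * real_of_int a" by simp
    also have "\<dots> = real (7 * (2 * n + 4) * nat a)" using ab by simp
    finally have S: "S \<le> 7 * (2 * n + 4) * nat a + 1" unfolding S_def by linarith
    have "2 * M \<le> real (4 * n + 8)" using M_le by simp
    hence w: "Suc w \<le> 4 * n + 10" unfolding w_def by linarith
    have "41 * S * Suc w \<le> Q" unfolding Q_def using S w by (intro mult_le_mono) auto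
    hence "real (41 * S * Suc w) \<le> real Q" by (simp only: of_nat_le_iff)
    hence SwQ: "41 * real S * real (Suc w) \<le> real Q" by (simp only: of_nat_mult of_nat_numeral)
    have la: "\<kappa> \<le> ln (real_of_int a + 1)"
    proof -
      have "\<kappa> \<le> 1 * ln (real_of_int a)" unfolding \<kappa>_def using \<eta> a2 by (intro mult_right_mono) auto
      also have "\<dots> \<le> ln (real_of_int a + 1)" using a2 by simp
      finally show ?thesis .
    qed
    have "41 * \<kappa> * real S * real (Suc w) = (41 * real S * real (Suc w)) * \<kappa>" by simp
    also have "\<dots> \<le> real Q * ln (real_of_int a + 1)" using SwQ la \<kappa>1 by (intro mult_mono) auto
    also have "\<dots> = ln ((real_of_int a + 1) ^ Q)" using a2 by (simp add: ln_realpow)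
    finally show ?thesis unfolding c using a2 by (subst ln_ge_iff[symmetric]) auto
  qed

  have "effective_irrationality_measure (\<lambda>xs. 1 / real (denominator_fn xs)) [p, nat a, nat b, n] p
    (padic_nth_root p n a b) (7 * M * real S)"
    unfolding effective_irrationality_measure_def
  proof (intro allI impI conjI)
    fix u v :: nat assume uv: "u \<ge> 1" "v \<ge> 1"
    show "1 / real (denominator_fn ([p, nat a, nat b, n] @ [u, v])) > 0" by (simp add: denominator_fn_def)
    fix r q :: int
    assume q: "q \<ge> 1" and ne: "padic_nth_root p n a b \<noteq> padic_of_rat p (of_int r / of_int q)"
    \<comment> \<open>The height is at least 1, so lowering the exponent by u / v weakens the
      bound.\<close>
    have "1 / c u v * real_of_int (max \<bar>r\<bar> q) powr (- (7 * M * real S) - real u / real v)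
      \<le> 1 / c u v * real_of_int (max \<bar>r\<bar> q) powr (- (7 * M * real S))"
      unfolding c using q a2 by (intro mult_left_mono powr_mono) auto
    also have "\<dots> < padic_dist p (padic_nth_root p n a b) (padic_of_rat p (of_int r / of_int q))"
      by (rule padic_root_approximation[OF p ab pab pEdvd E1 n(2) \<kappa>E \<kappa>1 \<eta> \<kappa>_def M4 nM w_def S_def q ne c1 c2])
    finally show "1 / real (denominator_fn ([p, nat a, nat b, n] @ [u, v])) *
        real_of_int (max \<bar>r\<bar> q) powr (- (7 * M * real S) - real u / real v)
      < padic_dist p (padic_nth_root p n a b) (padic_of_rat p (of_int r / of_int q))"
      unfolding c_def .
  qed
  hence "mu_eff (\<lambda>xs. 1 / real (denominator_fn xs)) [p, nat a, nat b, n] p (padic_nth_root p n a b)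
    \<le> ereal (7 * M * real S)"
    unfolding mu_eff_def by (intro INF_lower) simp
  also have "7 * M * real S < 53.8 / \<eta> * M\<^sup>2"
  proof -
    have "7 * M / \<eta> \<ge> 0" using M4 \<eta> by simp
    hence "real S \<le> 7 * M / \<eta> + 1" unfolding S_def by linarith
    \<comment> \<open>Rounding 7 M / \<eta> up adds at most 1, which M \<ge> 4 and \<eta> < 1 turn
      into M / (4 \<eta>). The resulting constant is 7 (7 + 1/4) = 50.75.\<close>
    also have "1 \<le> M / (4 * \<eta>)" using M4 \<eta> by (simp add: field_simps)
    finally have "real S \<le> 29 / 4 * M / \<eta>" by (simp add: field_simps)
    hence "7 * M * real S \<le> 7 * M * (29 / 4 * M / \<eta>)" using M4 by (intro mult_left_mono) auto
    also have "\<dots> = 50.75 * (M\<^sup>2 / \<eta>)" by (simp add: power2_eq_square)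
    also have "\<dots> < 53.8 * (M\<^sup>2 / \<eta>)" using M4 \<eta> by (intro mult_strict_right_mono) auto
    finally show ?thesis by simp
  qed
  hence "ereal (7 * M * real S) < ereal (53.8 / \<eta> * M\<^sup>2)" by simp
  finally show "mu_eff (\<lambda>xs. 1 / real (denominator_fn xs)) [p, nat a, nat b, n] p (padic_nth_root p n a b)
    < ereal (53.8 / \<eta> * (max (ln (2 * real n) / (\<eta> * ln (real_of_int a))) 4)\<^sup>2)"
    unfolding M_def \<kappa>_def .
qed

end
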